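(* Let $N\ge 1$ and let $a$ be either a positive integrable function on $(0,2]$ or, more generally, a positive distribution on $(0,2]$ (a nonzero finite nonnegative Borel measure, written $a(\alpha)\,d\alpha$) whose singular support does not contain $2$ (this last condition concerns only the case of distributions). Fix $t>0$. For $n=1,2,\dots$ let $\tau=\tau_n=t/n$ and let $h=h_n>0$ be mesh widths with $h_n\to 0$ as $n\to\infty$, such that for every $n$ $$\sigma(\tau,h):=2\tau\sum_{m\in\mathbb{Z}^N,\,m\neq 0}\frac{Q_m(h)}{|m|^N}\le 1 ,\qquad Q_m(h)=\int_0^2 |m|^{-\alpha}\,\frac{a(\alpha)b(\alpha)}{h^{\alpha}}\,d\alpha ,$$ where $b(\alpha)$ is the constant defined in the context. For each $n$ let $\mathbf{X}$ be a $\mathbb{Z}^N$-valued random vector with $P(\mathbf{X}=k)=p_k$, $k\in\mathbb{Z}^N$, where $$p_k=\begin{cases}1-2\tau\displaystyle\sum_{m\neq 0}\frac{Q_m(h)}{|m|^N}, & k=0,\\[2mm] 2\tau\,\dfrac{Q_k(h)}{|k|^N}, & k\neq 0,\end{cases}$$ let $\mathbf{X}_1,\dots,\mathbf{X}_n$ be independent random vectors with the same distribution as $\mathbf{X}$, and put $\mathbf{S}_n=h\mathbf{X}_1+\cdots+h\mathbf{X}_n$ (with $\tau=\tau_n$, $h=h_n$). Then, as $n\to\infty$, $\mathbf{S}_n$ converges in law to a random vector in $\mathbb{R}^N$ whose probability density function is $G(t,\cdot)$, where $G$ is the fundamental solution of the distributed space fractional order differential equation $$\frac{\partial}{\partial t}u(t,x)=\int_0^2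 a(\alpha)\,D_0^{\alpha}u(t,x)\,d\alpha,\qquad t>0,\ x\in\mathbb{R}^N .$$
   Context: $|\cdot|$ denotes the Euclidean norm. For $0<\alpha\le 2$, $D_0^\alpha=-(-\Delta)^{\alpha/2}$ is the pseudo-differential operator on $\mathbb{R}^N$ with symbol $-|\xi|^\alpha$. The constant $b(\alpha)$ is $$b(\alpha)=\frac{\alpha\,\Gamma(\frac{\alpha}{2})\,\Gamma(\frac{N+\alpha}{2})\,\sin\frac{\alpha\pi}{2}}{2^{2-\alpha}\,\pi^{1+N/2}} .$$ The fundamental solution of the equation is the solution $G(t,x)$ (in the weak sense) with initial condition $G(0,x)=\delta(x)$ (Dirac distribution). It is given by $G(t,\cdot)=F^{-1}\big(e^{t\mathcal{B}(\xi)}\big)$, where $F^{-1}$ is the inverse Fourier transform and $\mathcal{B}(\xi)=-\int_0^2 a(\alpha)|\xi|^\alpha\,d\alpha$; that is, the characteristic function of the law with density $G(t,\cdot)$ is $e^{t\mathcal{B}(\xi)}$. The condition that the singular support of the distribution $a$ does not contain $2$ means that $a$ coincides with a smooth function near $\alpha=2$; in particular it has no atom at $2$. The integrals $\int_0^2\dots a(\alpha)\,d\alpha$ are over $(0,2]$ and are integrals against the measure $a$ in the distribution case. Random walk interpretation: a particle starts at the origin and at times $t_j=j\tau$ jumps on the lattice $h\mathbb{Z}^N$ by $h\mathbf{X}_j$, so $\mathbf{S}_n$ is its position at time $t=n\tau$. The law of $\mathbf{X}$ depends on $(\tau,h)$, hence on $n$. *)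

theory Defs
  imports "HOL-Probability.Probability"
begin

section \<open>Weights on \<open>(0,2]\<close>\<close>

definition smooth_at_ball :: "(real \<Rightarrow> real) \<Rightarrow> real \<Rightarrow> real \<Rightarrow> bool" where
  "smooth_at_ball \<rho> x e \<longleftrightarrow>
     (\<forall>k. \<forall>y\<in>ball x e. (deriv ^^ k) \<rho> field_differentiable (at y))"

text \<open>
  A positive distribution on \<open>(0,2]\<close> is a measure \<open>A\<close> on the Borel sets of the line that is
  carried by \<open>(0,2]\<close>.  A point \<open>x\<close> of \<open>(0,2]\<close> is outside the singular support if \<open>A\<close> has a smooth
  density on a neighbourhood of \<open>x\<close> relative to \<open>(0,2]\<close>.  At the end point \<open>x = 2\<close> the density
  is smooth up to and including \<open>2\<close>; an atom at \<open>2\<close> is excluded.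
\<close>

definition sing_supp :: "real measure \<Rightarrow> real set" where
  "sing_supp A = {x \<in> {0<..2}. \<not> (\<exists>e>0. \<exists>\<rho>. smooth_at_ball \<rho> x e \<and>
      (\<forall>y \<in> ball x e \<inter> {0<..2}. 0 \<le> \<rho> y) \<and>
      (\<forall>E \<in> sets borel. E \<subseteq> ball x e \<inter> {0<..2} \<longrightarrow>
         emeasure A E = (\<integral>\<^sup>+ y. ennreal (\<rho> y) * indicator E y \<partial>lborel)))}"

definition function_weight :: "real measure \<Rightarrow> bool" where
  "function_weight A \<longleftrightarrow> (\<exists>a. set_integrable lborel {0<..2} a \<and> (\<forall>\<alpha>\<in>{0<..2}. 0 \<le> a \<alpha>) \<and>
      A = density lborel (\<lambda>\<alpha>. ennreal (indicator {0<..2} \<alpha> * a \<alpha>)))"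

definition admissible_weight :: "real measure \<Rightarrow> bool" where
  "admissible_weight A \<longleftrightarrow>
     finite_measure A \<and> sets A = sets borel \<and>
     emeasure A (- {0<..2}) = 0 \<and> emeasure A {0<..2} \<noteq> 0 \<and>
     (function_weight A \<or> 2 \<notin> sing_supp A)"


section \<open>The random walk\<close>

definition lat :: "int ^ 'n \<Rightarrow> real ^ 'n" where
  "lat m = (\<chi> i. real_of_int (m $ i))"

definition bconst :: "nat \<Rightarrow> real \<Rightarrow> real" where
  "bconst N \<alpha> = \<alpha> * Gamma (\<alpha> / 2) * Gamma ((real N + \<alpha>) / 2) * sin (\<alpha> * pi / 2)
     / (2 powr (2 - \<alpha>) * pi powr (1 + real N / 2))"

definition Q :: "real measure \<Rightarrow> real \<Rightarrow> int ^ 'n \<Rightarrow> real" where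
  "Q A h m = (\<integral>\<alpha>. norm (lat m) powr (- \<alpha>) * (bconst CARD('n) \<alpha> / h powr \<alpha>) \<partial>A)"

text \<open>The type argument carries the dimension \<open>N\<close>, on which the sum depends.\<close>

definition jump_sigma :: "'n::finite itself \<Rightarrow> real measure \<Rightarrow> real \<Rightarrow> real \<Rightarrow> real" where
  "jump_sigma _ A \<tau> h =
     2 * \<tau> * (\<Sum>\<^sub>\<infinity>m\<in>- {0 :: int ^ 'n}. Q A h m / norm (lat m) ^ CARD('n))"

definition jump_prob :: "real measure \<Rightarrow> real \<Rightarrow> real \<Rightarrow> int ^ 'n \<Rightarrow> real" where
  "jump_prob A \<tau> h k =
     (if k = 0 then 1 - jump_sigma TYPE('n) A \<tau> h
      else 2 * \<tau> * (Q A h k / norm (lat k) ^ CARD('n)))"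

definition converges_in_law :: "(nat \<Rightarrow> 'a::topological_space measure) \<Rightarrow> 'a measure \<Rightarrow> bool" where
  "converges_in_law \<mu> \<nu> \<longleftrightarrow>
     (\<forall>f :: 'a \<Rightarrow> real. continuous_on UNIV f \<and> bounded (range f) \<longrightarrow>
        (\<lambda>n. \<integral>x. f x \<partial>\<mu> n) \<longlonglongrightarrow> (\<integral>x. f x \<partial>\<nu>))"


section \<open>The distributed order equation\<close>

text \<open>
  The Fourier transform is normalised as in the definition of characteristic functions.
\<close>

definition fourier :: "(real ^ 'n \<Rightarrow> complex) \<Rightarrow> real ^ 'n \<Rightarrow> complex" where
  "fourier f \<xi> = (\<integral>x. iexp (\<xi> \<bullet> x) * f x \<partial>lborel)"

definition inv_fourier :: "(real ^ 'n \<Rightarrow> complex) \<Rightarrow> real ^ 'n \<Rightarrow> complex" where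
  "inv_fourier f x =
     complex_of_real (1 / (2 * pi) ^ CARD('n)) * (\<integral>\<xi>. iexp (- (\<xi> \<bullet> x)) * f \<xi> \<partial>lborel)"

primrec iter_deriv :: "(real ^ 'n) list \<Rightarrow> (real ^ 'n \<Rightarrow> complex) \<Rightarrow> real ^ 'n \<Rightarrow> complex" where
  "iter_deriv [] f = f"
| "iter_deriv (v # vs) f = (\<lambda>x. frechet_derivative (iter_deriv vs f) (at x) v)"

definition schwartz :: "(real ^ 'n \<Rightarrow> complex) \<Rightarrow> bool" where
  "schwartz f \<longleftrightarrow> (\<forall>vs. (\<forall>x. iter_deriv vs f differentiable (at x)) \<and>
     (\<forall>k::nat. bounded (range (\<lambda>x. norm x ^ k *\<^sub>R iter_deriv vs f x))))"

definition D0 :: "real \<Rightarrow> (real ^ 'n \<Rightarrow> complex) \<Rightarrow> real ^ 'n \<Rightarrow> complex" where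
  "D0 \<alpha> f = inv_fourier (\<lambda>\<xi>. complex_of_real (- (norm \<xi> powr \<alpha>)) * fourier f \<xi>)"

definition distributed_D0 :: "real measure \<Rightarrow> (real ^ 'n \<Rightarrow> complex) \<Rightarrow> real ^ 'n \<Rightarrow> complex" where
  "distributed_D0 A f x = (\<integral>\<alpha>. D0 \<alpha> f x \<partial>A)"

definition Bsym :: "real measure \<Rightarrow> real ^ 'n \<Rightarrow> real" where
  "Bsym A \<xi> = - (\<integral>\<alpha>. norm \<xi> powr \<alpha> \<partial>A)"

text \<open>
  Weak solution of the Cauchy problem with initial value the Dirac distribution: the equation
  holds after pairing with Schwartz functions.  The operators \<open>D0\<close> have even symbols and
  are therefore their own transposes.
\<close>

definition fundamental_solution :: "real measure \<Rightarrow> (real \<Rightarrow> real ^ 'n \<Rightarrow> real) \<Rightarrow> bool" where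
  "fundamental_solution A G \<longleftrightarrow>
     (\<forall>t>0. integrable lborel (G t)) \<and>
     (\<forall>\<phi>. schwartz \<phi> \<longrightarrow>
        (\<forall>t>0. ((\<lambda>s. \<integral>x. G s x *\<^sub>R \<phi> x \<partial>lborel) has_vector_derivative
                   (\<integral>x. G t x *\<^sub>R distributed_D0 A \<phi> x \<partial>lborel)) (at t)) \<and>
        ((\<lambda>t. \<integral>x. G t x *\<^sub>R \<phi> x \<partial>lborel) \<longlongrightarrow> \<phi> 0) (at_right 0))"

end

theory Submission
  imports Defs
begin

text \<open>
  One step of the walk has characteristic function \<open>1 - \<tau> * \<psi>\<close>, where \<open>\<psi> \<xi>\<close> is the integral over the
  orders \<open>\<alpha>\<close> and over space of \<open>2 * b(\<alpha>) * (1 - cos (\<xi> \<bullet> y)) * |y| powr (- N - \<alpha>)\<close> with \<open>y\<close> rounded to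
  the lattice \<open>h * Z^N\<close>.  Since \<open>b(\<alpha>)\<close> is the normalising constant of the fractional Laplacian and
  there is no atom at \<open>2\<close>, where \<open>b\<close> vanishes, dominated convergence gives
  \<open>\<psi> \<xi> \<longlonglongrightarrow> - Bsym A \<xi>\<close>, so the characteristic functions of the walk tend to
  \<open>exp (t * Bsym A \<xi>)\<close>.  This limit is integrable, so a Gaussian regularisation shows that it is
  the Fourier transform of a probability density, and the continuity theorem applies.  Times
  \<open>s \<noteq> t\<close> are reached by taking \<open>\<lfloor>n * s / t\<rfloor>\<close> steps instead of \<open>n\<close>.
\<close>

section \<open>Gaussian integrals and the heat kernel\<close>

text \<open>The obstacle is a majorant for \<psi> that is uniform in the mesh h and in the order
  \<alpha>. The integral of the kernel without the factor b blows up as \<alpha> tends to 0 (through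
  large y) and as \<alpha> tends to 2 (through small y); only the zeros of b at 0 and 2 compensate.
  Instead of estimating b, the exact identity for |\<xi>|^\<alpha> is averaged over a Gaussian
  \<xi>: \<open>1 - cos\<close> becomes \<open>1 - gauss\<close>, and the other side is at most 1
  plus a second moment, whatever \<alpha> is. Rounding y to the lattice costs only a constant
  factor, because the cell of the origin contributes nothing and elsewhere the rounded point is
  comparable with y. Powers of 1 - \<tau> \<psi> are compared with powers of exp (- \<tau> \<psi>)
  through |c^m - w^m| \<le> m |c - w|, valid since a characteristic function has modulus at most 1.
  Integrability of the limit comes from a positive mass of \<open>A\<close> on some [\<epsilon>, 2],
  which makes the exponent grow at least like |\<xi>|^\<epsilon>. The fundamental solution needs an
  integrable G(s) at every s > 0, which is why other numbers of steps are considered at all.\<close>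

lemma has_bochner_integral_lborel_prod:
  fixes f :: "'a::euclidean_space \<Rightarrow> real \<Rightarrow> 'b::{real_normed_field,banach,second_countable_topology}"
  assumes "\<And>b. b \<in> Basis \<Longrightarrow> has_bochner_integral lborel (f b) (I b)"
  shows "has_bochner_integral (lborel :: 'a measure) (\<lambda>x. \<Prod>b\<in>Basis. f b (x \<bullet> b)) (\<Prod>b\<in>Basis. I b)"
proof -
  interpret product_sigma_finite "\<lambda>_::'a. lborel :: real measure" ..
  have int: "integrable lborel (f b)" and val: "integral\<^sup>L lborel (f b) = I b" if "b \<in> Basis" for b
    using assms[OF that] by (auto simp: has_bochner_integral_iff)
  have [measurable]: "f b \<in> borel_measurable borel" if "b \<in> Basis" for b
    using int[OF that] by (auto dest: borel_measurable_integrable)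
  have coord: "(\<Prod>b\<in>Basis. f b ((\<Sum>c\<in>Basis. g c *\<^sub>R c) \<bullet> b)) = (\<Prod>b\<in>Basis. f b (g b))" for g :: "'a \<Rightarrow> real"
    by (intro prod.cong refl) simp
  have "integrable (\<Pi>\<^sub>M b\<in>(Basis :: 'a set). lborel) (\<lambda>g. \<Prod>b\<in>Basis. f b (g b))"
    by (intro product_integrable_prod int) auto
  moreover have "(\<integral>g. (\<Prod>b\<in>Basis. f b (g b)) \<partial>(\<Pi>\<^sub>M b\<in>(Basis :: 'a set). lborel)) = (\<Prod>b\<in>Basis. I b)"
    by (subst product_integral_prod) (auto simp: int val)
  \<comment> \<open>By \<open>lborel_eq\<close>, Lebesgue measure is the image of the product
    measure on coordinates under this basis expansion.\<close>
  moreover have T: "(\<lambda>g. \<Sum>b\<in>Basis. g b *\<^sub>R b) \<in> (\<Pi>\<^sub>M b\<in>(Basis :: 'a set). lborel) \<rightarrow>\<^sub>M borel"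
    by measurable
  moreover have F: "(\<lambda>x::'a. \<Prod>b\<in>Basis. f b (x \<bullet> b)) \<in> borel_measurable borel" by measurable
  ultimately show ?thesis
    unfolding has_bochner_integral_iff lborel_eq[where 'a='a]
    by (simp only: integrable_distr_eq[OF T F] integral_distr[OF T F] coord simp_thms)
qed

lemma has_bochner_integral_lborel_affine:
  fixes f :: "'a::euclidean_space \<Rightarrow> 'b::{banach,second_countable_topology}"
  assumes f: "has_bochner_integral lborel f I" and c: "c \<noteq> 0"
  shows "has_bochner_integral lborel (\<lambda>x. f (t + c *\<^sub>R x)) (I /\<^sub>R \<bar>c\<bar> ^ DIM('a))"
proof -
  have [measurable]: "f \<in> borel_measurable borel"
    using f by (auto dest: borel_measurable_has_bochner_integral)
  have pw: "ennreal \<bar>c\<bar> ^ DIM('a) = ennreal (\<bar>c\<bar> ^ DIM('a))" by (simp add: ennreal_power)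
  have "has_bochner_integral (density (distr lborel borel (\<lambda>x. t + c *\<^sub>R x)) (\<lambda>_. \<bar>c\<bar>^DIM('a))) f I"
    using f lborel_affine[OF c, of t] by (simp add: pw)
  then have int: "integrable lborel (\<lambda>x. \<bar>c\<bar>^DIM('a) *\<^sub>R f (t + c *\<^sub>R x))"
     and "(\<integral>x. \<bar>c\<bar>^DIM('a) *\<^sub>R f (t + c *\<^sub>R x) \<partial>lborel) = I"
    unfolding has_bochner_integral_iff
    by (simp_all add: integrable_density integral_density integrable_distr_eq integral_distr)
  then show ?thesis
    using c integrable_scaleR_right[of "1 / \<bar>c\<bar>^DIM('a)", OF int] by (auto simp: has_bochner_integral_iff)
qed

lemma gaussian_fourier_real:
  fixes a \<xi> :: real
  assumes a: "a > 0"
  shows "has_bochner_integral lborel (\<lambda>x. iexp (\<xi> * x) * complex_of_real (exp (- a * x\<^sup>2)))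
           (complex_of_real (sqrt (pi / a) * exp (- (1 / (4 * a)) * \<xi>\<^sup>2)))"
proof -
  \<comment> \<open>Chosen so that (c x)^2 / 2 = a x^2: rescaling by c reduces the claim to the
    characteristic function of the standard normal law.\<close>
  define c where "c = sqrt (2 * a)"
  have c: "c > 0" "c\<^sup>2 = 2 * a" using a by (auto simp: c_def)
  have "integrable lborel (\<lambda>x. iexp (\<xi> / c * x) * complex_of_real (std_normal_density x))"
    by (rule Bochner_Integration.integrable_bound[OF integrable_normal_moment_abs[of 1 0 0]])
       (auto simp: norm_mult)
  moreover have "(\<integral>x. iexp (\<xi> / c * x) * complex_of_real (std_normal_density x) \<partial>lborel)
      = complex_of_real (exp (- (\<xi> / c)\<^sup>2 / 2))"
    using fun_cong[OF char_std_normal_distribution, of "\<xi> / c"]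
    by (simp add: char_def integral_density scaleR_conv_of_real mult.commute)
  ultimately have "has_bochner_integral lborel (\<lambda>x. iexp (\<xi> / c * x) * complex_of_real (std_normal_density x))
      (complex_of_real (exp (- (\<xi> / c)\<^sup>2 / 2)))"
    by (simp add: has_bochner_integral_iff)
  from has_bochner_integral_lborel_affine[OF this, of c 0] c
  have "has_bochner_integral lborel (\<lambda>x. iexp (\<xi> * x) * complex_of_real (std_normal_density (c * x)))
      (complex_of_real (exp (- (\<xi> / c)\<^sup>2 / 2)) /\<^sub>R c)" by simp
  from has_bochner_integral_mult_right[OF this, of "complex_of_real (sqrt (2 * pi))"]
  have *: "has_bochner_integral lborel
      (\<lambda>x. complex_of_real (sqrt (2 * pi)) * (iexp (\<xi> * x) * complex_of_real (std_normal_density (c * x))))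
      (complex_of_real (sqrt (2 * pi)) * (complex_of_real (exp (- (\<xi> / c)\<^sup>2 / 2)) /\<^sub>R c))" by simp
  have 1: "complex_of_real (sqrt (2 * pi)) * (z * complex_of_real (std_normal_density (c * x)))
     = z * complex_of_real (exp (- a * x\<^sup>2))" for x z
    using c by (simp add: normal_density_def power_mult_distrib scaleR_conv_of_real)
  have 2: "complex_of_real (sqrt (2 * pi)) * (complex_of_real (exp (- (\<xi> / c)\<^sup>2 / 2)) /\<^sub>R c)
     = complex_of_real (sqrt (pi / a) * exp (- (1 / (4 * a)) * \<xi>\<^sup>2))"
    using c a by (simp add: power_divide scaleR_conv_of_real real_sqrt_divide real_sqrt_mult c_def field_simps)
  show ?thesis using * unfolding 1 2 .
qed

lemma norm_power2_Basis: "(norm x)\<^sup>2 = (\<Sum>b\<in>Basis. (x \<bullet> b)\<^sup>2)" for x :: "'a::euclidean_space"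
  by (subst power2_norm_eq_inner, subst euclidean_inner) (simp add: power2_eq_square)

definition gauss :: "real \<Rightarrow> 'a::euclidean_space \<Rightarrow> real" where
  "gauss a x = exp (- a * (norm x)\<^sup>2)"

lemma gauss_pos: "gauss a x > 0" by (simp add: gauss_def)

lemma gauss_commute: "gauss a (x - y) = gauss a (y - x)" by (simp add: gauss_def norm_minus_commute)

lemma gauss_measurable [measurable]: "gauss a \<in> borel_measurable borel"
  unfolding gauss_def by measurable

lemma gaussian_fourier:
  fixes \<xi> :: "'a::euclidean_space"
  assumes a: "a > 0"
  shows "has_bochner_integral lborel (\<lambda>x. complex_of_real (gauss a x) * iexp (\<xi> \<bullet> x))
           (complex_of_real (sqrt (pi / a) ^ DIM('a) * gauss (1 / (4 * a)) \<xi>))"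
proof -
  have "has_bochner_integral lborel
     (\<lambda>x::'a. \<Prod>b\<in>Basis. iexp ((\<xi> \<bullet> b) * (x \<bullet> b)) * complex_of_real (exp (- a * (x \<bullet> b)\<^sup>2)))
     (\<Prod>b\<in>Basis. complex_of_real (sqrt (pi / a) * exp (- (1 / (4 * a)) * (\<xi> \<bullet> b)\<^sup>2)))"
    by (rule has_bochner_integral_lborel_prod) (rule gaussian_fourier_real[OF a])
  moreover have "(\<Prod>b\<in>Basis. iexp ((\<xi> \<bullet> b) * (x \<bullet> b)) * complex_of_real (exp (- a * (x \<bullet> b)\<^sup>2)))
     = complex_of_real (gauss a x) * iexp (\<xi> \<bullet> x)" for x :: 'a
    unfolding prod.distrib of_real_prod[symmetric]
    by (simp add: gauss_def norm_power2_Basis sum_distrib_left exp_sum[symmetric]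
        sum_negf[symmetric] euclidean_inner[of \<xi> x] mult.commute)
  moreover have "(\<Prod>b\<in>Basis. complex_of_real (sqrt (pi / a) * exp (- (1 / (4 * a)) * (\<xi> \<bullet> b)\<^sup>2)))
     = complex_of_real (sqrt (pi / a) ^ DIM('a) * gauss (1 / (4 * a)) \<xi>)"
    unfolding of_real_prod[symmetric]
    by (simp add: prod.distrib gauss_def norm_power2_Basis sum_distrib_left exp_sum[symmetric]
        sum_negf[symmetric])
  ultimately show ?thesis by simp
qed

lemma has_bochner_integral_gauss:
  assumes "a > 0"
  shows "has_bochner_integral lborel (gauss a :: 'a::euclidean_space \<Rightarrow> real) (sqrt (pi / a) ^ DIM('a))"
  using has_bochner_integral_bounded_linear[OF bounded_linear_Re gaussian_fourier[OF assms, of "0::'a"]]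
  by (simp add: gauss_def[abs_def])

lemma integrable_gauss [intro]: "a > 0 \<Longrightarrow> integrable lborel (gauss a :: 'a::euclidean_space \<Rightarrow> real)"
  using has_bochner_integral_gauss by (auto simp: has_bochner_integral_iff)

text \<open>The kernel of the heat semigroup at time a, a centred Gaussian density of variance 2 a
  in each coordinate. Its Fourier transform is \<open>gauss a\<close>, so damping a transform by
  \<open>gauss a\<close> amounts to convolving with \<open>heat a\<close>.\<close>

definition heat :: "real \<Rightarrow> 'a::euclidean_space \<Rightarrow> real" where
  "heat a x = gauss (1 / (4 * a)) x / sqrt (4 * pi * a) ^ DIM('a)"

lemma heat_nonneg: "a > 0 \<Longrightarrow> heat a x \<ge> 0" by (simp add: heat_def gauss_def)

lemma heat_commute: "heat a (x - y) = heat a (y - x)" by (simp add: heat_def gauss_commute)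

lemma heat_measurable [measurable]: "heat a \<in> borel_measurable borel"
  unfolding heat_def by measurable

lemma heat_bound: "a > 0 \<Longrightarrow> \<bar>heat a (x::'a::euclidean_space)\<bar> \<le> 1 / sqrt (4 * pi * a) ^ DIM('a)"
  by (simp add: heat_def gauss_def abs_mult divide_right_mono)

lemma has_bochner_integral_heat:
  assumes "a > 0"
  shows "has_bochner_integral lborel (heat a :: 'a::euclidean_space \<Rightarrow> real) 1"
proof -
  have *: "sqrt (pi / (1 / (4 * a))) = sqrt (4 * pi * a)" by simp
  have "has_bochner_integral lborel (\<lambda>x::'a. gauss (1 / (4 * a)) x / sqrt (4 * pi * a) ^ DIM('a))
      (sqrt (pi / (1 / (4 * a))) ^ DIM('a) / sqrt (4 * pi * a) ^ DIM('a))"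
    using assms by (intro has_bochner_integral_divide_zero has_bochner_integral_gauss) auto
  then show ?thesis unfolding * heat_def[abs_def] using assms by simp
qed

lemma gaussian_inverse_fourier:
  fixes x :: "'a::euclidean_space"
  assumes a: "a > 0"
  shows "has_bochner_integral lborel (\<lambda>\<xi>. complex_of_real (gauss a \<xi>) * iexp (x \<bullet> \<xi>))
           (complex_of_real ((2 * pi) ^ DIM('a) * heat a x))"
proof -
  have "sqrt (pi / a) = 2 * pi / sqrt (4 * pi * a)"
    using a by (simp add: real_sqrt_divide real_sqrt_mult field_simps)
  then have "sqrt (pi / a) ^ DIM('a) * gauss (1 / (4 * a)) x = (2 * pi) ^ DIM('a) * heat a x"
    by (simp add: heat_def power_divide)
  then show ?thesis using gaussian_fourier[OF a, of x] by simp
qed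

lemma heat_scale:
  assumes a: "a > 0"
  shows "heat a (sqrt a *\<^sub>R x) * sqrt a ^ DIM('a) = heat 1 (x::'a::euclidean_space)"
  using a by (simp add: heat_def gauss_def power_mult_distrib real_sqrt_mult)

text \<open>The substitution y = x + sqrt a z moves the parameter from the kernel into f, so that
  all estimates are made against the one density \<open>heat 1\<close>.\<close>

lemma has_bochner_integral_heat_convolution:
  fixes f :: "'a::euclidean_space \<Rightarrow> 'b::{banach,second_countable_topology}"
  assumes a: "a > 0" and [measurable]: "f \<in> borel_measurable borel" and B: "\<And>x. norm (f x) \<le> B"
  shows "has_bochner_integral lborel (\<lambda>y. heat a (x - y) *\<^sub>R f y) (\<integral>z. heat 1 z *\<^sub>R f (x + sqrt a *\<^sub>R z) \<partial>lborel)"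
proof -
  have "has_bochner_integral lborel (\<lambda>z::'a. heat 1 z *\<^sub>R f (x + sqrt a *\<^sub>R z))
     (\<integral>z. heat 1 z *\<^sub>R f (x + sqrt a *\<^sub>R z) \<partial>lborel)" (is "has_bochner_integral _ _ ?I")
    unfolding has_bochner_integral_iff
  proof
    show "integrable lborel (\<lambda>z::'a. heat 1 z *\<^sub>R f (x + sqrt a *\<^sub>R z))"
    proof (rule Bochner_Integration.integrable_bound)
      show "integrable lborel (\<lambda>z::'a. B * heat 1 z)"
        using has_bochner_integral_heat[of 1, where 'a='a] by (auto simp: has_bochner_integral_iff)
      have "norm (heat 1 z *\<^sub>R f (x + sqrt a *\<^sub>R z)) \<le> norm (B * heat 1 z)" for z
        using mult_right_mono[OF order.trans[OF B abs_ge_self], of "heat 1 z"]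
        by (simp add: abs_mult heat_nonneg mult.commute[of "heat 1 z"])
      then show "AE z in lborel. norm (heat 1 z *\<^sub>R f (x + sqrt a *\<^sub>R z)) \<le> norm (B * heat 1 z)" by simp
    qed measurable
  qed simp
  from has_bochner_integral_lborel_affine[OF this, of "1 / sqrt a" "- x /\<^sub>R sqrt a"] a
  have "has_bochner_integral lborel
    (\<lambda>y::'a. heat 1 ((y - x) /\<^sub>R sqrt a) *\<^sub>R f y) (sqrt a ^ DIM('a) *\<^sub>R ?I)"
    by (simp add: scaleR_diff_right divide_simps algebra_simps power_divide)
  from has_bochner_integral_scaleR_right[OF this, of "1 / sqrt a ^ DIM('a)"]
  have "has_bochner_integral lborel
    (\<lambda>y::'a. (heat 1 ((y - x) /\<^sub>R sqrt a) / sqrt a ^ DIM('a)) *\<^sub>R f y) ?I" using a by simp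
  moreover have "heat 1 ((y - x) /\<^sub>R sqrt a) / sqrt a ^ DIM('a) = heat a (x - y)" for y :: 'a
    using heat_scale[OF a, of "(y - x) /\<^sub>R sqrt a"] a by (simp add: heat_commute[of a x y] field_simps)
  ultimately show ?thesis by simp
qed

lemma heat_convolution_tendsto:
  fixes f :: "'a::euclidean_space \<Rightarrow> 'b::{banach,second_countable_topology}" and a :: "nat \<Rightarrow> real"
  assumes f: "continuous_on UNIV f" and B: "\<And>x. norm (f x) \<le> B"
    and a: "a \<longlonglongrightarrow> 0" "\<And>n. a n > 0"
  shows "(\<lambda>n. \<integral>y. heat (a n) (x - y) *\<^sub>R f y \<partial>lborel) \<longlonglongrightarrow> f x"
proof -
  have [measurable]: "f \<in> borel_measurable borel" using f by (rule borel_measurable_continuous_onI)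
  have "(\<lambda>n. \<integral>z. heat 1 z *\<^sub>R f (x + sqrt (a n) *\<^sub>R z) \<partial>lborel) \<longlonglongrightarrow> (\<integral>z. heat 1 (z::'a) *\<^sub>R f x \<partial>lborel)"
  proof (rule integral_dominated_convergence[where w="\<lambda>z. B * heat 1 z"])
    show "integrable lborel (\<lambda>z::'a. B * heat 1 z)"
      using has_bochner_integral_heat[of 1, where 'a='a] by (auto simp: has_bochner_integral_iff)
    show "AE z in lborel. (\<lambda>n. heat 1 z *\<^sub>R f (x + sqrt (a n) *\<^sub>R z)) \<longlonglongrightarrow> heat 1 z *\<^sub>R f x"
    proof (intro AE_I2 tendsto_intros)
      fix z :: 'a
      have "(\<lambda>n. x + sqrt (a n) *\<^sub>R z) \<longlonglongrightarrow> x + sqrt 0 *\<^sub>R z" by (intro tendsto_intros a)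
      then show "(\<lambda>n. f (x + sqrt (a n) *\<^sub>R z)) \<longlonglongrightarrow> f x"
        using f by (intro continuous_on_tendsto_compose[OF f]) auto
    qed
    show "AE z in lborel. norm (heat 1 z *\<^sub>R f (x + sqrt (a n) *\<^sub>R z)) \<le> B * heat 1 z" for n
      using B by (auto simp: heat_nonneg mult.commute[of B] intro!: mult_left_mono)
  qed measurable
  moreover have "(\<integral>y. heat (a n) (x - y) *\<^sub>R f y \<partial>lborel) = (\<integral>z. heat 1 z *\<^sub>R f (x + sqrt (a n) *\<^sub>R z) \<partial>lborel)" for n
    using has_bochner_integral_heat_convolution[where f=f and x=x and B=B, OF a(2) _ B, of n]
    by (simp add: has_bochner_integral_iff)
  moreover have "(\<integral>z. heat 1 (z::'a) *\<^sub>R f x \<partial>lborel) = f x"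
    using has_bochner_integral_heat[of 1, where 'a='a] by (simp add: has_bochner_integral_iff)
  ultimately show ?thesis by simp
qed

text \<open>Fubini applies because the integrand is dominated by K |f x| |g y|. The measures are
  left general: the lemma is used with probability measures, with Lebesgue measure on both sides,
  and with the measure \<open>A\<close> on orders.\<close>

lemma integral_swap_bounded_kernel:
  fixes f :: "'a \<Rightarrow> 'c::{real_normed_field,banach,second_countable_topology}" and g :: "'b \<Rightarrow> 'c"
  assumes "sigma_finite_measure M" "sigma_finite_measure N"
    and f: "integrable M f" and g: "integrable N g"
    and k [measurable]: "case_prod k \<in> borel_measurable (M \<Otimes>\<^sub>M N)"
    and K: "\<And>x y. norm (k x y) \<le> K"
  shows "(\<integral>x. f x * (\<integral>y. g y * k x y \<partial>N) \<partial>M) = (\<integral>y. g y * (\<integral>x. f x * k x y \<partial>M) \<partial>N)" (is ?eq)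
    and "integrable M (\<lambda>x. f x * (\<integral>y. g y * k x y \<partial>N))" (is ?int)
proof -
  interpret sigma_finite_measure M by fact
  interpret N: sigma_finite_measure N by fact
  interpret pair_sigma_finite M N ..
  have [measurable]: "f \<in> borel_measurable M" "g \<in> borel_measurable N" using f g by auto
  have gk: "integrable N (\<lambda>y. g y * k x y)" if [measurable]: "x \<in> space M" for x
  proof (rule Bochner_Integration.integrable_bound[of N "\<lambda>y. K * norm (g y)"])
    show "integrable N (\<lambda>y. K * norm (g y))" using g by auto
    show "AE y in N. norm (g y * k x y) \<le> norm (K * norm (g y))"
      using K order.trans[OF norm_ge_zero K]
      by (auto simp: norm_mult mult.commute[of K] abs_mult intro!: AE_I2 mult_left_mono)
  qed measurable
  have K0: "K \<ge> 0" using order.trans[OF norm_ge_zero K] .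
  have bd: "(\<integral>y. norm (f x * (g y * k x y)) \<partial>N) \<le> K * (\<integral>y. norm (g y) \<partial>N) * norm (f x)"
    if "x \<in> space M" for x
  proof -
    have "(\<integral>y. norm (f x * (g y * k x y)) \<partial>N) \<le> (\<integral>y. (K * norm (f x)) * norm (g y) \<partial>N)"
    proof (rule integral_mono)
      show "integrable N (\<lambda>y. norm (f x * (g y * k x y)))" using gk[OF that] by auto
      show "integrable N (\<lambda>y. (K * norm (f x)) * norm (g y))" using g by auto
      fix y show "norm (f x * (g y * k x y)) \<le> K * norm (f x) * norm (g y)"
        using mult_left_mono[OF K[of x y], of "norm (f x) * norm (g y)"]
        by (simp add: norm_mult mult_ac)
    qed
    then show ?thesis by (simp add: mult_ac)
  qed
  have int: "integrable (M \<Otimes>\<^sub>M N) (\<lambda>(x, y). f x * (g y * k x y))"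
  proof (rule Fubini_integrable)
    have meas: "(\<lambda>x. \<integral>y. norm (f x * (g y * k x y)) \<partial>N) \<in> borel_measurable M" by measurable
    show "integrable M (\<lambda>x. \<integral>y. norm (case (x, y) of (x, y) \<Rightarrow> f x * (g y * k x y)) \<partial>N)"
      unfolding split_conv
    proof (rule Bochner_Integration.integrable_bound[of M "\<lambda>x. K * (\<integral>y. norm (g y) \<partial>N) * norm (f x)"])
      show "integrable M (\<lambda>x. K * (\<integral>y. norm (g y) \<partial>N) * norm (f x))" using f by auto
      show "AE x in M. norm (\<integral>y. norm (f x * (g y * k x y)) \<partial>N) \<le> norm (K * (\<integral>y. norm (g y) \<partial>N) * norm (f x))"
        using bd K0 by (auto intro!: AE_I2 simp: abs_mult)
    qed (rule meas)
    show "AE x in M. integrable N (\<lambda>y. case (x, y) of (x, y) \<Rightarrow> f x * (g y * k x y))"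
      using gk by (auto intro!: AE_I2)
  qed measurable
  have "(\<integral>y. \<integral>x. f x * (g y * k x y) \<partial>M \<partial>N) = (\<integral>x. \<integral>y. f x * (g y * k x y) \<partial>N \<partial>M)"
    by (rule Fubini_integral[OF int])
  moreover have "(\<integral>x. f x * (g y * k x y) \<partial>M) = g y * (\<integral>x. f x * k x y \<partial>M)" for y
    by (subst integral_mult_right_zero[symmetric]) (simp add: mult_ac)
  ultimately show ?eq by simp
  show ?int using integrable_fst'[OF int] by simp
qed

lemma integrable_heat_norm_power2:
  assumes a: "a > 0"
  shows "integrable lborel (\<lambda>z::'a::euclidean_space. heat a z * (norm z)\<^sup>2)"
proof (rule Bochner_Integration.integrable_bound)
  \<comment> \<open>With u = |z|^2 / (8 a) the Gaussian is exp (- 2 u), and u \<le> exp u spends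
    half of the exponent on the factor |z|^2.\<close>
  let ?C = "8 * a / sqrt (4 * pi * a) ^ DIM('a)"
  show "integrable lborel (\<lambda>z::'a. ?C * gauss (1 / (8 * a)) z)"
    using a by (intro integrable_mult_right integrable_gauss) simp
  have "heat a z * (norm z)\<^sup>2 \<le> ?C * gauss (1 / (8 * a)) z" for z :: 'a
  proof -
    have "(norm z)\<^sup>2 / (8 * a) \<le> exp ((norm z)\<^sup>2 / (8 * a))"
      using exp_ge_add_one_self[of "(norm z)\<^sup>2 / (8 * a)"] by linarith
    then have "(norm z)\<^sup>2 \<le> 8 * a * exp ((norm z)\<^sup>2 / (8 * a))" using a by (simp add: field_simps)
    then have "heat a z * (norm z)\<^sup>2 \<le> heat a z * (8 * a * exp ((norm z)\<^sup>2 / (8 * a)))"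
      using a by (intro mult_left_mono heat_nonneg)
    also have "\<dots> = ?C * (exp (- (1 / (4 * a)) * (norm z)\<^sup>2) * exp ((norm z)\<^sup>2 / (8 * a)))"
      by (simp add: heat_def gauss_def)
    also have "exp (- (1 / (4 * a)) * (norm z)\<^sup>2) * exp ((norm z)\<^sup>2 / (8 * a)) = gauss (1 / (8 * a)) z"
      unfolding gauss_def exp_add[symmetric] using a by (intro arg_cong[of _ _ exp]) (simp add: field_simps)
    finally show ?thesis .
  qed
  then show "AE z in lborel. norm (heat a z * (norm z)\<^sup>2) \<le> norm (?C * gauss (1 / (8 * a)) (z::'a))"
    using a by (auto simp: heat_nonneg abs_mult abs_of_pos[OF gauss_pos])
qed measurable

lemma heat_convolution_uniform:
  fixes f :: "'a::euclidean_space \<Rightarrow> real"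
  assumes f: "uniformly_continuous_on UNIV f" and B: "\<And>x. \<bar>f x\<bar> \<le> B" and e: "e > 0"
  obtains a where "a > 0" "\<And>x. \<bar>(\<integral>y. heat a (x - y) * f y \<partial>lborel) - f x\<bar> \<le> e"
proof -
  have [measurable]: "f \<in> borel_measurable borel"
    using uniformly_continuous_imp_continuous[OF f] by (rule borel_measurable_continuous_onI)
  have B0: "B \<ge> 0" using B[of 0] by linarith
  obtain d where d: "d > 0" "\<And>x y. dist y x < d \<Longrightarrow> \<bar>f y - f x\<bar> < e / 2"
    using f e unfolding uniformly_continuous_on_def dist_real_def by (metis UNIV_I half_gt_zero)
  \<comment> \<open>Close to 0 this is uniform continuity; further away the oscillation is at most 2
    B and |w|^2 / d^2 \<ge> 1. A quadratic modulus integrates against the heat kernel to its second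
    moment, which is proportional to a and does not depend on x.\<close>
  have quad: "\<bar>f (x + w) - f x\<bar> \<le> e / 2 + 2 * B / d\<^sup>2 * (norm w)\<^sup>2" for x w
  proof (cases "norm w < d")
    case True
    then have "\<bar>f (x + w) - f x\<bar> < e / 2" by (intro d) (simp add: dist_norm)
    moreover have "0 \<le> 2 * B / d\<^sup>2 * (norm w)\<^sup>2" using B0 by simp
    ultimately show ?thesis by linarith
  next
    case False
    then have "d\<^sup>2 \<le> (norm w)\<^sup>2" using d(1) by (intro power_mono) auto
    then have "2 * B * 1 \<le> 2 * B * ((norm w)\<^sup>2 / d\<^sup>2)" using d(1) B0 by (intro mult_left_mono) auto
    moreover have "\<bar>f (x + w) - f x\<bar> \<le> 2 * B" using B[of x] B[of "x + w"] by linarith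
    ultimately show ?thesis using e by simp
  qed
  define m where "m = (\<integral>z. heat 1 z * (norm (z::'a))\<^sup>2 \<partial>lborel)"
  have m0: "m \<ge> 0" unfolding m_def by (intro integral_nonneg_AE) (auto simp: heat_nonneg)
  \<comment> \<open>D bounds the coefficient of a in the error, with 1 added to make it positive;
    the choice of a below gives a D = e / 2.\<close>
  define D where "D = 2 * B / d\<^sup>2 * m + 1"
  define a where "a = e / (2 * D)"
  have den: "D > 0" unfolding D_def using B0 m0 by (intro add_nonneg_pos mult_nonneg_nonneg) auto
  have a: "a > 0" using e den by (simp add: a_def)
  have h1: "integrable lborel (heat 1 :: 'a \<Rightarrow> real)" "integral\<^sup>L lborel (heat 1 :: 'a \<Rightarrow> real) = 1"
    using has_bochner_integral_heat[of 1, where 'a='a] by (auto simp: has_bochner_integral_iff)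
  have h2: "integrable lborel (\<lambda>z::'a. heat 1 z * (norm z)\<^sup>2)" by (rule integrable_heat_norm_power2) simp
  have "\<bar>(\<integral>y. heat a (x - y) * f y \<partial>lborel) - f x\<bar> \<le> e" for x
  proof -
    have "has_bochner_integral lborel (\<lambda>y. heat a (x - y) *\<^sub>R (f y - f x))
       (\<integral>z. heat 1 z *\<^sub>R (f (x + sqrt a *\<^sub>R z) - f x) \<partial>lborel)"
      by (rule has_bochner_integral_heat_convolution[where B="2 * B", OF a])
         (measurable, use B order.trans[OF abs_triangle_ineq4 add_mono[OF B B]] in simp)
    moreover have "has_bochner_integral lborel (\<lambda>y. heat a (x - y) *\<^sub>R f x) (f x)"
      using has_bochner_integral_heat_convolution[where B="B" and f="\<lambda>_. f x" and x=x, OF a] B[of x] h1 by simp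
    ultimately have "has_bochner_integral lborel
        (\<lambda>y. heat a (x - y) *\<^sub>R (f y - f x) + heat a (x - y) *\<^sub>R f x)
        ((\<integral>z. heat 1 z *\<^sub>R (f (x + sqrt a *\<^sub>R z) - f x) \<partial>lborel) + f x)"
      by (rule has_bochner_integral_add)
    then have eq: "(\<integral>y. heat a (x - y) * f y \<partial>lborel) - f x = (\<integral>z. heat 1 z * (f (x + sqrt a *\<^sub>R z) - f x) \<partial>lborel)"
      by (simp add: has_bochner_integral_iff algebra_simps)
    have "\<bar>\<integral>z. heat 1 z * (f (x + sqrt a *\<^sub>R z) - f x) \<partial>lborel\<bar>
       \<le> (\<integral>z. e / 2 * heat 1 z + 2 * B / d\<^sup>2 * a * (heat 1 z * (norm (z::'a))\<^sup>2) \<partial>lborel)"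
    proof (rule integral_abs_bound[THEN order.trans], rule integral_mono_AE')
      show "integrable lborel (\<lambda>z::'a. e / 2 * heat 1 z + 2 * B / d\<^sup>2 * a * (heat 1 z * (norm z)\<^sup>2))"
        using h1 h2 by auto
      have "\<bar>heat 1 z * (f (x + sqrt a *\<^sub>R z) - f x)\<bar>
          \<le> e / 2 * heat 1 z + 2 * B / d\<^sup>2 * a * (heat 1 z * (norm z)\<^sup>2)" for z :: 'a
        using mult_left_mono[OF quad[of x "sqrt a *\<^sub>R z"], of "heat 1 z"] a
        unfolding abs_mult by (simp add: heat_nonneg power_mult_distrib distrib_left mult_ac)
      then show "AE z in lborel. \<bar>heat 1 z * (f (x + sqrt a *\<^sub>R z) - f x)\<bar>
          \<le> e / 2 * heat 1 z + 2 * B / d\<^sup>2 * a * (heat 1 z * (norm (z::'a))\<^sup>2)" by simp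
    qed (use e a B0 in \<open>auto simp: heat_nonneg intro!: AE_I2 add_nonneg_nonneg mult_nonneg_nonneg\<close>)
    also have "\<dots> = e / 2 + a * (2 * B / d\<^sup>2 * m)" using h1 h2 by (simp add: m_def)
    also have "\<dots> \<le> e / 2 + a * (2 * B / d\<^sup>2 * m + 1)" using a by (intro add_left_mono mult_left_mono) auto
    also have "a * (2 * B / d\<^sup>2 * m + 1) = e / 2" unfolding a_def D_def[symmetric] using den by simp
    finally show ?thesis unfolding eq by simp
  qed
  then show thesis using that a by blast
qed

section \<open>Characteristic functions and the continuity theorem\<close>

definition charfun :: "'a::euclidean_space measure \<Rightarrow> 'a \<Rightarrow> complex" where
  "charfun \<mu> \<xi> = (\<integral>x. iexp (\<xi> \<bullet> x) \<partial>\<mu>)"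

locale borel_prob = prob_space \<mu> for \<mu> :: "'a::euclidean_space measure" +
  assumes sets_eq [simp, measurable_cong]: "sets \<mu> = sets borel"
begin

lemma space_eq [simp]: "space \<mu> = UNIV" using sets_eq_imp_space_eq[OF sets_eq] by simp

lemma prob_UNIV [simp]: "prob UNIV = 1" using prob_space by simp

lemma charfun_0: "charfun \<mu> 0 = 1" by (simp add: charfun_def)

lemma norm_charfun_le: "norm (charfun \<mu> \<xi>) \<le> 1"
  unfolding charfun_def
  using integral_norm_bound[of \<mu> "\<lambda>x. iexp (\<xi> \<bullet> x)"] by simp

lemma charfun_measurable [measurable]: "charfun \<mu> \<in> borel_measurable borel"
  unfolding charfun_def[abs_def] by measurable

text \<open>Parseval against a Gaussian. It expresses heat means of the measure by its
  characteristic function, which is how pointwise convergence of characteristic functions gets back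
  to the measures.\<close>

lemma heat_smoothing:
  assumes a: "a > 0"
  shows "(\<integral>\<xi>. complex_of_real (gauss a \<xi>) * iexp (- (\<xi> \<bullet> x)) * charfun \<mu> \<xi> \<partial>lborel)
       = complex_of_real ((2 * pi) ^ DIM('a) * (\<integral>y. heat a (y - x) \<partial>\<mu>))"
proof -
  have "(\<integral>\<xi>. complex_of_real (gauss a \<xi>) * (\<integral>y. 1 * iexp (\<xi> \<bullet> (y - x)) \<partial>\<mu>) \<partial>lborel)
     = (\<integral>y. 1 * (\<integral>\<xi>. complex_of_real (gauss a \<xi>) * iexp (\<xi> \<bullet> (y - x)) \<partial>lborel) \<partial>\<mu>)"
    using a by (intro integral_swap_bounded_kernel[where K=1])
      (auto intro: sigma_finite_lborel sigma_finite_measure_axioms)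
  also have "(\<lambda>y. \<integral>\<xi>. complex_of_real (gauss a \<xi>) * iexp (\<xi> \<bullet> (y - x)) \<partial>lborel)
     = (\<lambda>y. complex_of_real ((2 * pi) ^ DIM('a) * heat a (y - x)))"
    using gaussian_inverse_fourier[OF a, of "_ - x"]
    by (auto simp: has_bochner_integral_iff inner_commute fun_eq_iff)
  also have "(\<lambda>\<xi>. complex_of_real (gauss a \<xi>) * (\<integral>y. 1 * iexp (\<xi> \<bullet> (y - x)) \<partial>\<mu>))
     = (\<lambda>\<xi>. complex_of_real (gauss a \<xi>) * iexp (- (\<xi> \<bullet> x)) * charfun \<mu> \<xi>)"
    unfolding charfun_def
    by (subst integral_mult_right_zero[symmetric])
       (simp add: inner_diff_right exp_diff exp_minus mult_ac divide_inverse right_diff_distrib fun_eq_iff)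
  finally show ?thesis by simp
qed

lemma heat_smoothing_integral:
  fixes f :: "'a \<Rightarrow> real"
  assumes a: "a > 0" and f: "integrable lborel f"
  shows "(\<integral>y. (\<integral>x. heat a (y - x) * f x \<partial>lborel) \<partial>\<mu>) = (\<integral>x. f x * (\<integral>y. heat a (y - x) \<partial>\<mu>) \<partial>lborel)"
  using integral_swap_bounded_kernel(1)[where M=\<mu> and N=lborel and f="\<lambda>_. 1" and g=f
      and k="\<lambda>y x. heat a (y - x)" and K="1 / sqrt (4 * pi * a) ^ DIM('a)"]
    f heat_bound[OF a, where 'a='a] sigma_finite_measure_axioms sigma_finite_lborel
  by (simp add: mult.commute)

end

text \<open>Dominated by \<open>gauss a\<close>, since characteristic functions have modulus at most
  1. The limit c is any measurable function: the lemma serves both the continuity theorem, where c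
  belongs to a known law, and the construction of the limit density, where it does not yet.\<close>

lemma gauss_charfun_tendsto:
  fixes \<mu> :: "nat \<Rightarrow> 'a::euclidean_space measure"
  assumes "\<And>k. borel_prob (\<mu> k)" and [measurable]: "c \<in> borel_measurable borel"
    and lim: "\<And>\<xi>. (\<lambda>k. charfun (\<mu> k) \<xi>) \<longlonglongrightarrow> c \<xi>" and a: "a > 0"
  shows "(\<lambda>k. complex_of_real ((2 * pi) ^ DIM('a) * (\<integral>y. heat a (y - x) \<partial>\<mu> k)))
    \<longlonglongrightarrow> (\<integral>\<xi>. complex_of_real (gauss a \<xi>) * iexp (- (\<xi> \<bullet> x)) * c \<xi> \<partial>lborel)"
proof -
  interpret m: borel_prob "\<mu> k" for k by fact
  have "(\<lambda>k. \<integral>\<xi>. complex_of_real (gauss a \<xi>) * iexp (- (\<xi> \<bullet> x)) * charfun (\<mu> k) \<xi> \<partial>lborel)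
    \<longlonglongrightarrow> (\<integral>\<xi>. complex_of_real (gauss a \<xi>) * iexp (- (\<xi> \<bullet> x)) * c \<xi> \<partial>lborel)"
  proof (rule integral_dominated_convergence[where w="gauss a"])
    show "AE \<xi> in lborel. (\<lambda>k. complex_of_real (gauss a \<xi>) * iexp (- (\<xi> \<bullet> x)) * charfun (\<mu> k) \<xi>)
      \<longlonglongrightarrow> complex_of_real (gauss a \<xi>) * iexp (- (\<xi> \<bullet> x)) * c \<xi>"
      by (intro AE_I2 tendsto_intros lim)
    show "AE \<xi> in lborel. norm (complex_of_real (gauss a \<xi>) * iexp (- (\<xi> \<bullet> x)) * charfun (\<mu> k) \<xi>) \<le> gauss a \<xi>" for k
      using m.norm_charfun_le by (auto simp: norm_mult abs_of_pos[OF gauss_pos] mult_left_le gauss_pos less_imp_le simp del: of_real_minus)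
  qed (use a in \<open>auto intro: integrable_gauss\<close>)
  then show ?thesis unfolding m.heat_smoothing[OF a] .
qed

lemma heat_smoothing_tendsto:
  fixes \<mu> :: "nat \<Rightarrow> 'a::euclidean_space measure"
  assumes "\<And>k. borel_prob (\<mu> k)" "borel_prob \<nu>"
    and "\<And>\<xi>. (\<lambda>k. charfun (\<mu> k) \<xi>) \<longlonglongrightarrow> charfun \<nu> \<xi>" and a: "a > 0"
  shows "(\<lambda>k. \<integral>y. heat a (y - x) \<partial>\<mu> k) \<longlonglongrightarrow> (\<integral>y. heat a (y - x) \<partial>\<nu>)"
proof -
  interpret n: borel_prob \<nu> by fact
  have "(\<lambda>k. (2 * pi) ^ DIM('a) * (\<integral>y. heat a (y - x) \<partial>\<mu> k))
      \<longlonglongrightarrow> (2 * pi) ^ DIM('a) * (\<integral>y. heat a (y - x) \<partial>\<nu>)"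
    using gauss_charfun_tendsto[OF assms(1) n.charfun_measurable assms(3) a, of x]
    unfolding n.heat_smoothing[OF a] by (simp only: tendsto_of_real_iff)
  from tendsto_mult_left[OF this, of "1 / (2 * pi) ^ DIM('a)"] show ?thesis by simp
qed

lemma uniformly_continuous_compact_support:
  fixes f :: "'a::euclidean_space \<Rightarrow> real"
  assumes f: "continuous_on UNIV f" and R: "\<And>x. norm x \<ge> R \<Longrightarrow> f x = 0"
  shows "uniformly_continuous_on UNIV f"
proof -
  have "uniformly_continuous_on (cball 0 (R + 1)) f"
    by (intro compact_uniformly_continuous continuous_on_subset[OF f]) auto
  then have uc: "\<exists>d>0. \<forall>x\<in>cball 0 (R + 1). \<forall>y\<in>cball 0 (R + 1). dist y x < d \<longrightarrow> dist (f y) (f x) < e" if "e > 0" for e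
    using that unfolding uniformly_continuous_on_def by auto
  show ?thesis unfolding uniformly_continuous_on_def
  proof (intro allI impI)
    fix e :: real assume e: "e > 0"
    from uc[OF e] obtain d where d: "d > 0"
      "\<And>x y. \<lbrakk>x \<in> cball 0 (R + 1); y \<in> cball 0 (R + 1); dist y x < d\<rbrakk> \<Longrightarrow> dist (f y) (f x) < e" by blast
    have "dist (f y) (f x) < e" if xy: "dist y x < min d 1" for x y
    proof (cases "x \<in> cball 0 (R + 1) \<and> y \<in> cball 0 (R + 1)")
      case False
      \<comment> \<open>If one of two points at distance below 1 lies beyond R + 1, both have norm
        at least R, where f vanishes.\<close>
      have "\<bar>norm y - norm x\<bar> < 1" using xy norm_triangle_ineq3[of y x] by (auto simp: dist_norm)
      with False have "norm x \<ge> R" "norm y \<ge> R" by auto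
      then show ?thesis using R e by simp
    qed (use d xy in auto)
    then show "\<exists>d>0. \<forall>x\<in>UNIV. \<forall>y\<in>UNIV. dist y x < d \<longrightarrow> dist (f y) (f x) < e"
      using d(1) by (intro exI[of _ "min d 1"]) auto
  qed
qed

text \<open>Replacing f by its heat mean changes the integral by at most e / 3 under every
  probability measure at once, because f is uniformly continuous. The integral of the heat mean is
  determined by heat means of the measure, hence by the characteristic function.\<close>

lemma levy_compact_support:
  fixes \<mu> :: "nat \<Rightarrow> 'a::euclidean_space measure" and f :: "'a \<Rightarrow> real"
  assumes \<mu>: "\<And>k. borel_prob (\<mu> k)" and \<nu>: "borel_prob \<nu>"
    and lim: "\<And>\<xi>. (\<lambda>k. charfun (\<mu> k) \<xi>) \<longlonglongrightarrow> charfun \<nu> \<xi>"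
    and f: "continuous_on UNIV f" and R: "\<And>x. norm x \<ge> R \<Longrightarrow> f x = 0"
  shows "(\<lambda>k. \<integral>x. f x \<partial>\<mu> k) \<longlonglongrightarrow> (\<integral>x. f x \<partial>\<nu>)"
proof -
  interpret m: borel_prob "\<mu> k" for k by fact
  interpret n: borel_prob \<nu> by fact
  have [measurable]: "f \<in> borel_measurable borel" using f by (rule borel_measurable_continuous_onI)
  have "bounded (f ` cball 0 R)"
    by (intro compact_imp_bounded compact_continuous_image continuous_on_subset[OF f]) auto
  then obtain B where "B > 0" "\<forall>x\<in>cball 0 R. \<bar>f x\<bar> \<le> B" unfolding bounded_pos by auto
  then have B: "\<bar>f x\<bar> \<le> B" for x using R[of x] by (cases "norm x \<le> R") auto
  have f_int: "integrable lborel f"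
  proof (rule Bochner_Integration.integrable_bound)
    show "integrable lborel (\<lambda>x. B * indicator (cball (0::'a) R) x)"
      using emeasure_lborel_cball_finite by (auto intro!: integrable_real_indicator)
    have "norm (f x) \<le> norm (B * indicator (cball (0::'a) R) x)" for x
      using B[of x] R[of x] by (auto simp: indicator_def)
    then show "AE x in lborel. norm (f x) \<le> norm (B * indicator (cball (0::'a) R) x)" by auto
  qed measurable
  have f_int': "integrable M f" if "borel_prob M" for M
  proof -
    interpret borel_prob M by fact
    show ?thesis using B by (intro integrable_const_bound[of _ B]) auto
  qed
  have uc: "uniformly_continuous_on UNIV f" by (rule uniformly_continuous_compact_support[OF f R])
  show ?thesis
  proof (rule LIMSEQ_I)
    fix e :: real assume e: "e > 0"
    obtain a where a: "a > 0" and close: "\<And>x. \<bar>(\<integral>y. heat a (x - y) * f y \<partial>lborel) - f x\<bar> \<le> e / 3"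
      by (rule heat_convolution_uniform[OF uc B, of "e / 3"]) (use e in auto)
    define F where "F x = (\<integral>y. heat a (x - y) * f y \<partial>lborel)" for x
    have [measurable]: "F \<in> borel_measurable borel" unfolding F_def by measurable
    have FB: "\<bar>F x\<bar> \<le> B + e / 3" for x using close[of x] B[of x] unfolding F_def by linarith
    have F_close: "\<bar>(\<integral>x. F x \<partial>M) - (\<integral>x. f x \<partial>M)\<bar> \<le> e / 3" if "borel_prob M" for M
    proof -
      interpret borel_prob M by fact
      have [simp]: "integrable M F" using FB by (intro integrable_const_bound[of _ "B + e/3"]) auto
      have [simp]: "integrable M f" using f_int' that .
      have "(\<integral>x. F x \<partial>M) - (\<integral>x. f x \<partial>M) = (\<integral>x. F x - f x \<partial>M)" by simp
      also have "\<bar>\<dots>\<bar> \<le> (\<integral>x. \<bar>F x - f x\<bar> \<partial>M)" by (rule integral_abs_bound)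
      also have "\<dots> \<le> (\<integral>x. e / 3 \<partial>M)"
        using close unfolding F_def[symmetric] by (intro integral_mono) auto
      finally show ?thesis by simp
    qed
    have bd: "\<bar>\<integral>y. heat a (y - x) \<partial>M\<bar> \<le> 1 / sqrt (4 * pi * a) ^ DIM('a)" if "borel_prob M" for M :: "'a measure" and x
    proof -
      interpret borel_prob M by fact
      have "\<bar>\<integral>y. heat a (y - x) \<partial>M\<bar> \<le> (\<integral>y. \<bar>heat a (y - x)\<bar> \<partial>M)" by (rule integral_abs_bound)
      also have "\<dots> \<le> (\<integral>y. 1 / sqrt (4 * pi * a) ^ DIM('a) \<partial>M)"
        using heat_bound[OF a, where 'a='a]
        by (intro integral_mono) (auto intro!: integrable_const_bound[of _ "1 / sqrt (4 * pi * a) ^ DIM('a)"])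
      finally show ?thesis by simp
    qed
    \<comment> \<open>With f placed on Lebesgue measure, the heat means of all the laws share one
      bound, and the compact support of f makes the majorant integrable.\<close>
    have "(\<lambda>k. \<integral>x. f x * (\<integral>y. heat a (y - x) \<partial>\<mu> k) \<partial>lborel) \<longlonglongrightarrow> (\<integral>x. f x * (\<integral>y. heat a (y - x) \<partial>\<nu>) \<partial>lborel)"
    proof (rule integral_dominated_convergence[where w="\<lambda>x. 1 / sqrt (4 * pi * a) ^ DIM('a) * \<bar>f x\<bar>"])
      show "AE x in lborel. (\<lambda>k. f x * (\<integral>y. heat a (y - x) \<partial>\<mu> k)) \<longlonglongrightarrow> f x * (\<integral>y. heat a (y - x) \<partial>\<nu>)"
        by (intro AE_I2 tendsto_intros heat_smoothing_tendsto \<mu> \<nu> lim a)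
      show "AE x in lborel. norm (f x * (\<integral>y. heat a (y - x) \<partial>\<mu> k)) \<le> 1 / sqrt (4 * pi * a) ^ DIM('a) * \<bar>f x\<bar>" for k
        using mult_left_mono[OF bd[OF \<mu>]] by (simp add: abs_mult mult.commute)
    qed (use f_int in auto)
    then have "(\<lambda>k. \<integral>x. F x \<partial>\<mu> k) \<longlonglongrightarrow> (\<integral>x. F x \<partial>\<nu>)"
      unfolding F_def m.heat_smoothing_integral[OF a f_int] n.heat_smoothing_integral[OF a f_int] .
    from LIMSEQ_D[OF this, of "e / 3"] e obtain no where
      no: "\<And>k. k \<ge> no \<Longrightarrow> norm ((\<integral>x. F x \<partial>\<mu> k) - (\<integral>x. F x \<partial>\<nu>)) < e / 3" by auto
    have "norm ((\<integral>x. f x \<partial>\<mu> k) - (\<integral>x. f x \<partial>\<nu>)) < e" if "k \<ge> no" for k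
      using no[OF that] F_close[OF \<mu>[of k]] F_close[OF \<nu>] unfolding real_norm_def by linarith
    then show "\<exists>no. \<forall>k\<ge>no. norm ((\<integral>x. f x \<partial>\<mu> k) - (\<integral>x. f x \<partial>\<nu>)) < e" by blast
  qed
qed

text \<open>No tightness is assumed. The compactly supported cutoffs \<open>\<psi> n\<close>, equal
  to 1 on the ball of radius n, are themselves test functions: once one of them captures almost all
  mass of \<nu>, it captures almost all mass of \<open>\<mu> k\<close> for large k.\<close>

lemma levy_converges_in_law:
  fixes \<mu> :: "nat \<Rightarrow> 'a::euclidean_space measure"
  assumes \<mu>: "\<And>k. borel_prob (\<mu> k)" and \<nu>: "borel_prob \<nu>"
    and lim: "\<And>\<xi>. (\<lambda>k. charfun (\<mu> k) \<xi>) \<longlonglongrightarrow> charfun \<nu> \<xi>"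
  shows "converges_in_law \<mu> \<nu>"
  unfolding converges_in_law_def
proof (intro allI impI)
  fix f :: "'a \<Rightarrow> real" assume "continuous_on UNIV f \<and> bounded (range f)"
  then have f: "continuous_on UNIV f" and "bounded (range f)" by auto
  then obtain B where B: "\<And>x. \<bar>f x\<bar> \<le> B" "B > 0" by (auto simp: bounded_pos)
  interpret m: borel_prob "\<mu> k" for k by fact
  interpret n: borel_prob \<nu> by fact
  have [measurable]: "f \<in> borel_measurable borel" using f by (rule borel_measurable_continuous_onI)
  define \<psi> where "\<psi> n x = max 0 (min 1 (real n + 1 - norm x))" for n :: nat and x :: 'a
  have \<psi>c: "continuous_on UNIV (\<psi> n)" for n unfolding \<psi>_def by (intro continuous_intros)
  have [measurable]: "\<psi> n \<in> borel_measurable borel" for n using \<psi>c by (rule borel_measurable_continuous_onI)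
  have \<psi>01: "0 \<le> \<psi> n x" "\<psi> n x \<le> 1" for n x by (auto simp: \<psi>_def)
  have \<psi>0: "\<psi> n x = 0" if "norm x \<ge> real n + 1" for n x using that by (simp add: \<psi>_def)
  have "(\<lambda>n. \<integral>x. \<psi> n x \<partial>\<nu>) \<longlonglongrightarrow> (\<integral>x. 1 \<partial>\<nu>)"
  proof (rule integral_dominated_convergence[where w="\<lambda>_. 1"])
    have "(\<lambda>n. \<psi> n x) \<longlonglongrightarrow> 1" for x
    proof (rule tendsto_eventually)
      show "\<forall>\<^sub>F n in sequentially. \<psi> n x = 1"
        using eventually_ge_at_top[of "nat \<lceil>norm x\<rceil>"] by eventually_elim (auto simp: \<psi>_def nat_le_iff ceiling_le_iff)
    qed
    then show "AE x in \<nu>. (\<lambda>n. \<psi> n x) \<longlonglongrightarrow> 1" by simp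
  qed (use \<psi>01 in auto)
  then have \<psi>lim: "(\<lambda>n. \<integral>x. \<psi> n x \<partial>\<nu>) \<longlonglongrightarrow> 1" by simp
  have cut: "\<bar>(\<integral>x. f x \<partial>M) - (\<integral>x. f x * \<psi> n x \<partial>M)\<bar> \<le> B * (1 - (\<integral>x. \<psi> n x \<partial>M))" if "borel_prob M" for M n
  proof -
    interpret borel_prob M by fact
    have i: "integrable M f" "integrable M (\<psi> n)"
      using B \<psi>01 integrable_const_bound[of f B] integrable_const_bound[of "\<psi> n" 1] by auto
    have "\<bar>f x * \<psi> n x\<bar> \<le> B" for x
      using mult_mono[OF B(1)[of x] \<psi>01(2)[of n x]] B(2) \<psi>01(1)[of n x] by (simp add: abs_mult)
    then have i: "integrable M f" "integrable M (\<psi> n)" "integrable M (\<lambda>x. f x * \<psi> n x)"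
      using i by (auto intro!: integrable_const_bound[of _ B])
    have "(\<integral>x. f x \<partial>M) - (\<integral>x. f x * \<psi> n x \<partial>M) = (\<integral>x. f x * (1 - \<psi> n x) \<partial>M)"
      using i by (simp add: right_diff_distrib)
    also have "\<bar>\<dots>\<bar> \<le> (\<integral>x. \<bar>f x * (1 - \<psi> n x)\<bar> \<partial>M)" by (rule integral_abs_bound)
    also have "\<dots> \<le> (\<integral>x. B * (1 - \<psi> n x) \<partial>M)"
    proof (rule integral_mono)
      show "integrable M (\<lambda>x. \<bar>f x * (1 - \<psi> n x)\<bar>)" using i by (simp add: right_diff_distrib)
      show "\<bar>f x * (1 - \<psi> n x)\<bar> \<le> B * (1 - \<psi> n x)" for x
        unfolding abs_mult using mult_right_mono[OF B(1)[of x], of "1 - \<psi> n x"] \<psi>01[of n x] by simp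
    qed (use i in simp)
    also have "\<dots> = B * (1 - (\<integral>x. \<psi> n x \<partial>M))" using i by simp
    finally show ?thesis .
  qed
  show "(\<lambda>k. \<integral>x. f x \<partial>\<mu> k) \<longlonglongrightarrow> (\<integral>x. f x \<partial>\<nu>)"
  proof (rule LIMSEQ_I)
    fix e :: real assume e: "e > 0"
    \<comment> \<open>The truncation error is at most B times the lost mass, so this n makes it less
      than e / 4 for \<nu>, and for \<open>\<mu> k\<close> eventually. With e / 4 for the truncated
      test function the total stays below e.\<close>
    from LIMSEQ_D[OF \<psi>lim, of "e / (4 * B)"] e B obtain n where n: "\<bar>(\<integral>x. \<psi> n x \<partial>\<nu>) - 1\<bar> < e / (4 * B)"
      by (metis divide_pos_pos mult_pos_pos order_refl real_norm_def zero_less_numeral)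
    then have "1 - (\<integral>x. \<psi> n x \<partial>\<nu>) < e / (4 * B)" by linarith
    then have n\<nu>: "B * (1 - (\<integral>x. \<psi> n x \<partial>\<nu>)) < e / 4" using B(2) by (simp add: field_simps)
    have l1: "(\<lambda>k. B * (1 - (\<integral>x. \<psi> n x \<partial>\<mu> k))) \<longlonglongrightarrow> B * (1 - (\<integral>x. \<psi> n x \<partial>\<nu>))"
      by (intro tendsto_intros levy_compact_support[OF \<mu> \<nu> lim \<psi>c \<psi>0])
    have l2: "(\<lambda>k. \<integral>x. f x * \<psi> n x \<partial>\<mu> k) \<longlonglongrightarrow> (\<integral>x. f x * \<psi> n x \<partial>\<nu>)"
      by (rule levy_compact_support[OF \<mu> \<nu> lim, of _ "real n + 1"]) (intro continuous_intros f \<psi>c, simp add: \<psi>0)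
    from LIMSEQ_D[OF l2, of "e / 4"] e obtain n2 where
      n2: "\<And>k. k \<ge> n2 \<Longrightarrow> \<bar>(\<integral>x. f x * \<psi> n x \<partial>\<mu> k) - (\<integral>x. f x * \<psi> n x \<partial>\<nu>)\<bar> < e / 4" by auto
    from order_tendstoD(2)[OF l1 n\<nu>] obtain n1 where
      n1: "\<And>k. k \<ge> n1 \<Longrightarrow> B * (1 - (\<integral>x. \<psi> n x \<partial>\<mu> k)) < e / 4" by (auto simp: eventually_sequentially)
    have "norm ((\<integral>x. f x \<partial>\<mu> k) - (\<integral>x. f x \<partial>\<nu>)) < e" if "k \<ge> max n1 n2" for k
      using n1[of k] n2[of k] that cut[OF \<mu>[of k], of n] cut[OF \<nu>, of n] n\<nu>
      unfolding real_norm_def by linarith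
    then show "\<exists>no. \<forall>k\<ge>no. norm ((\<integral>x. f x \<partial>\<mu> k) - (\<integral>x. f x \<partial>\<nu>)) < e" by blast
  qed
qed

section \<open>Fourier inversion and limit densities\<close>

lemma inv_fourier_measurable [measurable]:
  fixes c :: "real ^ 'n \<Rightarrow> complex"
  assumes [measurable]: "c \<in> borel_measurable borel"
  shows "inv_fourier c \<in> borel_measurable borel"
  unfolding inv_fourier_def[abs_def] by measurable

lemma inv_fourier_bound:
  fixes c :: "real ^ 'n \<Rightarrow> complex"
  assumes c: "integrable lborel c"
  shows "norm (inv_fourier c x) \<le> (\<integral>\<xi>. norm (c \<xi>) \<partial>lborel)"
proof -
  have "norm (inv_fourier c x) \<le> 1 / (2 * pi) ^ CARD('n) * (\<integral>\<xi>. norm (iexp (- (\<xi> \<bullet> x)) * c \<xi>) \<partial>lborel)"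
  proof -
    have "norm (\<integral>\<xi>. iexp (- (\<xi> \<bullet> x)) * c \<xi> \<partial>lborel) \<le> (\<integral>\<xi>. norm (iexp (- (\<xi> \<bullet> x)) * c \<xi>) \<partial>lborel)"
      by (rule integral_norm_bound)
    then show ?thesis
      unfolding inv_fourier_def norm_mult[of "complex_of_real _"] norm_of_real by (intro mult_mono) auto
  qed
  also have "\<dots> \<le> 1 * (\<integral>\<xi>. norm (iexp (- (\<xi> \<bullet> x)) * c \<xi>) \<partial>lborel)"
  proof (intro mult_right_mono integral_nonneg_AE AE_I2)
    have "1 \<le> (2 * pi) ^ CARD('n)" using pi_ge_two by (intro one_le_power) simp
    then show "1 / (2 * pi) ^ CARD('n) \<le> 1" by (simp add: divide_le_eq_1)
  qed auto
  finally show ?thesis unfolding norm_mult by simp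
qed

text \<open>The multiplication formula: the transform moves from c to f. The reflection
  \<open>- \<xi>\<close> reflects the opposite signs in the exponents of \<open>fourier\<close> and
  \<open>inv_fourier\<close>.\<close>

lemma inv_fourier_duality:
  fixes f c :: "real ^ 'n \<Rightarrow> complex"
  assumes f: "integrable lborel f" and c: "integrable lborel c"
  shows "(\<integral>x. f x * inv_fourier c x \<partial>lborel)
    = complex_of_real (1 / (2 * pi) ^ CARD('n)) * (\<integral>\<xi>. c \<xi> * fourier f (- \<xi>) \<partial>lborel)"
proof -
  have "(\<integral>x. f x * (\<integral>\<xi>. c \<xi> * iexp (- (\<xi> \<bullet> x)) \<partial>lborel) \<partial>lborel)
     = (\<integral>\<xi>. c \<xi> * (\<integral>x. f x * iexp (- (\<xi> \<bullet> x)) \<partial>lborel) \<partial>lborel)"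
    by (rule integral_swap_bounded_kernel[where K=1, OF sigma_finite_lborel sigma_finite_lborel f c]) auto
  then show ?thesis
    unfolding inv_fourier_def fourier_def
    by (subst mult.left_commute, subst integral_mult_right_zero) (simp add: mult.commute)
qed

section \<open>Inversion by Gaussian summation\<close>

lemma gauss_tendsto_1: "a \<longlonglongrightarrow> 0 \<Longrightarrow> (\<lambda>k. gauss (a k) x) \<longlonglongrightarrow> 1"
  unfolding gauss_def by (auto intro!: tendsto_eq_intros)

lemma abs_gauss_le_1: "a \<ge> 0 \<Longrightarrow> \<bar>gauss a x\<bar> \<le> 1" by (simp add: gauss_def)

text \<open>Duality applied to a modulated Gaussian, whose transform is a translated heat kernel.
  Letting a tend to 0, the left side becomes the transform of \<open>inv_fourier c\<close> and the
  right side becomes c.\<close>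

lemma fourier_gauss_inv_fourier:
  fixes c :: "real ^ 'n \<Rightarrow> complex"
  assumes c: "integrable lborel c" and a: "a > 0"
  shows "(\<integral>x. complex_of_real (gauss a x) * iexp (\<zeta> \<bullet> x) * inv_fourier c x \<partial>lborel)
     = (\<integral>\<xi>. heat a (\<zeta> - \<xi>) *\<^sub>R c \<xi> \<partial>lborel)"
proof -
  have i: "integrable lborel (\<lambda>x. complex_of_real (gauss a x) * iexp (\<zeta> \<bullet> x))"
    using gaussian_fourier[OF a, of \<zeta>] by (simp add: has_bochner_integral_iff)
  have "fourier (\<lambda>x. complex_of_real (gauss a x) * iexp (\<zeta> \<bullet> x)) (- \<xi>)
     = complex_of_real ((2 * pi) ^ CARD('n) * heat a (\<zeta> - \<xi>))" for \<xi>
    using gaussian_inverse_fourier[OF a, of "\<zeta> - \<xi>"] unfolding fourier_def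
    by (simp add: has_bochner_integral_iff inner_diff_left exp_diff exp_minus field_simps right_diff_distrib)
  then show ?thesis
    unfolding inv_fourier_duality[OF i c]
    by (subst integral_mult_right_zero[symmetric]) (simp add: scaleR_conv_of_real mult.commute)
qed

lemma fourier_inv_fourier:
  fixes c :: "real ^ 'n \<Rightarrow> complex"
  assumes c: "integrable lborel c" "continuous_on UNIV c" "\<And>\<xi>. norm (c \<xi>) \<le> B"
    and g: "integrable lborel (inv_fourier c)"
  shows "fourier (inv_fourier c) \<zeta> = c \<zeta>"
proof -
  have [measurable]: "c \<in> borel_measurable borel" using c(1) by auto
  let ?a = "\<lambda>n. 1 / real (Suc n)"
  have a: "?a \<longlonglongrightarrow> 0" "\<And>n. ?a n > 0" using LIMSEQ_inverse_real_of_nat by (auto simp: inverse_eq_divide)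
  have "(\<lambda>n. \<integral>x. complex_of_real (gauss (?a n) x) * iexp (\<zeta> \<bullet> x) * inv_fourier c x \<partial>lborel)
     \<longlonglongrightarrow> (\<integral>x. complex_of_real 1 * iexp (\<zeta> \<bullet> x) * inv_fourier c x \<partial>lborel)"
  proof (rule integral_dominated_convergence[where w="\<lambda>x. norm (inv_fourier c x)"])
    show "AE x in lborel. (\<lambda>n. complex_of_real (gauss (?a n) x) * iexp (\<zeta> \<bullet> x) * inv_fourier c x)
         \<longlonglongrightarrow> complex_of_real 1 * iexp (\<zeta> \<bullet> x) * inv_fourier c x"
      by (intro AE_I2 tendsto_intros gauss_tendsto_1 a)
    show "AE x in lborel. norm (complex_of_real (gauss (?a n) x) * iexp (\<zeta> \<bullet> x) * inv_fourier c x)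
         \<le> norm (inv_fourier c x)" for n
      using abs_gauss_le_1[of "?a n" "_ :: real ^ 'n"] by (intro AE_I2) (simp add: norm_mult mult_left_le_one_le)
  qed (use g in auto)
  moreover have "(\<lambda>n. \<integral>\<xi>. heat (?a n) (\<zeta> - \<xi>) *\<^sub>R c \<xi> \<partial>lborel) \<longlonglongrightarrow> c \<zeta>"
    by (rule heat_convolution_tendsto[OF c(2,3) a])
  ultimately show ?thesis
    unfolding fourier_gauss_inv_fourier[OF c(1) a(2)] fourier_def
    by (simp add: LIMSEQ_unique)
qed

text \<open>Up to the factor (2 pi)^N, the inverse transform is the reflected transform. Hence
  inversion in this order follows from the other order by the change of variables y -> - y.\<close>

lemma inv_fourier_fourier:
  fixes f :: "real ^ 'n \<Rightarrow> complex"
  assumes f: "integrable lborel f" "continuous_on UNIV f" "\<And>x. norm (f x) \<le> B"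
    and c: "integrable lborel (fourier f)"
  shows "inv_fourier (fourier f) x = f x"
proof -
  have [measurable]: "f \<in> borel_measurable borel" using f(1) by auto
  have sub: "integral\<^sup>L lborel (\<lambda>y. h (- y)) = integral\<^sup>L lborel h" "integrable lborel (\<lambda>y. h (- y))"
    if "integrable lborel h" for h :: "real ^ 'n \<Rightarrow> complex"
    using has_bochner_integral_lborel_affine[OF has_bochner_integral_integrable[OF that], of "-1" 0]
    by (auto simp: has_bochner_integral_iff)
  have inv: "inv_fourier f y = complex_of_real (1 / (2 * pi) ^ CARD('n)) * fourier f (- y)" for y
    by (simp add: inv_fourier_def fourier_def inner_commute)
  have fi: "integrable lborel (inv_fourier f)"
    unfolding inv[abs_def] using sub(2)[OF c] by auto
  have [measurable]: "fourier f \<in> borel_measurable borel" using c by auto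
  have "f x = fourier (inv_fourier f) x" using fourier_inv_fourier[OF f fi] by simp
  also have "\<dots> = complex_of_real (1 / (2 * pi) ^ CARD('n)) * (\<integral>y. iexp (x \<bullet> y) * fourier f (- y) \<partial>lborel)"
    unfolding fourier_def[of "inv_fourier f"] inv
    by (subst integral_mult_right_zero[symmetric]) (simp add: mult_ac)
  also have "(\<integral>y. iexp (x \<bullet> y) * fourier f (- y) \<partial>lborel) = (\<integral>y. iexp (- (x \<bullet> y)) * fourier f y \<partial>lborel)"
    proof -
    have "integrable lborel (\<lambda>y. iexp (- (x \<bullet> y)) * fourier f y)"
      by (rule Bochner_Integration.integrable_bound[OF c]) (auto simp: norm_mult)
    from sub(1)[OF this] show ?thesis by simp
  qed
  finally show ?thesis by (simp add: inv_fourier_def inner_commute)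
qed

lemma nonneg_real_tendsto:
  fixes z :: complex
  assumes "(\<lambda>n. complex_of_real (r n)) \<longlonglongrightarrow> z" "\<And>n. 0 \<le> r n"
  shows "z = complex_of_real (Re z)" "0 \<le> Re z"
proof -
  show "0 \<le> Re z" using LIMSEQ_le_const[OF tendsto_Re[OF assms(1)], of 0] assms(2) by auto
  have "Im z = 0" using tendsto_Im[OF assms(1)] by (simp add: LIMSEQ_const_iff)
  then show "z = complex_of_real (Re z)" by (simp add: complex_eq_iff)
qed

text \<open>
  The Bochner-type statement behind the existence of the limit density: an integrable pointwise
  limit of characteristic functions has a nonnegative inverse transform, because its Gaussian
  regularisation is a limit of Gaussian mixtures.
\<close>

locale charfun_limit =
  fixes c :: "real ^ 'n \<Rightarrow> complex" and \<mu> :: "nat \<Rightarrow> (real ^ 'n) measure"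
  assumes \<mu>: "\<And>k. borel_prob (\<mu> k)"
    and lim: "\<And>\<xi>. (\<lambda>k. charfun (\<mu> k) \<xi>) \<longlonglongrightarrow> c \<xi>"
    and c_int: "integrable lborel c" and c_cont: "continuous_on UNIV c"
begin

sublocale m: borel_prob "\<mu> k" for k by (rule \<mu>)

lemma c_meas [measurable]: "c \<in> borel_measurable borel" using c_int by auto

lemma norm_c_le: "norm (c \<xi>) \<le> 1"
  using LIMSEQ_le_const2[OF tendsto_norm[OF lim[of \<xi>]], of 1] m.norm_charfun_le by auto

lemma c_0: "c 0 = 1"
  using lim[of 0] by (simp add: m.charfun_0 LIMSEQ_const_iff)

lemma regularised_nonneg:
  assumes a: "a > 0"
  shows "\<exists>r\<ge>0. inv_fourier (\<lambda>\<xi>. complex_of_real (gauss a \<xi>) * c \<xi>) x = complex_of_real r"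
proof -
  note * = gauss_charfun_tendsto[OF \<mu> c_meas lim a, of x]
  define I where "I = (\<integral>\<xi>. complex_of_real (gauss a \<xi>) * iexp (- (\<xi> \<bullet> x)) * c \<xi> \<partial>lborel)"
  have I: "I = complex_of_real (Re I)" "0 \<le> Re I"
    unfolding I_def
    by (rule nonneg_real_tendsto[OF *], intro mult_nonneg_nonneg integral_nonneg_AE AE_I2 heat_nonneg a, simp)+
  have "inv_fourier (\<lambda>\<xi>. complex_of_real (gauss a \<xi>) * c \<xi>) x = complex_of_real (1 / (2 * pi) ^ CARD('n)) * I"
    by (simp add: inv_fourier_def I_def mult_ac)
  also have "\<dots> = complex_of_real (1 / (2 * pi) ^ CARD('n) * Re I)" by (subst I(1)) simp
  finally show ?thesis using I(2) by (intro exI[of _ "1 / (2 * pi) ^ CARD('n) * Re I"]) simp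
qed

definition dens :: "real ^ 'n \<Rightarrow> real" where "dens x = Re (inv_fourier c x)"

text \<open>The regularised inverse transforms are nonnegative reals and converge to the inverse
  transform of c as the Gaussian parameter tends to 0, with |c| as majorant.\<close>

lemma dens: "inv_fourier c x = complex_of_real (dens x)" "0 \<le> dens x"
proof -
  let ?a = "\<lambda>n. 1 / real (Suc n)"
  have a: "?a \<longlonglongrightarrow> 0" "\<And>n. ?a n > 0" using LIMSEQ_inverse_real_of_nat by (auto simp: inverse_eq_divide)
  obtain r where r: "\<And>n. 0 \<le> r n" "\<And>n. inv_fourier (\<lambda>\<xi>. complex_of_real (gauss (?a n) \<xi>) * c \<xi>) x = complex_of_real (r n)"
    using regularised_nonneg[OF a(2), of _ x] by metis
  have "(\<lambda>n. \<integral>\<xi>. iexp (- (\<xi> \<bullet> x)) * (complex_of_real (gauss (?a n) \<xi>) * c \<xi>) \<partial>lborel)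
     \<longlonglongrightarrow> (\<integral>\<xi>. iexp (- (\<xi> \<bullet> x)) * (complex_of_real 1 * c \<xi>) \<partial>lborel)"
  proof (rule integral_dominated_convergence[where w="\<lambda>x. norm (c x)"])
    show "AE \<xi> in lborel. (\<lambda>n. iexp (- (\<xi> \<bullet> x)) * (complex_of_real (gauss (?a n) \<xi>) * c \<xi>))
         \<longlonglongrightarrow> iexp (- (\<xi> \<bullet> x)) * (complex_of_real 1 * c \<xi>)"
      by (intro AE_I2 tendsto_intros gauss_tendsto_1 a)
    show "AE \<xi> in lborel. norm (iexp (- (\<xi> \<bullet> x)) * (complex_of_real (gauss (?a n) \<xi>) * c \<xi>)) \<le> norm (c \<xi>)" for n
      using abs_gauss_le_1[of "?a n" "_ :: real ^ 'n"] by (intro AE_I2) (simp add: norm_mult mult_left_le_one_le)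
  qed (use c_int in auto)
  then have "(\<lambda>n. inv_fourier (\<lambda>\<xi>. complex_of_real (gauss (?a n) \<xi>) * c \<xi>) x) \<longlonglongrightarrow> inv_fourier c x"
    unfolding inv_fourier_def by (intro tendsto_intros) simp
  then have "(\<lambda>n. complex_of_real (r n)) \<longlonglongrightarrow> inv_fourier c x" unfolding r(2) .
  from nonneg_real_tendsto[OF this r(1)]
  show "inv_fourier c x = complex_of_real (dens x)" "0 \<le> dens x" unfolding dens_def by auto
qed

lemma dens_measurable [measurable]: "dens \<in> borel_measurable borel"
  unfolding dens_def[abs_def] by measurable

lemma dens_le: "dens x \<le> (\<integral>\<xi>. norm (c \<xi>) \<partial>lborel)"
  using inv_fourier_bound[OF c_int, of x] by (simp add: dens)

text \<open>The density is so far only bounded, so a Gaussian weight is put on it to have a finite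
  mass. At frequency 0 the regularised inversion formula identifies this mass with a heat mean of c,
  and |c| \<le> 1. The bound does not depend on a.\<close>

lemma gauss_dens:
  assumes a: "a > 0"
  shows "(\<integral>\<^sup>+x. ennreal (gauss a x * dens x) \<partial>lborel) \<le> 1"
proof -
  have i: "integrable lborel (\<lambda>x. gauss a x * dens x)"
  proof (rule Bochner_Integration.integrable_bound)
    show "integrable lborel (\<lambda>x::real^'n. gauss a x * (\<integral>\<xi>. norm (c \<xi>) \<partial>lborel))"
      using a by (intro integrable_mult_left integrable_gauss)
    have "norm (gauss a x * dens x) \<le> norm (gauss a x * (\<integral>\<xi>. norm (c \<xi>) \<partial>lborel))" for x
      using dens(2)[of x] dens_le[of x] order.trans[OF dens(2)[of x] dens_le[of x]]
      by (auto simp: abs_mult abs_of_nonneg intro!: mult_left_mono)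
    then show "AE x in lborel. norm (gauss a x * dens x) \<le> norm (gauss a x * (\<integral>\<xi>. norm (c \<xi>) \<partial>lborel))" by auto
  qed measurable
  have h: "integrable lborel (heat a :: real ^ 'n \<Rightarrow> real)" "integral\<^sup>L lborel (heat a :: real ^ 'n \<Rightarrow> real) = 1"
    using has_bochner_integral_heat[OF a, where 'a="real ^ 'n"] by (auto simp: has_bochner_integral_iff)
  have "complex_of_real (\<integral>x. gauss a x * dens x \<partial>lborel) = (\<integral>\<xi>. heat a (0 - \<xi>) *\<^sub>R c \<xi> \<partial>lborel)"
    using fourier_gauss_inv_fourier[OF c_int a, of 0] by (simp add: dens(1) flip: of_real_mult)
  then have "\<bar>\<integral>x. gauss a x * dens x \<partial>lborel\<bar> = norm (\<integral>\<xi>. heat a (0 - \<xi>) *\<^sub>R c \<xi> \<partial>lborel)"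
    by (metis norm_of_real)
  also have "\<dots> \<le> (\<integral>\<xi>. heat a (\<xi> :: real ^ 'n) \<partial>lborel)"
    by (rule Bochner_Integration.integral_norm_bound_integral[OF _ h(1)])
      (use norm_c_le abs_of_nonneg[OF heat_nonneg[OF a, where 'a="real ^ 'n"]]
          heat_nonneg[OF a, where 'a="real ^ 'n"] h heat_commute[of a "0 :: real ^ 'n"] in
        \<open>auto intro!: Bochner_Integration.integrable_bound[OF h(1)] mult_left_le AE_I2\<close>)
  finally have "(\<integral>x. gauss a x * dens x \<partial>lborel) \<le> 1" using h by simp
  then show ?thesis
    by (subst nn_integral_eq_integral[OF i]) (auto simp: dens less_imp_le[OF gauss_pos])
qed

text \<open>Fatou's lemma as the Gaussian weight tends to 1, using the uniform bound on the weighted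
  masses.\<close>

lemma integrable_dens: "integrable lborel dens"
proof (rule integrableI_nonneg)
  let ?a = "\<lambda>n. 1 / real (Suc n)"
  have a: "?a \<longlonglongrightarrow> 0" "\<And>n. ?a n > 0" using LIMSEQ_inverse_real_of_nat by (auto simp: inverse_eq_divide)
  have "(\<lambda>n. ennreal (gauss (?a n) x * dens x)) \<longlonglongrightarrow> ennreal (1 * dens x)" for x
    by (intro tendsto_ennrealI tendsto_intros gauss_tendsto_1 a)
  then have "ennreal (dens x) = liminf (\<lambda>n. ennreal (gauss (?a n) x * dens x))" for x
    using lim_imp_Liminf[OF trivial_limit_sequentially] by (metis mult_1)
  then have "(\<integral>\<^sup>+x. ennreal (dens x) \<partial>lborel) \<le> liminf (\<lambda>n. \<integral>\<^sup>+x. ennreal (gauss (?a n) x * dens x) \<partial>lborel)"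
    by (simp add: nn_integral_liminf)
  also have "\<dots> \<le> liminf (\<lambda>n::nat. 1)"
    by (intro Liminf_mono always_eventually allI gauss_dens a)
  finally show "(\<integral>\<^sup>+x. ennreal (dens x) \<partial>lborel) < \<infinity>" by (simp add: Liminf_const order.strict_trans1)
qed (auto simp: dens)

lemma fourier_dens: "(\<integral>x. iexp (\<xi> \<bullet> x) * complex_of_real (dens x) \<partial>lborel) = c \<xi>"
proof -
  have "inv_fourier c = (\<lambda>x. complex_of_real (dens x))" by (auto simp: dens)
  then show ?thesis
    using fourier_inv_fourier[OF c_int c_cont norm_c_le, of \<xi>] integrable_dens by (simp add: fourier_def)
qed

lemma borel_prob_dens: "borel_prob (density lborel dens)"
proof (intro borel_prob.intro prob_spaceI borel_prob_axioms.intro)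
  have "complex_of_real (\<integral>x. dens x \<partial>lborel) = 1"
    using fourier_dens[of 0] by (simp add: c_0)
  then have "(\<integral>x. dens x \<partial>lborel) = 1" by (simp only: of_real_eq_1_iff)
  then show "emeasure (density lborel dens) (space (density lborel dens)) = 1"
    using nn_integral_eq_integral[OF integrable_dens] by (simp add: emeasure_density dens)
qed simp

lemma charfun_dens: "charfun (density lborel dens) \<xi> = c \<xi>"
  unfolding charfun_def
  by (subst integral_density) (auto simp: dens scaleR_conv_of_real mult.commute fourier_dens[unfolded mult.commute[of "iexp _"]])

lemma converges_in_law_dens: "converges_in_law \<mu> (density lborel dens)"
  by (rule levy_converges_in_law[OF \<mu> borel_prob_dens]) (simp add: charfun_dens lim)

end

section \<open>The constant of the Riesz kernel\<close>

lemma nn_integral_powr_from_0: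
  assumes "s > 0" "b \<ge> 0"
  shows "(\<integral>\<^sup>+u. ennreal (indicator {0..b} u * u powr (s - 1)) \<partial>lborel) = ennreal (b powr s / s)"
  using nn_integral_has_integral_lebesgue[OF _ has_integral_powr_from_0[of "s - 1" b]] assms by simp

lemma nn_integral_exp_interval:
  assumes "b \<ge> 0"
  shows "(\<integral>\<^sup>+w. ennreal (indicator {0..b} w * exp (- w)) \<partial>lborel) = ennreal (1 - exp (- b))"
proof -
  have "(\<integral>\<^sup>+w. ennreal (exp (- w)) * indicator {0..b} w \<partial>lborel) = ennreal (- exp (- b) - (- exp (- 0)))"
    using assms by (intro nn_integral_FTC_Icc) (auto intro!: derivative_eq_intros)
  then show ?thesis by (simp add: ennreal_mult' mult.commute flip: ennreal_indicator)
qed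

text \<open>Write 1 - exp (- c / u) as the integral of exp (- w) over [0, c / u] and exchange. For
  fixed w > 0 the variable u runs over [0, c / w], which gives (c / w)^s / s, and the remaining
  integral in w is Gamma (1 - s).\<close>

lemma nn_integral_one_minus_exp:
  assumes s: "0 < s" "s < 1" and c: "c \<ge> 0"
  shows "(\<integral>\<^sup>+u. ennreal (indicator {0..} u * u powr (s - 1) * (1 - exp (- (c / u)))) \<partial>lborel)
    = ennreal (c powr s * Gamma (1 - s) / s)"
proof (cases "c = 0")
  case False
  with c have c: "c > 0" by simp
  let ?F = "\<lambda>u w. ennreal (indicator {0..} u * u powr (s - 1) * (indicator {0..c / u} w * exp (- w)))"
  have 1: "ennreal (indicator {0..} u * u powr (s - 1) * (1 - exp (- (c / u))))
      = (\<integral>\<^sup>+w. ?F u w \<partial>lborel)" for u :: real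
  proof (cases "u \<ge> 0")
    case True
    have "ennreal (u powr (s - 1) * (1 - exp (- (c / u)))) = ennreal (u powr (s - 1)) * ennreal (1 - exp (- (c / u)))"
      using True c by (intro ennreal_mult) auto
    also have "\<dots> = ennreal (u powr (s - 1)) * (\<integral>\<^sup>+w. ennreal (indicator {0..c / u} w * exp (- w)) \<partial>lborel)"
      using True c by (subst nn_integral_exp_interval) auto
    also have "\<dots> = (\<integral>\<^sup>+w. ennreal (u powr (s - 1) * (indicator {0..c / u} w * exp (- w))) \<partial>lborel)"
      by (simp add: nn_integral_cmult ennreal_mult)
    finally show ?thesis using True by simp
  qed simp
  \<comment> \<open>The point w = 0 is left out: there the left side is infinite, while
    \<open>0 powr _\<close> makes the right side 0. It is a null set.\<close>
  have 2: "(\<integral>\<^sup>+u. ?F u w \<partial>lborel)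
      = ennreal (c powr s / s) * ennreal (indicator {0..} w * w powr ((1 - s) - 1) / exp w)" if w: "w \<noteq> 0" for w :: real
  proof (cases "w > 0")
    case True
    have "indicator {0..} u * u powr (s - 1) * (indicator {0..c / u} w * exp (- w))
       = exp (- w) * (indicator {0..c / w} u * u powr (s - 1))" for u :: real
      using True c by (cases "u > 0"; cases "u = 0") (auto simp: indicator_def field_simps)
    then have "(\<integral>\<^sup>+u. ?F u w \<partial>lborel)
      = (\<integral>\<^sup>+u. ennreal (exp (- w)) * ennreal (indicator {0..c / w} u * u powr (s - 1)) \<partial>lborel)"
      by (simp only: ennreal_mult'[OF exp_ge_zero])
    also have "\<dots> = ennreal (exp (- w)) * (\<integral>\<^sup>+u. ennreal (indicator {0..c / w} u * u powr (s - 1)) \<partial>lborel)"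
      by (rule nn_integral_cmult) measurable
    also have "\<dots> = ennreal (exp (- w)) * ennreal ((c / w) powr s / s)"
      using True c s by (subst nn_integral_powr_from_0) auto
    also have "\<dots> = ennreal (c powr s / s) * ennreal (w powr (- s) / exp w)"
      using True c s by (simp flip: ennreal_mult add: powr_divide powr_minus exp_minus field_simps)
    finally show ?thesis using True by simp
  next
    case False
    with w have "w < 0" by simp
    then have "(\<integral>\<^sup>+u. ?F u w \<partial>lborel) = 0"
      by (intro nn_integral_0_iff_AE[THEN iffD2] AE_I2) auto
    with \<open>w < 0\<close> show ?thesis by simp
  qed
  have "(\<integral>\<^sup>+u. ennreal (indicator {0..} u * u powr (s - 1) * (1 - exp (- (c / u)))) \<partial>lborel)
    = (\<integral>\<^sup>+u. \<integral>\<^sup>+w. ?F u w \<partial>lborel \<partial>lborel)"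
    unfolding 1 ..
  also have "\<dots> = (\<integral>\<^sup>+w. \<integral>\<^sup>+u. ?F u w \<partial>lborel \<partial>lborel)"
  proof (rule lborel_pair.Fubini')
    have [measurable]: "Measurable.pred (borel \<Otimes>\<^sub>M borel) (\<lambda>x::real \<times> real. fst x \<in> {0..c / snd x})"
      unfolding atLeastAtMost_iff by measurable
    show "(\<lambda>(w, u). ?F u w)
       \<in> borel_measurable (lborel \<Otimes>\<^sub>M lborel)" by (simp add: split_beta') measurable
  qed
  also have "\<dots> = (\<integral>\<^sup>+w. ennreal (c powr s / s) * ennreal (indicator {0..} w * w powr ((1 - s) - 1) / exp w) \<partial>lborel)"
    by (rule nn_integral_cong_AE) (use AE_lborel_singleton[of "0 :: real"] 2 in auto)
  also have "\<dots> = ennreal (c powr s / s) * ennreal (Gamma (1 - s))"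
    using s by (subst nn_integral_cmult) (auto simp: Gamma_conv_nn_integral_real)
  also have "\<dots> = ennreal (c powr s * Gamma (1 - s) / s)"
    using s c Gamma_real_pos[of "1 - s"] by (simp flip: ennreal_mult)
  finally show ?thesis .
qed simp

lemma nn_integral_Gamma_scaled:
  assumes p: "p > 0" and r: "r > 0"
  shows "(\<integral>\<^sup>+u. ennreal (indicator {0..} u * u powr (p - 1) * exp (- u * r)) \<partial>lborel) = ennreal (Gamma p * r powr (- p))"
proof -
  have "ennreal (Gamma p) = ennreal \<bar>r\<bar> * (\<integral>\<^sup>+u. ennreal (indicator {0..} (0 + r * u) * (0 + r * u) powr (p - 1) / exp (0 + r * u)) \<partial>lborel)"
    unfolding Gamma_conv_nn_integral_real[OF p] using r by (intro nn_integral_real_affine) auto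
  also have "\<dots> = (\<integral>\<^sup>+u. ennreal (r powr p) * ennreal (indicator {0..} u * u powr (p - 1) * exp (- u * r)) \<partial>lborel)"
  proof (subst nn_integral_cmult[symmetric], measurable, intro nn_integral_cong)
    fix u :: real
    show "ennreal \<bar>r\<bar> * ennreal (indicator {0..} (0 + r * u) * (0 + r * u) powr (p - 1) / exp (0 + r * u))
       = ennreal (r powr p) * ennreal (indicator {0..} u * u powr (p - 1) * exp (- u * r))"
      using r by (auto simp: indicator_def zero_le_mult_iff powr_mult powr_diff exp_minus field_simps simp flip: ennreal_mult)
  qed
  also have "\<dots> = ennreal (r powr p) * (\<integral>\<^sup>+u. ennreal (indicator {0..} u * u powr (p - 1) * exp (- u * r)) \<partial>lborel)"
    by (simp add: nn_integral_cmult)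
  finally have *: "ennreal (Gamma p) = \<dots>" .
  have "(\<integral>\<^sup>+u. ennreal (indicator {0..} u * u powr (p - 1) * exp (- u * r)) \<partial>lborel)
     = ennreal (r powr (- p)) * ennreal (r powr p) * (\<integral>\<^sup>+u. ennreal (indicator {0..} u * u powr (p - 1) * exp (- u * r)) \<partial>lborel)"
    using r by (simp flip: ennreal_mult powr_add)
  also have "\<dots> = ennreal (r powr (- p)) * ennreal (Gamma p)" unfolding * by (simp add: mult.assoc)
  finally show ?thesis using p Gamma_real_pos[OF p] by (simp flip: ennreal_mult add: mult.commute)
qed

lemma bconst_nonneg: "0 \<le> \<alpha> \<Longrightarrow> \<alpha> \<le> 2 \<Longrightarrow> 0 \<le> bconst N \<alpha>"
  unfolding bconst_def
  by (cases "\<alpha> = 0") (auto intro!: divide_nonneg_nonneg mult_nonneg_nonneg less_imp_le[OF Gamma_real_pos] sin_ge_zero)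

lemma bconst_2: "bconst N 2 = 0" by (simp add: bconst_def)

text \<open>This identity is what fixes the value of b. The left side collects the factors produced
  by the Gaussian mixture; the reflection formula turns Gamma (\<alpha> / 2) Gamma (1 - \<alpha> /
  2) into pi / sin (\<alpha> pi / 2), which the sine in b cancels.\<close>

lemma bconst_mult_Gamma:
  assumes "0 < \<alpha>" "\<alpha> < 2"
  shows "2 * bconst N \<alpha> * (pi powr (real N / 2) * ((r\<^sup>2 / 4) powr (\<alpha> / 2) * Gamma (1 - \<alpha> / 2) / (\<alpha> / 2))
      / Gamma ((real N + \<alpha>) / 2)) = \<bar>r\<bar> powr \<alpha>"
proof -
  have s: "sin (pi * \<alpha> / 2) > 0" using assms by (intro sin_gt_zero) (auto simp: field_simps)
  have "complex_of_real (Gamma (\<alpha> / 2) * Gamma (1 - \<alpha> / 2))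
      = Gamma (complex_of_real (\<alpha> / 2)) * Gamma (1 - complex_of_real (\<alpha> / 2))"
    by (simp only: of_real_mult of_real_diff of_real_1 flip: Gamma_complex_of_real)
  also have "\<dots> = complex_of_real pi / sin (complex_of_real pi * complex_of_real (\<alpha> / 2))"
    by (rule Gamma_reflection_complex)
  also have "\<dots> = complex_of_real (pi / sin (pi * (\<alpha> / 2)))"
    by (subst of_real_divide[of pi]) (simp only: of_real_mult[symmetric] sin_of_real)
  finally have refl: "Gamma (\<alpha> / 2) * Gamma (1 - \<alpha> / 2) * sin (\<alpha> * pi / 2) = pi"
    using s by (simp only: of_real_eq_iff) (simp add: mult.commute)
  have r: "(r\<^sup>2 / 4) powr (\<alpha> / 2) = \<bar>r\<bar> powr \<alpha> / 2 powr \<alpha>"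
  proof -
    have "(r\<^sup>2 / 4) powr (\<alpha> / 2) = ((\<bar>r\<bar> / 2) powr 2) powr (\<alpha> / 2)" by (simp add: power_divide)
    then show ?thesis by (simp only: powr_powr) (simp add: powr_divide)
  qed
  have G: "Gamma ((real N + \<alpha>) / 2) > 0" using assms by (intro Gamma_real_pos) auto
  \<comment> \<open>The cancellation is purely rational in T = 2^\<alpha>, P = pi^(N/2), R =
    |r|^\<alpha> and the values of Gamma and sine, so it is proved with these as variables.\<close>
  have alg: "2 * (\<alpha> * g1 * G * S / ((4 / T) * (pi * P))) * (P * (R / T * g2 / (\<alpha> / 2)) / G) = g1 * g2 * S * R / pi"
    if "G \<noteq> 0" "T \<noteq> 0" "P \<noteq> 0" for g1 g2 G S T P R
    using that assms by (simp add: field_simps)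
  have "2 powr (2 - \<alpha>) = 4 / 2 powr \<alpha>" "pi powr (1 + real N / 2) = pi * pi powr (real N / 2)"
    by (simp_all add: powr_diff powr_add)
  then have "2 * bconst N \<alpha> * (pi powr (real N / 2) * ((r\<^sup>2 / 4) powr (\<alpha> / 2) * Gamma (1 - \<alpha> / 2) / (\<alpha> / 2)) / Gamma ((real N + \<alpha>) / 2))
    = Gamma (\<alpha> / 2) * Gamma (1 - \<alpha> / 2) * sin (\<alpha> * pi / 2) * \<bar>r\<bar> powr \<alpha> / pi"
    unfolding bconst_def r using G by (simp only:) (rule alg; simp)
  also have "\<dots> = \<bar>r\<bar> powr \<alpha>" unfolding refl by simp
  finally show ?thesis .
qed

lemma has_bochner_integral_one_minus_cos_gauss:
  fixes \<xi> :: "'a::euclidean_space"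
  assumes u: "u > 0"
  shows "has_bochner_integral lborel (\<lambda>y. (1 - cos (\<xi> \<bullet> y)) * gauss u y) (sqrt (pi / u) ^ DIM('a) * (1 - gauss (1 / (4 * u)) \<xi>))"
proof -
  have "has_bochner_integral lborel (\<lambda>y. gauss u y * cos (\<xi> \<bullet> y)) (sqrt (pi / u) ^ DIM('a) * gauss (1 / (4 * u)) \<xi>)"
    using has_bochner_integral_bounded_linear[OF bounded_linear_Re gaussian_fourier[OF u, of \<xi>]]
    by (simp add: Re_exp)
  from has_bochner_integral_diff[OF has_bochner_integral_gauss[OF u] this]
  show ?thesis by (simp add: algebra_simps)
qed

text \<open>The Riesz kernel is a mixture of Gaussians, whose Fourier transforms are known.\<close>

lemma nn_integral_one_minus_cos:
  fixes \<xi> :: "'a::euclidean_space"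
  assumes \<alpha>: "0 < \<alpha>" "\<alpha> < 2"
  shows "(\<integral>\<^sup>+y. ennreal (2 * bconst DIM('a) \<alpha> * ((1 - cos (\<xi> \<bullet> y)) * norm y powr (- (real DIM('a) + \<alpha>)))) \<partial>lborel)
     = ennreal (norm \<xi> powr \<alpha>)"
proof -
  define p where "p = (real DIM('a) + \<alpha>) / 2"
  let ?F = "\<lambda>u y. ennreal (indicator {0..} u * u powr (p - 1) * ((1 - cos (\<xi> \<bullet> y)) * gauss u y))"
  have p: "p > 0" using \<alpha> by (simp add: p_def)
  have G: "Gamma p > 0" using p by (rule Gamma_real_pos)
  have b: "bconst DIM('a) \<alpha> \<ge> 0" using \<alpha> by (intro bconst_nonneg) auto
  \<comment> \<open>The Gamma integral with exponent p = (N + \<alpha>) / 2 writes |y|^(- 2 p) as a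
    mixture of the functions \<open>gauss u\<close>. The origin, a null set, is excluded because of
    the power.\<close>
  have 1: "ennreal ((1 - cos (\<xi> \<bullet> y)) * norm y powr (- (real DIM('a) + \<alpha>)))
    = ennreal (1 / Gamma p) * (\<integral>\<^sup>+u. ?F u y \<partial>lborel)"
    if "y \<noteq> 0" for y
  proof -
    have "(\<integral>\<^sup>+u. ?F u y \<partial>lborel)
      = (\<integral>\<^sup>+u. ennreal (1 - cos (\<xi> \<bullet> y)) * ennreal (indicator {0..} u * u powr (p - 1) * exp (- u * (norm y)\<^sup>2)) \<partial>lborel)"
      by (intro nn_integral_cong, subst ennreal_mult[symmetric]) (auto simp: gauss_def mult_ac)
    also have "\<dots> = ennreal (1 - cos (\<xi> \<bullet> y)) * ennreal (Gamma p * ((norm y)\<^sup>2) powr (- p))"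
      using that p by (subst nn_integral_cmult, measurable, subst nn_integral_Gamma_scaled) auto
    also have "((norm y)\<^sup>2) powr (- p) = norm y powr (- (real DIM('a) + \<alpha>))"
    proof -
      have "((norm y)\<^sup>2) powr (- p) = (norm y powr 2) powr (- p)" by simp
      moreover have "2 * - p = - (real DIM('a) + \<alpha>)" by (simp add: p_def field_simps)
      ultimately show ?thesis by (simp only: powr_powr)
    qed
    finally show ?thesis using G by (simp flip: ennreal_mult)
  qed
  \<comment> \<open>The mass (pi / u)^(N/2) of the Gaussian removes the dimension from the power of
    u. What remains is the integrand of \<open>nn_integral_one_minus_exp\<close> with s = \<alpha> /
    2 and c = |\<xi>|^2 / 4.\<close>
  have 2: "(\<integral>\<^sup>+y. ?F u y \<partial>lborel)
     = ennreal (pi powr (real DIM('a) / 2)) *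
        ennreal (indicator {0..} u * u powr (\<alpha> / 2 - 1) * (1 - exp (- ((norm \<xi>)\<^sup>2 / 4 / u))))" if "u \<noteq> 0" for u
  proof (cases "u > 0")
    case True
    have i: "has_bochner_integral lborel (\<lambda>y. u powr (p - 1) * ((1 - cos (\<xi> \<bullet> y)) * gauss u y))
        (u powr (p - 1) * (sqrt (pi / u) ^ DIM('a) * (1 - gauss (1 / (4 * u)) \<xi>)))"
      by (intro has_bochner_integral_mult_right has_bochner_integral_one_minus_cos_gauss True)
    have "(\<integral>\<^sup>+y. ennreal (u powr (p - 1) * ((1 - cos (\<xi> \<bullet> y)) * gauss u y)) \<partial>lborel)
       = ennreal (u powr (p - 1) * (sqrt (pi / u) ^ DIM('a) * (1 - gauss (1 / (4 * u)) \<xi>)))"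
      using i by (subst nn_integral_eq_integral) (auto simp: has_bochner_integral_iff less_imp_le[OF gauss_pos])
    also have "sqrt (pi / u) ^ DIM('a) = (pi / u) powr (real DIM('a) / 2)"
      using True by (simp add: powr_half_sqrt[symmetric] powr_realpow[symmetric] powr_powr)
    also have "u powr (p - 1) * ((pi / u) powr (real DIM('a) / 2) * (1 - gauss (1 / (4 * u)) \<xi>))
       = pi powr (real DIM('a) / 2) * (u powr (\<alpha> / 2 - 1) * (1 - exp (- ((norm \<xi>)\<^sup>2 / 4 / u))))"
    proof -
      have "u powr (p - 1) = u powr (real DIM('a) / 2) * u powr (\<alpha> / 2 - 1)"
        by (simp add: p_def powr_add[symmetric] add_divide_distrib add_diff_eq)
      then show ?thesis using True by (simp add: powr_divide gauss_def)
    qed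
    finally show ?thesis using True by (simp flip: ennreal_mult)
  qed (use that in auto)
  define c where "c = (norm \<xi>)\<^sup>2 / 4"
  have "(\<integral>\<^sup>+y. ennreal (2 * bconst DIM('a) \<alpha> * ((1 - cos (\<xi> \<bullet> y)) * norm y powr (- (real DIM('a) + \<alpha>)))) \<partial>lborel)
    = ennreal (2 * bconst DIM('a) \<alpha>) * (\<integral>\<^sup>+y. ennreal ((1 - cos (\<xi> \<bullet> y)) * norm y powr (- (real DIM('a) + \<alpha>))) \<partial>lborel)"
    using b by (subst nn_integral_cmult[symmetric]) (auto simp: ennreal_mult)
  also have "(\<integral>\<^sup>+y. ennreal ((1 - cos (\<xi> \<bullet> y)) * norm y powr (- (real DIM('a) + \<alpha>))) \<partial>lborel)
    = (\<integral>\<^sup>+y. ennreal (1 / Gamma p) * (\<integral>\<^sup>+u. ?F u y \<partial>lborel) \<partial>lborel)"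
    by (rule nn_integral_cong_AE) (use AE_lborel_singleton[of "0 :: 'a"] 1 in auto)
  also have "\<dots> = ennreal (1 / Gamma p) * (\<integral>\<^sup>+y. \<integral>\<^sup>+u. ?F u y \<partial>lborel \<partial>lborel)"
    unfolding gauss_def by (rule nn_integral_cmult) measurable
  also have "(\<integral>\<^sup>+y. \<integral>\<^sup>+u. ?F u y \<partial>lborel \<partial>lborel)
     = (\<integral>\<^sup>+u. \<integral>\<^sup>+y. ?F u y \<partial>lborel \<partial>lborel)"
    by (rule lborel_pair.Fubini') (unfold gauss_def, measurable)
  also have "\<dots> = (\<integral>\<^sup>+u. ennreal (pi powr (real DIM('a) / 2)) *
        ennreal (indicator {0..} u * u powr (\<alpha> / 2 - 1) * (1 - exp (- (c / u)))) \<partial>lborel)"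
    by (rule nn_integral_cong_AE) (use AE_lborel_singleton[of "0 :: real"] 2 in \<open>auto simp: c_def\<close>)
  also have "\<dots> = ennreal (pi powr (real DIM('a) / 2)) * ennreal (c powr (\<alpha> / 2) * Gamma (1 - \<alpha> / 2) / (\<alpha> / 2))"
    using \<alpha> by (subst nn_integral_cmult, measurable, subst nn_integral_one_minus_exp) (auto simp: c_def)
  also have "ennreal (2 * bconst DIM('a) \<alpha>) * (ennreal (1 / Gamma p) *
       (ennreal (pi powr (real DIM('a) / 2)) * ennreal (c powr (\<alpha> / 2) * Gamma (1 - \<alpha> / 2) / (\<alpha> / 2))))
     = ennreal (norm \<xi> powr \<alpha>)"
    using bconst_mult_Gamma[OF \<alpha>, of "DIM('a)" "norm \<xi>"] G b \<alpha> Gamma_real_pos[of "1 - \<alpha> / 2"]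
    by (simp flip: ennreal_mult add: p_def c_def mult_ac)
  finally show ?thesis .
qed

lemma gauss_average_one_minus_cos:
  fixes y :: "'a::euclidean_space"
  assumes a: "a > 0"
  shows "(\<integral>\<^sup>+\<xi>. ennreal (heat a \<xi> * (1 - cos (\<xi> \<bullet> y))) \<partial>lborel) = ennreal (1 - gauss a y)"
proof -
  have *: "sqrt (pi / (1 / (4 * a))) = sqrt (4 * pi * a)" by simp
  have "has_bochner_integral lborel (\<lambda>\<xi>. (1 - cos (y \<bullet> \<xi>)) * gauss (1 / (4 * a)) \<xi> / sqrt (4 * pi * a) ^ DIM('a))
     (sqrt (pi / (1 / (4 * a))) ^ DIM('a) * (1 - gauss (1 / (4 * (1 / (4 * a)))) y) / sqrt (4 * pi * a) ^ DIM('a))"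
    using a by (intro has_bochner_integral_divide_zero has_bochner_integral_one_minus_cos_gauss) auto
  then have "has_bochner_integral lborel (\<lambda>\<xi>. heat a \<xi> * (1 - cos (\<xi> \<bullet> y))) (1 - gauss a y)"
    unfolding * heat_def using a by (simp add: inner_commute mult.commute)
  then show ?thesis
    using a by (subst nn_integral_eq_integral) (auto simp: has_bochner_integral_iff heat_nonneg)
qed

lemma powr_le_one_plus_power2:
  assumes "0 < \<alpha>" "\<alpha> \<le> 2" "0 \<le> (r :: real)"
  shows "r powr \<alpha> \<le> 1 + r\<^sup>2"
proof (cases "r \<le> 1")
  case True
  then have "r powr \<alpha> \<le> 1" using assms by (simp add: powr_le1)
  then show ?thesis by (smt (verit) zero_le_power2)
next
  case False
  then have "r powr \<alpha> \<le> r powr 2" using assms by (intro powr_mono) auto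
  then show ?thesis using False by simp
qed

text \<open>
  Averaging \<open>1 - cos (\<xi> \<bullet> y)\<close> over a Gaussian \<open>\<xi>\<close> makes the bound uniform in the order \<open>\<alpha>\<close>.
\<close>

lemma nn_integral_one_minus_gauss:
  assumes \<alpha>: "0 < \<alpha>" "\<alpha> \<le> 2"
  shows "(\<integral>\<^sup>+y. ennreal (2 * bconst DIM('a) \<alpha> * ((1 - gauss (1 / 2) y) * norm y powr (- (real DIM('a) + \<alpha>)))) \<partial>(lborel :: 'a measure))
     \<le> (\<integral>\<^sup>+\<xi>. ennreal (heat (1 / 2) \<xi> * (1 + (norm \<xi>)\<^sup>2)) \<partial>(lborel :: 'a::euclidean_space measure))"
proof (cases "\<alpha> = 2")
  case False
  with \<alpha> have \<alpha>': "0 < \<alpha>" "\<alpha> < 2" by auto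
  have b: "bconst DIM('a) \<alpha> \<ge> 0" using \<alpha> by (intro bconst_nonneg) auto
  have 1: "ennreal (2 * bconst DIM('a) \<alpha> * ((1 - gauss (1 / 2) y) * norm y powr (- (real DIM('a) + \<alpha>))))
     = (\<integral>\<^sup>+\<xi>. ennreal (heat (1 / 2) \<xi> * (2 * bconst DIM('a) \<alpha> * ((1 - cos (\<xi> \<bullet> y)) * norm y powr (- (real DIM('a) + \<alpha>))))) \<partial>lborel)"
    (is "?l = ?r") for y :: 'a
  proof -
    have "?l = ennreal (2 * bconst DIM('a) \<alpha> * norm y powr (- (real DIM('a) + \<alpha>))) * ennreal (1 - gauss (1 / 2) y)"
      using b by (subst ennreal_mult'[symmetric]) (auto simp: mult_ac)
    also have "\<dots> = (\<integral>\<^sup>+\<xi>. ennreal (2 * bconst DIM('a) \<alpha> * norm y powr (- (real DIM('a) + \<alpha>)))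
        * ennreal (heat (1 / 2) \<xi> * (1 - cos (\<xi> \<bullet> y))) \<partial>lborel)"
      by (subst nn_integral_cmult) (auto simp: gauss_average_one_minus_cos)
    also have "\<dots> = ?r"
      using b by (intro nn_integral_cong, subst ennreal_mult'[symmetric]) (auto simp: mult_ac)
    finally show ?thesis .
  qed
  have "(\<integral>\<^sup>+y. ennreal (2 * bconst DIM('a) \<alpha> * ((1 - gauss (1 / 2) y) * norm y powr (- (real DIM('a) + \<alpha>)))) \<partial>(lborel :: 'a measure))
     = (\<integral>\<^sup>+\<xi>. \<integral>\<^sup>+y. ennreal (heat (1 / 2) \<xi> * (2 * bconst DIM('a) \<alpha> * ((1 - cos (\<xi> \<bullet> y)) * norm y powr (- (real DIM('a) + \<alpha>)))))
         \<partial>lborel \<partial>(lborel :: 'a measure))"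
    unfolding 1 by (rule lborel_pair.Fubini'[symmetric]) measurable
  also have "\<dots> = (\<integral>\<^sup>+\<xi>. ennreal (heat (1 / 2) \<xi>) * ennreal (norm \<xi> powr \<alpha>) \<partial>(lborel :: 'a measure))"
    by (intro nn_integral_cong, subst nn_integral_one_minus_cos[OF \<alpha>', symmetric], subst nn_integral_cmult[symmetric])
       (auto simp: ennreal_mult' heat_nonneg)
  also have "\<dots> \<le> (\<integral>\<^sup>+\<xi>. ennreal (heat (1 / 2) \<xi> * (1 + (norm \<xi>)\<^sup>2)) \<partial>(lborel :: 'a measure))"
    by (intro nn_integral_mono, subst ennreal_mult'[symmetric])
       (auto simp: heat_nonneg intro!: ennreal_leI mult_left_mono powr_le_one_plus_power2 \<alpha>)
  finally show ?thesis .
\<comment> \<open>At order 2 the integral itself diverges but b vanishes, so the left side is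
  0.\<close>
qed (simp add: bconst_2)

lemma nn_integral_heat_moment_finite:
  "(\<integral>\<^sup>+\<xi>. ennreal (heat (1 / 2) \<xi> * (1 + (norm \<xi>)\<^sup>2)) \<partial>(lborel :: 'a::euclidean_space measure)) < \<infinity>"
proof -
  have "integrable lborel (\<lambda>\<xi>::'a. heat (1 / 2) \<xi> + heat (1 / 2) \<xi> * (norm \<xi>)\<^sup>2)"
    using has_bochner_integral_heat[of "1 / 2", where 'a='a] integrable_heat_norm_power2[of "1 / 2", where 'a='a]
    by (intro Bochner_Integration.integrable_add) (auto simp: has_bochner_integral_iff)
  then have "integrable lborel (\<lambda>\<xi>::'a. heat (1 / 2) \<xi> * (1 + (norm \<xi>)\<^sup>2))" by (simp add: distrib_left)
  then show ?thesis by (subst nn_integral_eq_integral) (auto simp: heat_nonneg)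
qed

section \<open>Lattice sums as integrals of step functions\<close>

text \<open>\<open>A\<close> is a measure on the whole line carried by (0,2]. The cut-off makes the
  weight nonnegative and bounded everywhere, not just almost everywhere, as nonnegative integrals
  over the line require.\<close>

definition bweight :: "nat \<Rightarrow> real \<Rightarrow> real" where
  "bweight N \<alpha> = indicator {0<..2} \<alpha> * bconst N \<alpha>"

lemma bweight_nonneg: "0 \<le> bweight N \<alpha>"
  by (auto simp: bweight_def indicator_def bconst_nonneg)

text \<open>Gamma is discontinuous at its poles, so measurability is read off its reciprocal, which
  is continuous everywhere.\<close>

lemma bconst_measurable [measurable]: "bconst N \<in> borel_measurable borel"
proof -
  have "(\<lambda>x. inverse (rGamma x)) \<in> borel_measurable (borel :: real measure)"
    by (intro borel_measurable_inverse borel_measurable_continuous_onI continuous_on_rGamma)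
  then have [measurable]: "Gamma \<in> borel_measurable (borel :: real measure)"
    by (simp add: rGamma_inverse_Gamma)
  show ?thesis unfolding bconst_def[abs_def] by measurable
qed

lemma bweight_measurable [measurable]: "bweight N \<in> borel_measurable borel"
  unfolding bweight_def[abs_def] by measurable

text \<open>The factor \<alpha> cancels the pole of Gamma (\<alpha> / 2) at 0, since \<alpha> Gamma
  (\<alpha> / 2) = 2 Gamma (\<alpha> / 2 + 1). Hence b extends continuously to the compact interval
  [0, 2].\<close>

lemma bweight_bounded:
  assumes N: "N \<ge> 1"
  obtains C where "\<And>\<alpha>. bweight N \<alpha> \<le> C"
proof -
  let ?g = "\<lambda>\<alpha>. 2 * Gamma (\<alpha> / 2 + 1) * Gamma ((real N + \<alpha>) / 2) * sin (\<alpha> * pi / 2)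
     / (2 powr (2 - \<alpha>) * pi powr (1 + real N / 2))"
  have "continuous_on {0..2} ?g"
    using N by (intro continuous_intros continuous_on_compose2[of "{0<..}" Gamma] continuous_on_Gamma)
       (auto elim!: nonpos_Ints_cases)
  then have "bounded (?g ` {0..2})" by (intro compact_imp_bounded compact_continuous_image) auto
  then obtain C where "C > 0" and C: "\<forall>\<alpha>\<in>{0..2}. \<bar>?g \<alpha>\<bar> \<le> C" unfolding bounded_pos by auto
  have "bweight N \<alpha> \<le> C" for \<alpha>
  proof (cases "\<alpha> \<in> {0<..2}")
    case True
    then have "\<alpha> * Gamma (\<alpha> / 2) = 2 * Gamma (\<alpha> / 2 + 1)"
      by (subst Gamma_plus1) (auto elim!: nonpos_Ints_cases)
    then have "bconst N \<alpha> = ?g \<alpha>" by (simp add: bconst_def)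
    moreover have "\<bar>?g \<alpha>\<bar> \<le> C" by (rule bspec[OF C]) (use True in auto)
    ultimately have "bconst N \<alpha> \<le> C" by (simp only: abs_le_D1)
    then show ?thesis using True by (simp add: bweight_def)
  qed (use \<open>C > 0\<close> in \<open>simp add: bweight_def\<close>)
  then show thesis by (rule that)
qed

section \<open>Rounding to the lattice\<close>

definition cellindex :: "real \<Rightarrow> real ^ 'n \<Rightarrow> int ^ 'n" where
  "cellindex h y = (\<chi> i. round (y $ i / h))"

text \<open>The nearest lattice point, coordinate by coordinate. Its fibres are cubes of volume h^N,
  so a lattice sum with weight h^N is the Lebesgue integral of a function of
  \<open>snap h y\<close>.\<close>

definition snap :: "real \<Rightarrow> real ^ 'n \<Rightarrow> real ^ 'n" where
  "snap h y = h *\<^sub>R lat (cellindex h y)"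

lemma snap_nth: "snap h y $ i = h * of_int (round (y $ i / h))"
  by (simp add: snap_def lat_def cellindex_def)

lemma lat_0 [simp]: "lat 0 = 0" by (simp add: lat_def vec_eq_iff)

lemma lat_minus: "lat (- k) = - lat k" by (simp add: lat_def vec_eq_iff)

lemma lat_eq_0_iff [simp]: "lat k = 0 \<longleftrightarrow> k = 0" by (simp add: lat_def vec_eq_iff)

lemma snap_measurable [measurable]: "snap h \<in> borel_measurable borel"
  unfolding borel_measurable_euclidean_space[of "snap h"]
proof
  fix b :: "real ^ 'n" assume "b \<in> Basis"
  then obtain i where b: "b = axis i 1" by (auto simp: Basis_vec_def)
  have "(\<lambda>y. h * of_int \<lfloor>y $ i / h + 1 / 2\<rfloor>) \<in> borel_measurable borel" by measurable
  then show "(\<lambda>y. snap h y \<bullet> b) \<in> borel_measurable borel"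
    by (simp add: b inner_axis snap_nth round_def)
qed

lemma cellindex_eq_iff:
  assumes h: "h > 0"
  shows "cellindex h y = k \<longleftrightarrow> (\<forall>i. h * (of_int (k $ i) - 1 / 2) \<le> y $ i \<and> y $ i < h * (of_int (k $ i) + 1 / 2))"
proof -
  have "round x = m \<longleftrightarrow> of_int m - 1 / 2 \<le> x \<and> x < of_int m + 1 / 2" for x :: real and m
    using of_int_round_le[of x] of_int_round_gt[of x] round_unique[of x m] by linarith
  then show ?thesis
    using h by (simp add: cellindex_def vec_eq_iff field_simps)
qed

lemma cellindex_measurable [measurable]: "(cellindex h :: real ^ 'n \<Rightarrow> _) \<in> borel \<rightarrow>\<^sub>M count_space UNIV"
proof -
  have "cellindex h -` {a} \<inter> space borel \<in> sets borel" for a :: "int ^ 'n"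
  proof -
    have "cellindex h -` {a} \<inter> space borel = {y. \<forall>i\<in>UNIV. \<lfloor>y $ i / h + 1 / 2\<rfloor> = a $ i}"
      by (auto simp: cellindex_def vec_eq_iff round_def)
    also have "\<dots> \<in> sets borel" by measurable
    finally show ?thesis .
  qed
  then show ?thesis by (subst measurable_count_space_eq_countable) auto
qed

lemma emeasure_cell:
  fixes k :: "int ^ 'n"
  assumes h: "h > 0"
  shows "emeasure lborel {y. cellindex h y = k} = ennreal (h ^ CARD('n))"
proof -
  define l u :: "real ^ 'n" where "l = (\<chi> i. h * (of_int (k $ i) - 1 / 2))" and "u = (\<chi> i. h * (of_int (k $ i) + 1 / 2))"
  have [measurable]: "{y. cellindex h y = k} \<in> sets borel"
    using measurable_sets[OF cellindex_measurable[of h], of "{k}"] by (simp add: vimage_def)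
  \<comment> \<open>The cell is half open, hence squeezed between the open and the closed box with
    the same corners and the same volume.\<close>
  have b: "box l u \<subseteq> {y. cellindex h y = k}" "{y. cellindex h y = k} \<subseteq> cbox l u"
    by (auto simp: cellindex_eq_iff[OF h] mem_box_cart l_def u_def less_imp_le)
  have ul: "(u - l) \<bullet> b = h" if "b \<in> Basis" for b
    using that by (auto simp: Basis_vec_def inner_axis u_def l_def algebra_simps)
  then have le: "l \<bullet> b \<le> u \<bullet> b" if "b \<in> Basis" for b using that h by (smt (verit) inner_diff_left)
  have "(\<Prod>b\<in>Basis. (u - l) \<bullet> b) = h ^ CARD('n)" using ul by simp
  then have "emeasure lborel (box l u) = ennreal (h ^ CARD('n))" "emeasure lborel (cbox l u) = ennreal (h ^ CARD('n))"
    using le by (simp_all add: emeasure_lborel_box_eq emeasure_lborel_cbox_eq)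
  moreover have "emeasure lborel (box l u) \<le> emeasure lborel {y. cellindex h y = k}"
     "emeasure lborel {y. cellindex h y = k} \<le> emeasure lborel (cbox l u)"
    using b by (auto intro!: emeasure_mono)
  ultimately show ?thesis by simp
qed

lemma norm_snap_diff:
  fixes y :: "real ^ 'n"
  assumes h: "h > 0"
  shows "norm (snap h y - y) \<le> real CARD('n) * (h / 2)"
proof -
  have "\<bar>(snap h y - y) $ i\<bar> \<le> h / 2" for i
  proof -
    have "(snap h y - y) $ i = h * (of_int (round (y $ i / h)) - y $ i / h)"
      using h by (simp add: snap_nth field_simps)
    then show ?thesis
      using mult_left_mono[OF of_int_round_abs_le[of "y $ i / h"], of h] h by (simp add: abs_mult)
  qed
  then have "(\<Sum>i\<in>UNIV. \<bar>(snap h y - y) $ i\<bar>) \<le> real CARD('n) * (h / 2)"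
    using sum_bounded_above[of UNIV "\<lambda>i. \<bar>(snap h y - y) $ i\<bar>" "h / 2"] by simp
  then show ?thesis using norm_le_l1_cart[of "snap h y - y"] by linarith
qed

text \<open>Outside the cell of the origin, |snap h y| \<ge> h and |y| \<ge> h / 2, so the rounding
  error of at most N h / 2 is absorbed by either norm. The constant is free of h.\<close>

lemma snap_comparable:
  fixes y :: "real ^ 'n"
  assumes h: "h > 0" and k: "snap h y \<noteq> 0"
  shows "norm y \<le> (1 + real CARD('n)) * norm (snap h y)" "norm (snap h y) \<le> (1 + real CARD('n)) * norm y"
proof -
  obtain i where i: "snap h y $ i \<noteq> 0" using k by (auto simp: vec_eq_iff)
  then have r: "round (y $ i / h) \<noteq> 0" by (auto simp: snap_nth)
  then have "1 \<le> \<bar>real_of_int (round (y $ i / h))\<bar>" by linarith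
  then have "h * 1 \<le> h * \<bar>real_of_int (round (y $ i / h))\<bar>" using h by (intro mult_left_mono) auto
  then have "h \<le> \<bar>snap h y $ i\<bar>" using h by (simp add: snap_nth abs_mult)
  then have hz: "h \<le> norm (snap h y)" using component_le_norm_cart[of "snap h y" i] by linarith
  have "1 / 2 \<le> \<bar>y $ i / h\<bar>" using r of_int_round_abs_le[of "y $ i / h"] by linarith
  then have "h / 2 \<le> \<bar>y $ i\<bar>" using h by (simp add: field_simps abs_divide)
  then have hy: "h / 2 \<le> norm y" using component_le_norm_cart[of y i] by linarith
  have "norm y \<le> norm (snap h y) + real CARD('n) * (h / 2)"
    using norm_snap_diff[OF h, of y] norm_triangle_ineq2[of y "snap h y"] by (simp add: norm_minus_commute)
  also have "\<dots> \<le> norm (snap h y) + real CARD('n) * norm (snap h y)"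
    using hz norm_ge_zero[of "snap h y"] by (intro add_left_mono mult_left_mono) linarith+
  finally show "norm y \<le> (1 + real CARD('n)) * norm (snap h y)" by (simp add: algebra_simps)
  have "norm (snap h y) \<le> norm y + real CARD('n) * (h / 2)"
    using norm_snap_diff[OF h, of y] norm_triangle_ineq2[of "snap h y" y] by linarith
  also have "\<dots> \<le> norm y + real CARD('n) * norm y" using hy by (intro add_left_mono mult_left_mono) auto
  finally show "norm (snap h y) \<le> (1 + real CARD('n)) * norm y" by (simp add: algebra_simps)
qed

section \<open>A majorant independent of the mesh\<close>

lemma one_minus_cos_le: "1 - cos (x::real) \<le> x\<^sup>2 / 2"
proof -
  have "1 - cos x = 2 * (sin (x / 2))\<^sup>2" using cos_double_sin[of "x / 2"] by simp
  moreover have "(sin (x / 2))\<^sup>2 \<le> (x / 2)\<^sup>2"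
    using abs_sin_x_le_abs_x[of "x / 2"] by (simp only: abs_le_square_iff)
  ultimately show ?thesis by (simp add: power_divide)
qed

text \<open>Adds the estimate by |\<xi>|^2 |z|^2 / 2, good for small z, to the trivial estimate by
  2, good for large z. The rational function of |z| replaces a minimum and behaves well when z is
  exchanged for a comparable point.\<close>

lemma one_minus_cos_inner_le:
  fixes \<xi> z :: "'a::real_inner"
  shows "1 - cos (\<xi> \<bullet> z) \<le> (2 + (norm \<xi>)\<^sup>2) * ((norm z)\<^sup>2 / (2 + (norm z)\<^sup>2))"
proof -
  have p: "2 + (norm z)\<^sup>2 > 0" by (smt (verit) zero_le_power2)
  have "1 - cos (\<xi> \<bullet> z) \<le> (\<xi> \<bullet> z)\<^sup>2 / 2" by (rule one_minus_cos_le)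
  also have "\<dots> \<le> (norm \<xi> * norm z)\<^sup>2 / 2"
    using Cauchy_Schwarz_ineq2[of \<xi> z] by (simp add: abs_le_square_iff[symmetric] abs_mult)
  finally have 1: "(1 - cos (\<xi> \<bullet> z)) * 2 \<le> (norm \<xi>)\<^sup>2 * (norm z)\<^sup>2" by (simp add: power_mult_distrib)
  have 2: "(1 - cos (\<xi> \<bullet> z)) * (norm z)\<^sup>2 \<le> 2 * (norm z)\<^sup>2"
    using cos_ge_minus_one[of "\<xi> \<bullet> z"] by (intro mult_right_mono) (linarith | simp)+
  have "(1 - cos (\<xi> \<bullet> z)) * (2 + (norm z)\<^sup>2) \<le> (2 + (norm \<xi>)\<^sup>2) * (norm z)\<^sup>2"
    using 1 2 by (simp add: algebra_simps)
  then show ?thesis using p by (simp add: field_simps)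
qed

text \<open>With x = |y|^2 / 2 this is 1 - 1 / (1 + x) \<le> 1 - exp (- x). It leads from the
  rational majorant to the one whose integral is controlled for all orders at once.\<close>

lemma rational_le_one_minus_gauss: "(norm y)\<^sup>2 / (2 + (norm y)\<^sup>2) \<le> 1 - gauss (1 / 2) (y :: 'a::euclidean_space)"
proof -
  define x where "x = (norm y)\<^sup>2 / 2"
  have x: "x \<ge> 0" by (simp add: x_def)
  have "exp (- x) \<le> 1 / (1 + x)"
    using exp_ge_add_one_self[of x] x by (simp add: exp_minus inverse_eq_divide frac_le)
  then have "1 - 1 / (1 + x) \<le> 1 - exp (- x)" by simp
  moreover have "1 - 1 / (1 + x) = (norm y)\<^sup>2 / (2 + (norm y)\<^sup>2)"
  proof -
    have "2 + (norm y)\<^sup>2 \<noteq> 0" by (smt (verit) zero_le_power2)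
    then show ?thesis using x by (simp add: x_def field_simps)
  qed
  ultimately show ?thesis by (simp add: gauss_def x_def)
qed

text \<open>On the cell of the origin the left side is 0. Elsewhere the rounded point is exchanged
  for y, at the price of c^2 in the bounded factor and c^(N+2) in the power, where N + 2 is the
  largest exponent over all orders.\<close>

lemma jump_kernel_dominated:
  fixes y \<xi> :: "real ^ 'n"
  assumes h: "h > 0" and \<alpha>: "0 \<le> \<alpha>" "\<alpha> \<le> 2"
  defines "c \<equiv> 1 + real CARD('n)"
  shows "(1 - cos (\<xi> \<bullet> snap h y)) * norm (snap h y) powr (- (real CARD('n) + \<alpha>))
    \<le> (2 + (norm \<xi>)\<^sup>2) * c\<^sup>2 * c powr (real CARD('n) + 2) *
        ((1 - gauss (1 / 2) y) * norm y powr (- (real CARD('n) + \<alpha>)))"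
proof (cases "snap h y = 0")
  case True
  then show ?thesis by (simp add: c_def abs_gauss_le_1[of "1 / 2" y] abs_le_D1)
next
  case False
  define z where "z = snap h y"
  note cmp = snap_comparable[OF h False, folded z_def c_def]
  have z: "norm z > 0" using False by (simp add: z_def)
  have c: "c \<ge> 1" by (simp add: c_def)
  have y: "norm y > 0" using cmp(2) z c by (smt (verit) mult_nonneg_nonpos)
  have mono: "(norm z)\<^sup>2 / (2 + (norm z)\<^sup>2) \<le> c\<^sup>2 * ((norm y)\<^sup>2 / (2 + (norm y)\<^sup>2))"
  proof -
    have z2: "(norm z)\<^sup>2 \<le> c\<^sup>2 * (norm y)\<^sup>2"
      using power_mono[OF cmp(2), of 2] by (simp add: power_mult_distrib)
    have c2: "1 \<le> c\<^sup>2" using c by (simp add: one_le_power)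
    have "(norm z)\<^sup>2 * (2 + (norm y)\<^sup>2) \<le> 2 * (c\<^sup>2 * (norm y)\<^sup>2) + 1 * (norm z)\<^sup>2 * (norm y)\<^sup>2"
      using z2 by (simp add: algebra_simps)
    also have "\<dots> \<le> 2 * (c\<^sup>2 * (norm y)\<^sup>2) + c\<^sup>2 * (norm z)\<^sup>2 * (norm y)\<^sup>2"
      using c2 by (intro add_left_mono mult_right_mono) auto
    also have "\<dots> = c\<^sup>2 * (norm y)\<^sup>2 * (2 + (norm z)\<^sup>2)" by (simp add: algebra_simps)
    finally have "(norm z)\<^sup>2 * (2 + (norm y)\<^sup>2) \<le> c\<^sup>2 * (norm y)\<^sup>2 * (2 + (norm z)\<^sup>2)" .
    moreover have "2 + (norm z)\<^sup>2 > 0" "2 + (norm y)\<^sup>2 > 0" by (smt (verit) zero_le_power2)+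
    ultimately show ?thesis by (simp add: divide_le_eq le_divide_eq mult.commute)
  qed
  have "1 - cos (\<xi> \<bullet> z) \<le> (2 + (norm \<xi>)\<^sup>2) * ((norm z)\<^sup>2 / (2 + (norm z)\<^sup>2))"
    by (rule one_minus_cos_inner_le)
  also have "\<dots> \<le> (2 + (norm \<xi>)\<^sup>2) * (c\<^sup>2 * ((norm y)\<^sup>2 / (2 + (norm y)\<^sup>2)))"
    by (intro mult_left_mono mono) auto
  also have "\<dots> \<le> (2 + (norm \<xi>)\<^sup>2) * (c\<^sup>2 * (1 - gauss (1 / 2) y))"
    by (intro mult_left_mono rational_le_one_minus_gauss) auto
  finally have 1: "1 - cos (\<xi> \<bullet> z) \<le> (2 + (norm \<xi>)\<^sup>2) * c\<^sup>2 * (1 - gauss (1 / 2) y)" by (simp add: mult_ac)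
  have "norm z powr (- (real CARD('n) + \<alpha>)) \<le> (norm y / c) powr (- (real CARD('n) + \<alpha>))"
    using cmp(1) y z c \<alpha> by (intro powr_mono2') (auto simp: divide_le_eq mult.commute)
  also have "\<dots> = c powr (real CARD('n) + \<alpha>) * norm y powr (- (real CARD('n) + \<alpha>))"
    using y c powr_add[of c "real CARD('n) + \<alpha>" "- (real CARD('n) + \<alpha>)"] by (simp add: powr_divide field_simps)
  also have "\<dots> \<le> c powr (real CARD('n) + 2) * norm y powr (- (real CARD('n) + \<alpha>))"
    using c \<alpha> by (intro mult_right_mono powr_mono) auto
  finally have 2: "norm z powr (- (real CARD('n) + \<alpha>)) \<le> c powr (real CARD('n) + 2) * norm y powr (- (real CARD('n) + \<alpha>))" .
  have g: "0 \<le> 1 - gauss (1 / 2) y" using abs_gauss_le_1[of "1 / 2" y] by linarith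
  have "(1 - cos (\<xi> \<bullet> z)) * norm z powr (- (real CARD('n) + \<alpha>))
     \<le> ((2 + (norm \<xi>)\<^sup>2) * c\<^sup>2 * (1 - gauss (1 / 2) y)) * (c powr (real CARD('n) + 2) * norm y powr (- (real CARD('n) + \<alpha>)))"
    using g by (intro mult_mono 1 2) auto
  then show ?thesis by (simp add: z_def mult_ac)
qed

lemma snap_tendsto:
  fixes y :: "real ^ 'n"
  assumes h: "\<And>n. h n > 0" "h \<longlonglongrightarrow> 0"
  shows "(\<lambda>n. snap (h n) y) \<longlonglongrightarrow> y"
proof (rule LIM_zero_cancel, rule Lim_null_comparison)
  show "\<forall>\<^sub>F n in sequentially. norm (snap (h n) y - y) \<le> real CARD('n) * (h n / 2)"
    by (intro always_eventually allI norm_snap_diff h)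
  show "(\<lambda>n. real CARD('n) * (h n / 2)) \<longlonglongrightarrow> 0" using h(2) by (auto intro!: tendsto_eq_intros)
qed

definition jump_kernel :: "nat \<Rightarrow> real ^ 'n \<Rightarrow> real \<Rightarrow> real ^ 'n \<Rightarrow> real" where
  "jump_kernel N \<xi> \<alpha> z = 2 * bweight N \<alpha> * ((1 - cos (\<xi> \<bullet> z)) * norm z powr (- (real N + \<alpha>)))"

text \<open>Dominated convergence is applied once, on the product of \<open>A\<close> and Lebesgue
  measure. The majorant of \<open>jump_kernel_dominated\<close> has a finite integral because
  \<open>nn_integral_one_minus_gauss\<close> bounds its inner integral independently of the order
  and \<open>A\<close> is finite.\<close>

lemma lattice_symbol_tendsto:
  fixes \<xi> :: "real ^ 'n"
  assumes "finite_measure A" and A [measurable_cong]: "sets A = sets borel" and A2: "emeasure A {2} = 0"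
    and h: "\<And>n. h n > 0" "h \<longlonglongrightarrow> 0"
  shows "(\<lambda>n. \<integral>\<^sup>+\<alpha>. \<integral>\<^sup>+y. ennreal (jump_kernel CARD('n) \<xi> \<alpha> (snap (h n) y)) \<partial>lborel \<partial>A)
    \<longlonglongrightarrow> (\<integral>\<^sup>+\<alpha>. ennreal (indicator {0<..2} \<alpha> * norm \<xi> powr \<alpha>) \<partial>A)"
proof -
  let ?L = "lborel :: (real ^ 'n) measure"
  interpret finite_measure A by fact
  interpret pair_sigma_finite A ?L ..
  define C where "C = (2 + (norm \<xi>)\<^sup>2) * (1 + real CARD('n))\<^sup>2 * (1 + real CARD('n)) powr (real CARD('n) + 2)"
  have C: "C \<ge> 0" by (simp add: C_def)
  let ?d = "\<lambda>\<alpha> y :: real ^ 'n. ennreal (C * (2 * bweight CARD('n) \<alpha> * ((1 - gauss (1 / 2) y) * norm y powr (- (real CARD('n) + \<alpha>)))))"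
  have meas: "(\<lambda>(\<alpha>, y). ennreal (jump_kernel CARD('n) \<xi> \<alpha> y)) \<in> borel_measurable (A \<Otimes>\<^sub>M ?L)"
    unfolding jump_kernel_def by measurable
  have meas_snap: "(\<lambda>(\<alpha>, y). ennreal (jump_kernel CARD('n) \<xi> \<alpha> (snap (h n) y))) \<in> borel_measurable (A \<Otimes>\<^sub>M ?L)" for n
    unfolding jump_kernel_def by measurable
  have meas_d: "(\<lambda>(\<alpha>, y). ?d \<alpha> y) \<in> borel_measurable (A \<Otimes>\<^sub>M ?L)" by measurable
  have "(\<integral>\<^sup>+p. (case p of (\<alpha>, y) \<Rightarrow> ?d \<alpha> y) \<partial>(A \<Otimes>\<^sub>M lborel)) = (\<integral>\<^sup>+\<alpha>. \<integral>\<^sup>+y. ?d \<alpha> y \<partial>lborel \<partial>A)"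
    using lborel.nn_integral_fst[OF meas_d] by simp
  also have "\<dots> \<le> (\<integral>\<^sup>+\<alpha>. ennreal C * (\<integral>\<^sup>+\<xi>. ennreal (heat (1 / 2) \<xi> * (1 + (norm \<xi>)\<^sup>2)) \<partial>?L) \<partial>A)"
  proof (rule nn_integral_mono)
    fix \<alpha>
    show "(\<integral>\<^sup>+y. ?d \<alpha> y \<partial>lborel) \<le> ennreal C * (\<integral>\<^sup>+\<xi>. ennreal (heat (1 / 2) \<xi> * (1 + (norm \<xi>)\<^sup>2)) \<partial>?L)"
    proof (cases "\<alpha> \<in> {0<..2}")
      case True
      have "(\<integral>\<^sup>+y. ?d \<alpha> y \<partial>lborel) = ennreal C * (\<integral>\<^sup>+y. ennreal (2 * bconst DIM(real ^ 'n) \<alpha> * ((1 - gauss (1 / 2) y) * norm y powr (- (real DIM(real ^ 'n) + \<alpha>)))) \<partial>?L)"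
        using C True by (subst nn_integral_cmult[symmetric]) (auto simp: ennreal_mult' bweight_def)
      then show ?thesis using nn_integral_one_minus_gauss[where 'a="real ^ 'n", of \<alpha>] True by (auto intro!: mult_left_mono)
    qed (simp add: bweight_def)
  qed
  also have "\<dots> < \<infinity>"
    using nn_integral_heat_moment_finite[where 'a="real ^ 'n"]
    by (auto simp: ennreal_mult_less_top ennreal_mult_eq_top_iff less_top[symmetric])
  finally have fin: "(\<integral>\<^sup>+p. (case p of (\<alpha>, y) \<Rightarrow> ?d \<alpha> y) \<partial>(A \<Otimes>\<^sub>M lborel)) < \<infinity>" .
  have "(\<lambda>n. \<integral>\<^sup>+p. (case p of (\<alpha>, y) \<Rightarrow> ennreal (jump_kernel CARD('n) \<xi> \<alpha> (snap (h n) y))) \<partial>(A \<Otimes>\<^sub>M lborel))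
     \<longlonglongrightarrow> (\<integral>\<^sup>+p. (case p of (\<alpha>, y) \<Rightarrow> ennreal (jump_kernel CARD('n) \<xi> \<alpha> y)) \<partial>(A \<Otimes>\<^sub>M lborel))"
  proof (rule nn_integral_dominated_convergence[OF meas_snap meas meas_d _ fin])
    fix n
    show "AE p in A \<Otimes>\<^sub>M lborel. (case p of (\<alpha>, y) \<Rightarrow> ennreal (jump_kernel CARD('n) \<xi> \<alpha> (snap (h n) y))) \<le> (case p of (\<alpha>, y) \<Rightarrow> ?d \<alpha> y)"
    proof (intro AE_I2, clarsimp split: prod.split intro!: ennreal_leI)
      fix \<alpha> and y :: "real ^ 'n"
      show "jump_kernel CARD('n) \<xi> \<alpha> (snap (h n) y) \<le> C * (2 * bweight CARD('n) \<alpha> * ((1 - gauss (1 / 2) y) * norm y powr (- real CARD('n) - \<alpha>)))"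
      proof (cases "\<alpha> \<in> {0<..2}")
        case True
        then have "2 * bweight CARD('n) \<alpha> * ((1 - cos (\<xi> \<bullet> snap (h n) y)) * norm (snap (h n) y) powr (- (real CARD('n) + \<alpha>)))
          \<le> 2 * bweight CARD('n) \<alpha> * (C * ((1 - gauss (1 / 2) y) * norm y powr (- (real CARD('n) + \<alpha>))))"
          unfolding C_def using bweight_nonneg by (intro mult_left_mono jump_kernel_dominated h) auto
        then show ?thesis by (simp add: jump_kernel_def mult_ac)
      qed (simp add: jump_kernel_def bweight_def)
    qed
  next
    have "(\<lambda>n. jump_kernel CARD('n) \<xi> \<alpha> (snap (h n) y)) \<longlonglongrightarrow> jump_kernel CARD('n) \<xi> \<alpha> y" for \<alpha> y
    proof (cases "y = 0")
      case True
      \<comment> \<open>The power of the norm is not continuous at 0, but rounding fixes the origin,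
        so the sequence is constant there.\<close>
      then have "snap (h n) y = 0" for n by (simp add: vec_eq_iff snap_nth)
      with True show ?thesis by simp
    next
      case False
      then show ?thesis unfolding jump_kernel_def by (intro tendsto_intros snap_tendsto h) auto
    qed
    then show "AE p in A \<Otimes>\<^sub>M lborel. (\<lambda>n. case p of (\<alpha>, y) \<Rightarrow> ennreal (jump_kernel CARD('n) \<xi> \<alpha> (snap (h n) y)))
        \<longlonglongrightarrow> (case p of (\<alpha>, y) \<Rightarrow> ennreal (jump_kernel CARD('n) \<xi> \<alpha> y))"
      by (auto intro!: AE_I2 tendsto_ennrealI)
  qed
  then have "(\<lambda>n. \<integral>\<^sup>+\<alpha>. \<integral>\<^sup>+y. ennreal (jump_kernel CARD('n) \<xi> \<alpha> (snap (h n) y)) \<partial>lborel \<partial>A)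
     \<longlonglongrightarrow> (\<integral>\<^sup>+\<alpha>. \<integral>\<^sup>+y. ennreal (jump_kernel CARD('n) \<xi> \<alpha> y) \<partial>lborel \<partial>A)"
    using lborel.nn_integral_fst[OF meas_snap] lborel.nn_integral_fst[OF meas] by simp
  also have "(\<integral>\<^sup>+\<alpha>. \<integral>\<^sup>+y. ennreal (jump_kernel CARD('n) \<xi> \<alpha> y) \<partial>lborel \<partial>A)
     = (\<integral>\<^sup>+\<alpha>. ennreal (indicator {0<..2} \<alpha> * norm \<xi> powr \<alpha>) \<partial>A)"
  proof (rule nn_integral_cong_AE)
    \<comment> \<open>At order 2 the limit kernel is 0 because b vanishes, whereas the symbol would
      be |\<xi>|^2. The absence of an atom at 2 enters here.\<close>
    have "AE \<alpha> in A. \<alpha> \<noteq> 2" using A2 A by (intro AE_I[of _ _ "{2}"]) auto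
    then show "AE \<alpha> in A. (\<integral>\<^sup>+y. ennreal (jump_kernel CARD('n) \<xi> \<alpha> y) \<partial>lborel) = ennreal (indicator {0<..2} \<alpha> * norm \<xi> powr \<alpha>)"
    proof eventually_elim
      case (elim \<alpha>)
      show ?case
      proof (cases "\<alpha> \<in> {0<..2}")
        case True
        with elim have "0 < \<alpha>" "\<alpha> < 2" by auto
        from nn_integral_one_minus_cos[OF this, of \<xi>] True show ?thesis by (simp add: jump_kernel_def bweight_def)
      qed (simp add: jump_kernel_def bweight_def)
    qed
  qed
  finally show ?thesis .
qed

section \<open>The random walk\<close>

text \<open>Used in two directions: it turns the expectation of a function of the jump into a
  lattice sum, and a lattice sum weighted by cell volumes into a Lebesgue integral.\<close>

lemma nn_integral_countable_fibres:
  fixes X :: "'w \<Rightarrow> 'k::countable" and F :: "'k \<Rightarrow> ennreal"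
  assumes [measurable]: "X \<in> M \<rightarrow>\<^sub>M count_space UNIV"
  shows "(\<integral>\<^sup>+w. F (X w) \<partial>M) = (\<integral>\<^sup>+k. F k * emeasure M {w \<in> space M. X w = k} \<partial>count_space UNIV)"
proof -
  have "F (X w) = (\<integral>\<^sup>+k. F k * indicator {w \<in> space M. X w = k} w \<partial>count_space UNIV)" if "w \<in> space M" for w
  proof -
    have "(\<integral>\<^sup>+k. F k * indicator {w \<in> space M. X w = k} w \<partial>count_space UNIV)
        = (\<integral>\<^sup>+k. F k * indicator {X w} k \<partial>count_space UNIV)"
      using that by (intro nn_integral_cong) (auto simp: indicator_def)
    then show ?thesis by simp
  qed
  then have "(\<integral>\<^sup>+w. F (X w) \<partial>M) = (\<integral>\<^sup>+w. \<integral>\<^sup>+k. F k * indicator {w \<in> space M. X w = k} w \<partial>count_space UNIV \<partial>M)"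
    by (intro nn_integral_cong)
  also have "\<dots> = (\<integral>\<^sup>+k. \<integral>\<^sup>+w. F k * indicator {w \<in> space M. X w = k} w \<partial>M \<partial>count_space UNIV)"
    by (rule nn_integral_count_space_nn_integral) (auto intro!: countableI_type)
  finally show ?thesis by (simp add: nn_integral_cmult)
qed

locale order_weight = finite_measure A for A :: "real measure" +
  assumes sets_A [simp, measurable_cong]: "sets A = sets borel"
    and A_carrier: "emeasure A (- {0<..2}) = 0"
begin

lemma AE_order: "AE \<alpha> in A. \<alpha> \<in> {0<..2}"
  by (rule AE_I[of _ _ "- {0<..2}"]) (use A_carrier in auto)

text \<open>The factors |k|^(- \<alpha>) and h^(- \<alpha>) combine into a power of the norm of the
  lattice point h k. Boundedness of b and r^(- \<alpha>) \<le> 1 + r^(- 2) give the integrability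
  that lets the Bochner integral \<open>Q\<close> be read as a nonnegative one.\<close>

lemma ennreal_Q:
  fixes k :: "int ^ 'n"
  assumes h: "h > 0" and k: "k \<noteq> 0"
  shows "ennreal (Q A h k) = (\<integral>\<^sup>+\<alpha>. ennreal (bweight CARD('n) \<alpha> * norm (h *\<^sub>R lat k) powr (- \<alpha>)) \<partial>A)" (is ?nn)
    and "0 \<le> Q A h k" (is ?pos)
proof -
  define r where "r = norm (h *\<^sub>R lat k)"
  have lk: "norm (lat k) > 0" using k by simp
  have r: "r > 0" using h k by (simp add: r_def)
  obtain C where C: "\<And>\<alpha>. bweight CARD('n) \<alpha> \<le> C" using bweight_bounded[of "CARD('n)"] by auto
  have C0: "C \<ge> 0" using order.trans[OF bweight_nonneg C] .
  have bd: "bweight CARD('n) \<alpha> * r powr (- \<alpha>) \<le> C * (1 + (1 / r)\<^sup>2)" if "\<alpha> \<in> {0<..2}" for \<alpha>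
  proof -
    have "r powr (- \<alpha>) = (1 / r) powr \<alpha>" using r by (simp add: powr_minus powr_divide inverse_eq_divide)
    also have "\<dots> \<le> 1 + (1 / r)\<^sup>2" using that r by (intro powr_le_one_plus_power2) auto
    finally show ?thesis by (intro mult_mono C C0) auto
  qed
  have int: "integrable A (\<lambda>\<alpha>. bweight CARD('n) \<alpha> * r powr (- \<alpha>))"
  proof (rule integrable_const_bound[of _ "C * (1 + (1 / r)\<^sup>2)"])
    show "AE \<alpha> in A. norm (bweight CARD('n) \<alpha> * r powr (- \<alpha>)) \<le> C * (1 + (1 / r)\<^sup>2)"
      using AE_order by eventually_elim (use bd bweight_nonneg in \<open>auto simp: abs_mult\<close>)
  qed measurable
  have "AE \<alpha> in A. norm (lat k) powr (- \<alpha>) * (bconst CARD('n) \<alpha> / h powr \<alpha>) = bweight CARD('n) \<alpha> * r powr (- \<alpha>)"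
    using AE_order
  proof eventually_elim
    case (elim \<alpha>)
    then show ?case using h lk by (simp add: bweight_def r_def powr_mult powr_minus field_simps)
  qed
  then have Q: "Q A h k = (\<integral>\<alpha>. bweight CARD('n) \<alpha> * r powr (- \<alpha>) \<partial>A)"
    unfolding Q_def by (intro integral_cong_AE) measurable
  show ?nn unfolding Q r_def[symmetric]
    by (rule nn_integral_eq_integral[OF int, symmetric]) (simp add: bweight_nonneg)
  show ?pos unfolding Q by (intro integral_nonneg_AE) (simp add: bweight_nonneg)
qed

text \<open>Since |k|^(- N) = h^N |h k|^(- N), the probability of a jump is \<tau> times a kernel at
  the lattice point h k times the volume h^N of its cell. At k = 0 both sides vanish through the
  factor 1 - cos.\<close>

lemma jump_mass:
  fixes k :: "int ^ 'n" and \<xi> :: "real ^ 'n"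
  assumes h: "h > 0" and \<tau>: "\<tau> \<ge> 0"
  shows "ennreal (1 - cos (\<xi> \<bullet> (h *\<^sub>R lat k))) * ennreal (jump_prob A \<tau> h k)
    = ennreal \<tau> * (\<integral>\<^sup>+\<alpha>. ennreal (jump_kernel CARD('n) \<xi> \<alpha> (h *\<^sub>R lat k)) \<partial>A) * ennreal (h ^ CARD('n))"
proof (cases "k = 0")
  case True
  then show ?thesis by (simp add: jump_kernel_def)
next
  case False
  define z where "z = h *\<^sub>R lat k"
  have z: "norm z > 0" using h False by (simp add: z_def)
  have "ennreal (jump_kernel CARD('n) \<xi> \<alpha> z)
    = ennreal (2 * (1 - cos (\<xi> \<bullet> z)) / norm z ^ CARD('n)) * ennreal (bweight CARD('n) \<alpha> * norm z powr (- \<alpha>))" for \<alpha>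
  proof -
    have "norm z powr (- (real CARD('n) + \<alpha>)) = norm z powr (- \<alpha>) / norm z ^ CARD('n)"
      using z by (simp add: powr_diff powr_realpow powr_minus_divide[of _ "real CARD('n)"] algebra_simps powr_minus field_simps powr_add)
    then have "jump_kernel CARD('n) \<xi> \<alpha> z
       = (2 * (1 - cos (\<xi> \<bullet> z)) / norm z ^ CARD('n)) * (bweight CARD('n) \<alpha> * norm z powr (- \<alpha>))"
      by (simp add: jump_kernel_def)
    moreover have "0 \<le> 2 * (1 - cos (\<xi> \<bullet> z)) / norm z ^ CARD('n)" by simp
    ultimately show ?thesis by (simp only: ennreal_mult')
  qed
  then have "(\<integral>\<^sup>+\<alpha>. ennreal (jump_kernel CARD('n) \<xi> \<alpha> z) \<partial>A)
    = ennreal (2 * (1 - cos (\<xi> \<bullet> z)) / norm z ^ CARD('n)) * ennreal (Q A h k)"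
    unfolding ennreal_Q(1)[OF h False] z_def[symmetric] by (simp add: nn_integral_cmult)
  then have K: "(\<integral>\<^sup>+\<alpha>. ennreal (jump_kernel CARD('n) \<xi> \<alpha> z) \<partial>A)
    = ennreal (2 * (1 - cos (\<xi> \<bullet> z)) / norm z ^ CARD('n)) * ennreal (Q A h k)" .
  then have "ennreal \<tau> * (\<integral>\<^sup>+\<alpha>. ennreal (jump_kernel CARD('n) \<xi> \<alpha> z) \<partial>A) * ennreal (h ^ CARD('n))
    = ennreal (\<tau> * ((2 * (1 - cos (\<xi> \<bullet> z)) / norm z ^ CARD('n)) * Q A h k) * h ^ CARD('n))"
  proof -
    have "0 \<le> 2 * (1 - cos (\<xi> \<bullet> z)) / norm z ^ CARD('n)" "0 \<le> h ^ CARD('n)" using h by simp_all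
    with K \<tau> ennreal_Q(2)[OF h False] show ?thesis by (simp only: ennreal_mult mult_nonneg_nonneg)
  qed
  also have "\<tau> * ((2 * (1 - cos (\<xi> \<bullet> z)) / norm z ^ CARD('n)) * Q A h k) * h ^ CARD('n)
    = (1 - cos (\<xi> \<bullet> z)) * (2 * \<tau> * (Q A h k / norm (lat k) ^ CARD('n)))"
    using h False by (simp add: z_def power_mult_distrib field_simps)
  also have "ennreal \<dots> = ennreal (1 - cos (\<xi> \<bullet> z)) * ennreal (2 * \<tau> * (Q A h k / norm (lat k) ^ CARD('n)))"
    by (rule ennreal_mult') simp
  finally show ?thesis using False by (simp only: jump_prob_def z_def if_False)
qed

lemma jump_prob_minus: "jump_prob A \<tau> h (- k) = jump_prob A \<tau> h k"
  by (simp add: jump_prob_def Q_def lat_minus)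

end

text \<open>The \<psi> of the overview, with values in \<open>ennreal\<close> so that lattice sums
  and integrals over orders may be exchanged freely.\<close>

definition lattice_symbol :: "real measure \<Rightarrow> real \<Rightarrow> real ^ 'n \<Rightarrow> ennreal" where
  "lattice_symbol A h \<xi> = (\<integral>\<^sup>+\<alpha>. \<integral>\<^sup>+y. ennreal (jump_kernel CARD('n) \<xi> \<alpha> (snap h y)) \<partial>lborel \<partial>A)"

locale lattice_jump = order_weight A + M: prob_space M for A and M :: "'w measure" +
  fixes X :: "'w \<Rightarrow> int ^ 'n" and \<tau> h :: real
  assumes X [measurable]: "X \<in> M \<rightarrow>\<^sub>M count_space UNIV"
    and law: "\<And>k. M.prob {w \<in> space M. X w = k} = jump_prob A \<tau> h k"
    and \<tau>: "\<tau> \<ge> 0" and h: "h > 0"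
begin

abbreviation jump :: "'w \<Rightarrow> real ^ 'n" where "jump w \<equiv> h *\<^sub>R lat (X w)"

lemma measurable_jump [measurable]: "jump \<in> borel_measurable M"
  by (rule measurable_compose[OF X]) simp

text \<open>The expectation is a sum over lattice points, \<open>jump_mass\<close> writes each term
  with the volume of a cell, and summing over the cells restores an integral over space.\<close>

lemma one_minus_cos_jump:
  "(\<integral>\<^sup>+w. ennreal (1 - cos (\<xi> \<bullet> jump w)) \<partial>M) = ennreal \<tau> * lattice_symbol A h \<xi>"
proof -
  let ?K = "\<lambda>\<alpha> k. ennreal (jump_kernel CARD('n) \<xi> \<alpha> (h *\<^sub>R lat k))"
  have [measurable]: "(\<lambda>\<alpha>. jump_kernel CARD('n) \<xi> \<alpha> (z :: real ^ 'n)) \<in> borel_measurable borel" for z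
    unfolding jump_kernel_def by measurable
  have "(\<integral>\<^sup>+w. ennreal (1 - cos (\<xi> \<bullet> jump w)) \<partial>M)
      = (\<integral>\<^sup>+k. ennreal (1 - cos (\<xi> \<bullet> (h *\<^sub>R lat k))) * emeasure M {w \<in> space M. X w = k} \<partial>count_space UNIV)"
    by (rule nn_integral_countable_fibres[OF X])
  also have "\<dots> = (\<integral>\<^sup>+k. ennreal \<tau> * (\<integral>\<^sup>+\<alpha>. ?K \<alpha> k \<partial>A) * ennreal (h ^ CARD('n)) \<partial>count_space UNIV)"
    unfolding M.emeasure_eq_measure law jump_mass[OF h \<tau>] ..
  also have "\<dots> = (\<integral>\<^sup>+k. ennreal \<tau> * (\<integral>\<^sup>+\<alpha>. ?K \<alpha> k * emeasure lborel {y \<in> space lborel. cellindex h y = k} \<partial>A) \<partial>count_space UNIV)"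
    by (simp add: emeasure_cell[OF h] nn_integral_multc mult.assoc)
  also have "\<dots> = ennreal \<tau> * (\<integral>\<^sup>+k. \<integral>\<^sup>+\<alpha>. ?K \<alpha> k * emeasure lborel {y \<in> space lborel. cellindex h y = k} \<partial>A \<partial>count_space UNIV)"
    by (rule nn_integral_cmult) simp
  also have "(\<integral>\<^sup>+k. \<integral>\<^sup>+\<alpha>. ?K \<alpha> k * emeasure lborel {y \<in> space lborel. cellindex h y = k} \<partial>A \<partial>count_space UNIV)
     = (\<integral>\<^sup>+\<alpha>. \<integral>\<^sup>+k. ?K \<alpha> k * emeasure lborel {y \<in> space lborel. cellindex h y = k} \<partial>count_space UNIV \<partial>A)"
    by (rule nn_integral_count_space_nn_integral[symmetric]) (auto intro!: countableI_type)
  also have "\<dots> = lattice_symbol A h \<xi>"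
    unfolding lattice_symbol_def snap_def
    by (intro nn_integral_cong nn_integral_countable_fibres[symmetric]) simp
  finally show ?thesis .
qed

text \<open>The jump probabilities are even in k. This makes the characteristic function of a step
  real.\<close>

lemma jump_symmetric:
  "distr M (count_space UNIV) X = distr M (count_space UNIV) (\<lambda>w. - X w)"
proof (rule measure_eqI_countable[of _ UNIV])
  fix k :: "int ^ 'n"
  have "emeasure (distr M (count_space UNIV) X) {k} = ennreal (jump_prob A \<tau> h k)"
    by (subst emeasure_distr) (auto simp: law[symmetric] M.emeasure_eq_measure vimage_def Int_def conj_commute)
  moreover have "emeasure (distr M (count_space UNIV) (\<lambda>w. - X w)) {k} = ennreal (jump_prob A \<tau> h (- k))"
    by (subst emeasure_distr) (auto simp: law[symmetric] M.emeasure_eq_measure vimage_def Int_def conj_commute minus_equation_iff[of _ k] intro!: arg_cong[of _ _ M.prob])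
  ultimately show "emeasure (distr M (count_space UNIV) X) {k} = emeasure (distr M (count_space UNIV) (\<lambda>w. - X w)) {k}"
    by (simp add: jump_prob_minus)
qed (auto intro!: countableI_type)

lemma charfun_jump:
  "(\<integral>w. iexp (\<xi> \<bullet> jump w) \<partial>M) = complex_of_real (1 - \<tau> * enn2real (lattice_symbol A h \<xi>))"
proof -
  have i: "integrable M (\<lambda>w. sin (\<xi> \<bullet> jump w))" "integrable M (\<lambda>w. cos (\<xi> \<bullet> jump w))"
    by (auto intro!: M.integrable_const_bound[of _ 1])
  have "(\<integral>w. sin (\<xi> \<bullet> jump w) \<partial>M) = (\<integral>k. sin (\<xi> \<bullet> (h *\<^sub>R lat k)) \<partial>distr M (count_space UNIV) X)"
    by (simp add: integral_distr)
  also have "\<dots> = (\<integral>w. - sin (\<xi> \<bullet> jump w) \<partial>M)"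
    unfolding jump_symmetric by (simp add: integral_distr lat_minus)
  finally have s0: "(\<integral>w. sin (\<xi> \<bullet> jump w) \<partial>M) = 0" by simp
  have "ennreal (\<integral>w. 1 - cos (\<xi> \<bullet> jump w) \<partial>M) = ennreal \<tau> * lattice_symbol A h \<xi>"
    using i unfolding one_minus_cos_jump[symmetric]
    by (intro nn_integral_eq_integral[symmetric]) auto
  then have "enn2real (ennreal (\<integral>w. 1 - cos (\<xi> \<bullet> jump w) \<partial>M)) = \<tau> * enn2real (lattice_symbol A h \<xi>)"
    using \<tau> by (simp add: enn2real_mult)
  moreover have "0 \<le> (\<integral>w. 1 - cos (\<xi> \<bullet> jump w) \<partial>M)" by (intro integral_nonneg_AE) auto
  ultimately have c: "(\<integral>w. cos (\<xi> \<bullet> jump w) \<partial>M) = 1 - \<tau> * enn2real (lattice_symbol A h \<xi>)"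
    using i by (simp add: M.prob_space)
  have "(\<integral>w. iexp (\<xi> \<bullet> jump w) \<partial>M) = (\<integral>w. complex_of_real (cos (\<xi> \<bullet> jump w)) + \<i> * complex_of_real (sin (\<xi> \<bullet> jump w)) \<partial>M)"
    by (intro Bochner_Integration.integral_cong refl) (simp add: complex_eq_iff Re_exp Im_exp)
  also have "\<dots> = complex_of_real (\<integral>w. cos (\<xi> \<bullet> jump w) \<partial>M) + \<i> * complex_of_real (\<integral>w. sin (\<xi> \<bullet> jump w) \<partial>M)"
    using i by simp
  finally show ?thesis unfolding c s0 by simp
qed

end

section \<open>Independent steps and powers of characteristic functions\<close>

lemma (in prob_space) charfun_sum:
  fixes Y :: "nat \<Rightarrow> 'a \<Rightarrow> 'b::euclidean_space"
  assumes indep: "indep_vars (\<lambda>_. borel) Y {1..n}"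
    and id: "\<And>j. j \<in> {1..n} \<Longrightarrow> (\<integral>w. iexp (\<xi> \<bullet> Y j w) \<partial>M) = c"
  shows "charfun (distr M borel (\<lambda>w. \<Sum>j=1..n. Y j w)) \<xi> = c ^ n"
proof -
  have [measurable]: "Y j \<in> borel_measurable M" if "j \<in> {1..n}" for j
    using indep that by (auto simp: indep_vars_def)
  have "charfun (distr M borel (\<lambda>w. \<Sum>j=1..n. Y j w)) \<xi> = (\<integral>w. iexp (\<xi> \<bullet> (\<Sum>j=1..n. Y j w)) \<partial>M)"
    unfolding charfun_def by (subst integral_distr) measurable
  also have "\<dots> = (\<integral>w. (\<Prod>j=1..n. iexp (\<xi> \<bullet> Y j w)) \<partial>M)"
    by (simp add: inner_sum_right sum_distrib_left exp_sum)
  also have "\<dots> = (\<Prod>j=1..n. \<integral>w. iexp (\<xi> \<bullet> Y j w) \<partial>M)"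
  proof (rule indep_vars_lebesgue_integral)
    show "indep_vars (\<lambda>_. borel) (\<lambda>j w. iexp (\<xi> \<bullet> Y j w)) {1..n}"
      by (rule indep_vars_compose2[OF indep]) measurable
    show "integrable M (\<lambda>w. iexp (\<xi> \<bullet> Y j w))" if "j \<in> {1..n}" for j
      using that by (intro integrable_const_bound[of _ 1]) auto
  qed simp
  also have "\<dots> = c ^ n" using id by simp
  finally show ?thesis .
qed

text \<open>The given family provides exactly n steps for the n-th walk. A law for any other number
  of steps is built here as a convolution power, the image of a product measure under
  addition.\<close>

lemma convolution_power:
  fixes \<mu> :: "'a::euclidean_space measure"
  assumes "borel_prob \<mu>"
  obtains \<nu> :: "'a measure" where "borel_prob \<nu>" "\<And>\<xi>. charfun \<nu> \<xi> = charfun \<mu> \<xi> ^ m"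
proof -
  interpret m: borel_prob \<mu> by fact
  have "\<exists>\<nu> :: 'a measure. borel_prob \<nu> \<and> (\<forall>\<xi>. charfun \<nu> \<xi> = charfun \<mu> \<xi> ^ m)"
  proof (induction m)
    case 0
    have "borel_prob (return borel (0 :: 'a))"
      by (intro borel_prob.intro borel_prob_axioms.intro prob_space_return) auto
    moreover have "charfun (return borel (0 :: 'a)) \<xi> = 1" for \<xi>
      unfolding charfun_def by (subst integral_return) auto
    ultimately show ?case by auto
  next
    case (Suc m)
    then obtain \<nu> :: "'a measure" where "borel_prob \<nu>" and \<nu>: "\<And>\<xi>. charfun \<nu> \<xi> = charfun \<mu> \<xi> ^ m" by auto
    interpret n: borel_prob \<nu> by fact
    interpret P: pair_prob_space \<mu> \<nu> ..
    let ?D = "distr (\<mu> \<Otimes>\<^sub>M \<nu>) borel (\<lambda>p. fst p + snd p)"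
    have "borel_prob ?D"
      by (intro borel_prob.intro borel_prob_axioms.intro P.prob_space_distr) auto
    moreover have "charfun ?D \<xi> = charfun \<mu> \<xi> ^ Suc m" for \<xi>
    proof -
      have "charfun ?D \<xi> = (\<integral>p. iexp (\<xi> \<bullet> (fst p + snd p)) \<partial>(\<mu> \<Otimes>\<^sub>M \<nu>))"
        unfolding charfun_def by (subst integral_distr) auto
      also have "\<dots> = (\<integral>x. \<integral>y. iexp (\<xi> \<bullet> (x + y)) \<partial>\<nu> \<partial>\<mu>)"
        by (subst P.integral_fst'[symmetric]) (auto intro!: P.integrable_const_bound[of _ 1])
      also have "\<dots> = (\<integral>x. iexp (\<xi> \<bullet> x) * charfun \<nu> \<xi> \<partial>\<mu>)"
        by (simp add: inner_add_right distrib_left exp_add charfun_def)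
      also have "\<dots> = charfun \<mu> \<xi> * charfun \<nu> \<xi>" by (simp add: charfun_def[of \<mu>])
      finally show ?thesis by (simp add: \<nu>)
    qed
    ultimately show ?case by blast
  qed
  then show thesis using that by blast
qed

lemma abs_one_minus_exp_le:
  assumes "u \<ge> (0::real)"
  shows "\<bar>1 - u - exp (- u)\<bar> \<le> u\<^sup>2"
proof -
  have "exp (- u) \<ge> 1 - u" using exp_ge_add_one_self[of "- u"] by simp
  moreover have "exp (- u) \<le> 1 - u + u\<^sup>2"
  proof -
    have "exp (- u) \<le> 1 / (1 + u)"
      using exp_ge_add_one_self[of u] assms by (simp add: exp_minus inverse_eq_divide frac_le)
    also have "\<dots> \<le> 1 - u + u\<^sup>2"
    proof -
      \<comment> \<open>The product equals 1 + u^3.\<close>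
      have "1 \<le> (1 - u + u\<^sup>2) * (1 + u)" using assms by (simp add: algebra_simps power2_eq_square)
      then show ?thesis using assms by (simp add: divide_le_eq)
    qed
    finally show ?thesis .
  qed
  ultimately show ?thesis by simp
qed

text \<open>Both c n and exp (- (t / n) x n) lie in [- 1, 1], so their m-th powers differ by at most
  m times their difference, which is of second order in t / n. As m t / n stays bounded, the error
  tends to 0.\<close>

lemma power_one_minus_tendsto_exp:
  fixes c :: "nat \<Rightarrow> real"
  assumes x: "x \<longlonglongrightarrow> L" "\<And>n. 0 \<le> x n" and c: "\<And>n. n \<ge> 1 \<Longrightarrow> c n = 1 - t / real n * x n" "\<And>n. n \<ge> 1 \<Longrightarrow> \<bar>c n\<bar> \<le> 1"
    and t: "t > 0" and m: "(\<lambda>n. real (m n) * (t / real n)) \<longlonglongrightarrow> s"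
  shows "(\<lambda>n. c n ^ m n) \<longlonglongrightarrow> exp (- (s * L))"
proof -
  define w where "w n = exp (- (t / real n * x n))" for n
  have "(\<lambda>n. w n ^ m n) \<longlonglongrightarrow> exp (- (s * L))"
  proof -
    have "w n ^ m n = exp (- (real (m n) * (t / real n) * x n))" for n
      unfolding w_def exp_of_nat_mult[symmetric] by simp
    then show ?thesis by (simp only:) (intro tendsto_intros m x(1))
  qed
  moreover have "(\<lambda>n. c n ^ m n - w n ^ m n) \<longlonglongrightarrow> 0"
  proof (rule Lim_null_comparison)
    show "\<forall>\<^sub>F n in sequentially. norm (c n ^ m n - w n ^ m n) \<le> real (m n) * (t / real n) * (t / real n * (x n)\<^sup>2)"
      using eventually_ge_at_top[of 1]
    proof eventually_elim
      case (elim n)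
      have u: "t / real n * x n \<ge> 0" using t x(2) by simp
      have "norm (c n ^ m n - w n ^ m n) \<le> real (m n) * norm (c n - w n)"
        using c(2)[OF elim] u by (intro norm_power_diff) (auto simp: w_def)
      also have "\<dots> \<le> real (m n) * (t / real n * x n)\<^sup>2"
        unfolding c(1)[OF elim] w_def real_norm_def by (intro mult_left_mono abs_one_minus_exp_le u) simp
      finally show ?case by (simp add: power2_eq_square mult_ac)
    qed
    have "(\<lambda>n. t / real n) \<longlonglongrightarrow> 0" by (intro tendsto_divide_0[OF tendsto_const] filterlim_at_top_imp_at_infinity filterlim_real_sequentially)
    then have "(\<lambda>n. real (m n) * (t / real n) * (t / real n * (x n)\<^sup>2)) \<longlonglongrightarrow> s * (0 * L\<^sup>2)"
      by (intro tendsto_intros m x)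
    then show "(\<lambda>n. real (m n) * (t / real n) * (t / real n * (x n)\<^sup>2)) \<longlonglongrightarrow> 0" by simp
  qed
  ultimately show ?thesis using tendsto_add by fastforce
qed

section \<open>The symbol of the distributed order operator\<close>

lemma integrable_inverse_1_plus_square_real: "integrable lborel (\<lambda>t::real. 1 / (1 + t\<^sup>2))"
proof -
  have "set_integrable lborel (einterval (-\<infinity>) \<infinity>) (\<lambda>x::real. inverse (1 + x\<^sup>2))"
    by (rule integrable_inverse_1_plus_square)
  then show ?thesis by (simp add: set_integrable_def inverse_eq_divide)
qed

lemma prod_one_plus_square_le: "(\<Prod>b\<in>Basis. 1 + (x \<bullet> b)\<^sup>2) \<le> (1 + norm x) ^ (2 * DIM('a))" for x :: "'a::euclidean_space"
proof -
  have "(\<Prod>b\<in>Basis. 1 + (x \<bullet> b)\<^sup>2) \<le> (\<Prod>b\<in>(Basis :: 'a set). (1 + norm x)\<^sup>2)"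
  proof (rule prod_mono)
    fix b :: 'a assume "b \<in> Basis"
    then have "\<bar>x \<bullet> b\<bar> \<le> norm x" by (rule Basis_le_norm)
    then have "(x \<bullet> b)\<^sup>2 \<le> (norm x)\<^sup>2" by (simp add: abs_le_square_iff[symmetric])
    moreover have "(1 + norm x)\<^sup>2 = 1 + 2 * norm x + (norm x)\<^sup>2" by (simp add: power2_sum)
    ultimately show "0 \<le> 1 + (x \<bullet> b)\<^sup>2 \<and> 1 + (x \<bullet> b)\<^sup>2 \<le> (1 + norm x)\<^sup>2"
      using norm_ge_zero[of x] zero_le_power2[of "x \<bullet> b"] by linarith
  qed
  also have "\<dots> = (1 + norm x) ^ (2 * DIM('a))" by (simp add: power_mult)
  finally show ?thesis .
qed

text \<open>The majorant is the product over coordinates of 1 / (1 + x_b^2), an integrable function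
  whose reciprocal is at most (1 + |x|)^(2 N). This explains the exponent.\<close>

lemma integrable_decay:
  fixes c :: "'a::euclidean_space \<Rightarrow> 'b::{banach,second_countable_topology}"
  assumes [measurable]: "c \<in> borel_measurable borel" and C: "\<And>x. norm (c x) * (1 + norm x) ^ (2 * DIM('a)) \<le> C"
  shows "integrable lborel c"
proof (rule Bochner_Integration.integrable_bound)
  have "has_bochner_integral lborel (\<lambda>x::'a. \<Prod>b\<in>Basis. 1 / (1 + (x \<bullet> b)\<^sup>2)) (\<Prod>b\<in>(Basis :: 'a set). integral\<^sup>L lborel (\<lambda>t::real. 1 / (1 + t\<^sup>2)))"
    by (rule has_bochner_integral_lborel_prod) (rule has_bochner_integral_integrable[OF integrable_inverse_1_plus_square_real])
  then show "integrable lborel (\<lambda>x::'a. C * (\<Prod>b\<in>Basis. 1 / (1 + (x \<bullet> b)\<^sup>2)))"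
    by (auto simp: has_bochner_integral_iff)
  have "norm (c x) \<le> norm (C * (\<Prod>b\<in>Basis. 1 / (1 + (x \<bullet> b)\<^sup>2)))" for x
  proof -
    have p: "(\<Prod>b\<in>Basis. 1 + (x \<bullet> b)\<^sup>2) > 0" by (intro prod_pos) (smt (verit) zero_le_power2)
    have "norm (c x) * (\<Prod>b\<in>Basis. 1 + (x \<bullet> b)\<^sup>2) \<le> norm (c x) * (1 + norm x) ^ (2 * DIM('a))"
      by (intro mult_left_mono prod_one_plus_square_le) simp
    also have "\<dots> \<le> C" by (rule C)
    also have "\<dots> \<le> \<bar>C\<bar>" by simp
    finally have "norm (c x) \<le> \<bar>C\<bar> / (\<Prod>b\<in>Basis. 1 + (x \<bullet> b)\<^sup>2)" using p by (simp add: le_divide_eq)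
    then show ?thesis using p by (simp add: prod_dividef abs_mult)
  qed
  then show "AE x in lborel. norm (c x) \<le> norm (C * (\<Prod>b\<in>Basis. 1 / (1 + (x \<bullet> b)\<^sup>2)))" by simp
qed measurable

lemma one_plus_power_le:
  assumes "(r::real) \<ge> 0"
  shows "(1 + r) ^ m \<le> 2 ^ m * (1 + r ^ m)"
proof -
  have "(1 + r) ^ m \<le> (2 * max 1 r) ^ m" using assms by (intro power_mono) auto
  also have "\<dots> = 2 ^ m * max 1 r ^ m" by (simp add: power_mult_distrib)
  also have "\<dots> \<le> 2 ^ m * (1 + r ^ m)" using assms by (intro mult_left_mono) (auto simp: max_def)
  finally show ?thesis .
qed

lemma power_le_fact_mult_exp: "(y::real) \<ge> 0 \<Longrightarrow> y ^ K \<le> fact K * exp y"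
proof -
  assume y: "y \<ge> 0"
  have s: "(\<lambda>n. y ^ n /\<^sub>R fact n) sums exp y" by (rule exp_converges)
  have "(\<Sum>n\<in>{K}. y ^ n /\<^sub>R fact n) \<le> (\<Sum>n. y ^ n /\<^sub>R fact n)"
    using y s by (intro sum_le_suminf) (auto simp: sums_iff)
  then show ?thesis using s by (simp add: sums_iff field_simps)
qed

section \<open>Continuity and growth of the symbol\<close>

context order_weight
begin

definition symbol :: "real ^ 'n \<Rightarrow> real" where
  "symbol \<xi> = (\<integral>\<alpha>. norm \<xi> powr \<alpha> \<partial>A)"

lemma Bsym_eq: "Bsym A \<xi> = - symbol \<xi>" by (simp add: Bsym_def symbol_def)

lemma AE_powr_le: "AE \<alpha> in A. norm (r powr \<alpha>) \<le> 1 + r\<^sup>2" if "r \<ge> 0"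
  using AE_order by eventually_elim (use powr_le_one_plus_power2 that in auto)

lemma integrable_norm_powr: "integrable A (\<lambda>\<alpha>. norm (\<xi> :: real ^ 'n) powr \<alpha>)"
  by (rule integrable_const_bound[OF AE_powr_le]) auto

lemma symbol_nonneg: "0 \<le> symbol \<xi>"
  unfolding symbol_def by (intro integral_nonneg_AE) auto

lemma symbol_minus [simp]: "symbol (- \<xi>) = symbol \<xi>" by (simp add: symbol_def)

lemma symbol_le: "symbol \<xi> \<le> measure A (space A) * (1 + (norm \<xi>)\<^sup>2)"
proof -
  have "symbol \<xi> \<le> (\<integral>\<alpha>. 1 + (norm \<xi>)\<^sup>2 \<partial>A)"
    unfolding symbol_def using AE_powr_le[of "norm \<xi>"] by (intro integral_mono_AE integrable_norm_powr) auto
  then show ?thesis by simp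
qed

lemma continuous_symbol: "continuous_on UNIV (symbol :: real ^ 'n \<Rightarrow> real)"
  unfolding continuous_on_sequentially
proof (intro allI ballI impI, elim conjE)
  fix x :: "nat \<Rightarrow> real ^ 'n" and a assume x: "x \<longlonglongrightarrow> a"
  obtain K where K: "\<And>i. norm (x i) \<le> K" "K > 0" using convergent_imp_Bseq[OF convergentI[OF x]] by (auto simp: Bseq_def)
  show "(symbol \<circ> x) \<longlonglongrightarrow> symbol a"
    unfolding symbol_def comp_def
  proof (rule integral_dominated_convergence[where w="\<lambda>_. 1 + K\<^sup>2"])
    show "AE \<alpha> in A. (\<lambda>i. norm (x i) powr \<alpha>) \<longlonglongrightarrow> norm a powr \<alpha>"
      using AE_order
    proof eventually_elim
      case (elim \<alpha>)
      then show ?case using tendsto_norm[OF x] by (intro tendsto_powr' tendsto_const) auto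
    qed
    show "AE \<alpha> in A. norm (norm (x i) powr \<alpha>) \<le> 1 + K\<^sup>2" for i
      using AE_powr_le[OF norm_ge_zero[of "x i"]]
    proof eventually_elim
      case (elim \<alpha>)
      have "(norm (x i))\<^sup>2 \<le> K\<^sup>2" using K by (intro power_mono) auto
      then show ?case using elim by simp
    qed
  qed auto
qed

lemma symbol_measurable [measurable]: "symbol \<in> borel_measurable borel"
  by (rule borel_measurable_continuous_onI[OF continuous_symbol])

lemma nn_symbol: "(\<integral>\<^sup>+\<alpha>. ennreal (indicator {0<..2} \<alpha> * norm \<xi> powr \<alpha>) \<partial>A) = ennreal (symbol \<xi>)"
proof -
  have "(\<integral>\<^sup>+\<alpha>. ennreal (indicator {0<..2} \<alpha> * norm \<xi> powr \<alpha>) \<partial>A) = (\<integral>\<^sup>+\<alpha>. ennreal (norm \<xi> powr \<alpha>) \<partial>A)"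
    by (intro nn_integral_cong_AE) (use AE_order in \<open>eventually_elim, simp\<close>)
  also have "\<dots> = ennreal (symbol \<xi>)"
    unfolding symbol_def by (rule nn_integral_eq_integral[OF integrable_norm_powr]) simp
  finally show ?thesis .
qed

text \<open>The intervals [1 / (k + 1), 2] exhaust (0,2], so one of them has positive mass. On it
  the order is at least \<epsilon>, and |\<xi>|^\<alpha> is monotone in \<alpha> once |\<xi>| \<ge>
  1.\<close>

lemma symbol_lower_bound:
  assumes "emeasure A {0<..2} \<noteq> 0"
  obtains c \<epsilon> :: real where "c > 0" "\<epsilon> > 0" "\<And>\<xi> :: real ^ 'n. norm \<xi> \<ge> 1 \<Longrightarrow> c * norm \<xi> powr \<epsilon> \<le> symbol \<xi>"
proof -
  have U: "{0<..2::real} = (\<Union>k::nat. {1 / real (Suc k)..2})"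
  proof (intro equalityI subsetI)
    fix x :: real assume x: "x \<in> {0<..2}"
    then obtain k where "inverse (real (Suc k)) < x" using reals_Archimedean by auto
    then show "x \<in> (\<Union>k::nat. {1 / real (Suc k)..2})" using x by (auto simp: inverse_eq_divide intro!: exI[of _ k])
  next
    fix x :: real assume "x \<in> (\<Union>k::nat. {1 / real (Suc k)..2})"
    then obtain k :: nat where "1 / real (Suc k) \<le> x" "x \<le> 2" by auto
    moreover have "0 < 1 / real (Suc k)" by simp
    ultimately show "x \<in> {0<..2}" by (meson greaterThanAtMost_iff order_less_le_trans)
  qed
  have "\<exists>k::nat. emeasure A {1 / real (Suc k)..2} \<noteq> 0"
  proof (rule ccontr)
    assume "\<not> ?thesis"
    then have "\<And>k::nat. {1 / real (Suc k)..2} \<in> null_sets A" by (auto intro!: null_setsI)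
    then have "(\<Union>k::nat. {1 / real (Suc k)..2}) \<in> null_sets A" by (rule null_sets_UN)
    then show False using assms U by auto
  qed
  then obtain k :: nat where k: "emeasure A {1 / real (Suc k)..2} \<noteq> 0" by auto
  define \<epsilon> where "\<epsilon> = 1 / real (Suc k)"
  define c where "c = measure A {\<epsilon>..2}"
  have c: "c > 0" using k by (simp add: c_def \<epsilon>_def emeasure_eq_measure zero_less_measure_iff)
  have "c * norm \<xi> powr \<epsilon> \<le> symbol \<xi>" if "norm \<xi> \<ge> 1" for \<xi> :: "real ^ 'n"
  proof -
    have "c * norm \<xi> powr \<epsilon> = (\<integral>\<alpha>. indicator {\<epsilon>..2} \<alpha> * norm \<xi> powr \<epsilon> \<partial>A)" by (simp add: c_def)
    also have "\<dots> \<le> symbol \<xi>"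
      unfolding symbol_def
    proof (rule integral_mono)
      show "integrable A (\<lambda>\<alpha>. indicator {\<epsilon>..2} \<alpha> * norm \<xi> powr \<epsilon>)"
        by (intro integrable_mult_left integrable_real_indicator) (auto simp: less_top[symmetric])
      show "indicator {\<epsilon>..2} \<alpha> * norm \<xi> powr \<epsilon> \<le> norm \<xi> powr \<alpha>" for \<alpha>
        using that by (auto simp: indicator_def intro!: powr_mono)
    qed (rule integrable_norm_powr)
    finally show ?thesis .
  qed
  moreover have "\<epsilon> > 0" by (simp add: \<epsilon>_def)
  ultimately show thesis using that c by blast
qed

lemma integrable_exp_symbol:
  assumes A0: "emeasure A {0<..2} \<noteq> 0" and s: "s > 0"
  shows "integrable lborel (\<lambda>\<xi> :: real ^ 'n. exp (- (s * symbol \<xi>)))"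
proof -
  obtain c \<epsilon> where c: "c > 0" "\<epsilon> > 0" and lb: "\<And>\<xi> :: real ^ 'n. norm \<xi> \<ge> 1 \<Longrightarrow> c * norm \<xi> powr \<epsilon> \<le> symbol \<xi>"
    using symbol_lower_bound[OF A0] by metis
  let ?m = "2 * CARD('n)"
  \<comment> \<open>The exponent may grow as slowly as |\<xi>|^\<epsilon>. With \<epsilon> K \<ge> 2
    N, the inequality y^K \<le> K! exp y for y = s c |\<xi>|^\<epsilon> still yields decay of order
    |\<xi>|^(- 2 N).\<close>
  obtain K :: nat where "real ?m / \<epsilon> \<le> real K" using real_arch_simple by blast
  then have K: "real ?m \<le> \<epsilon> * real K" using c(2) by (simp add: field_simps)
  show ?thesis
  proof (rule integrable_decay[where C="2 ^ ?m * (1 + fact K / (s * c) ^ K)"])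
    fix \<xi> :: "real ^ 'n"
    define E where "E = exp (- (s * symbol \<xi>))"
    have E: "0 < E" "E \<le> 1" using s symbol_nonneg[of \<xi>] by (auto simp: E_def)
    have F: "0 \<le> fact K / (s * c) ^ K" using s c by simp
    have "E * (1 + norm \<xi>) ^ ?m \<le> 2 ^ ?m * (1 + fact K / (s * c) ^ K)"
    proof (cases "norm \<xi> \<ge> 1")
      case False
      then have "E * (1 + norm \<xi>) ^ ?m \<le> 1 * 2 ^ ?m" using E by (intro mult_mono power_mono) auto
      also have "\<dots> \<le> (1 + fact K / (s * c) ^ K) * 2 ^ ?m" using F by (intro mult_right_mono) auto
      finally show ?thesis by (simp only: mult.commute)
    next
      case True
      define y where "y = s * (c * norm \<xi> powr \<epsilon>)"
      have nz: "norm \<xi> > 0" "norm \<xi> powr \<epsilon> > 0" using True by linarith (use True in auto)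
      have y0: "y \<ge> 0" using s c by (simp add: y_def)
      have "E \<le> exp (- y)" using lb[OF True] s by (simp add: E_def y_def)
      then have "E * y ^ K \<le> exp (- y) * (fact K * exp y)"
        using y0 E power_le_fact_mult_exp[OF y0, of K] by (intro mult_mono) auto
      also have "\<dots> = fact K" by (simp add: exp_minus)
      finally have 1: "E * y ^ K \<le> fact K" .
      have "y ^ K = (s * c) ^ K * norm \<xi> powr (\<epsilon> * real K)"
        using nz by (simp add: y_def power_mult_distrib powr_powr[symmetric] powr_realpow mult_ac)
      moreover have "norm \<xi> ^ ?m \<le> norm \<xi> powr (\<epsilon> * real K)"
        using powr_mono[OF K True] powr_realpow[OF nz(1), of ?m] by simp
      ultimately have "E * ((s * c) ^ K * norm \<xi> ^ ?m) \<le> E * y ^ K"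
        using E s c by (simp add: mult_left_mono)
      with 1 have "(s * c) ^ K * (E * norm \<xi> ^ ?m) \<le> fact K" by (simp add: mult_ac)
      then have "E * norm \<xi> ^ ?m \<le> fact K / (s * c) ^ K" using s c by (simp add: le_divide_eq mult.commute)
      then have "E * (1 + norm \<xi> ^ ?m) \<le> 1 + fact K / (s * c) ^ K" using E by (simp add: distrib_left)
      then have "2 ^ ?m * (E * (1 + norm \<xi> ^ ?m)) \<le> 2 ^ ?m * (1 + fact K / (s * c) ^ K)" by (intro mult_left_mono) auto
      moreover have "E * (1 + norm \<xi>) ^ ?m \<le> E * (2 ^ ?m * (1 + norm \<xi> ^ ?m))"
        using E by (intro mult_left_mono one_plus_power_le) auto
      moreover have "E * (2 ^ ?m * (1 + norm \<xi> ^ ?m)) = 2 ^ ?m * (E * (1 + norm \<xi> ^ ?m))"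
        by (rule mult.left_commute)
      ultimately show ?thesis by linarith
    qed
    then show "norm (exp (- (s * symbol \<xi>))) * (1 + norm \<xi>) ^ (2 * DIM(real ^ 'n)) \<le> 2 ^ ?m * (1 + fact K / (s * c) ^ K)"
      by (simp add: E_def)
  qed measurable
qed

end

section \<open>Fourier transforms of Schwartz functions\<close>

text \<open>Averaging D over translations along the segment from 0 to v does not change its
  integral. By the fundamental theorem of calculus the averaged function is F (x + v) - F x, whose
  integral is 0 by translation invariance. This replaces integration by parts.\<close>

lemma integral_directional_derivative:
  fixes F D :: "'a::euclidean_space \<Rightarrow> complex"
  assumes F: "\<And>x. (F has_derivative F' x) (at x)" and D: "\<And>x. D x = F' x v"
    and F_int: "integrable lborel F" and D_int: "integrable lborel D" and D_cont: "continuous_on UNIV D"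
  shows "integral\<^sup>L lborel D = 0"
proof -
  have [measurable]: "D \<in> borel_measurable borel" using D_int by auto
  have tr: "has_bochner_integral lborel (\<lambda>x. g (x + r *\<^sub>R v)) (integral\<^sup>L lborel g)" if "integrable lborel g" for g :: "'a \<Rightarrow> complex" and r :: real
    using has_bochner_integral_lborel_affine[OF has_bochner_integral_integrable[OF that], of 1 "r *\<^sub>R v"] by (simp add: add.commute)
  have tr_norm: "(\<integral>x. norm (D (x + r *\<^sub>R v)) \<partial>lborel) = (\<integral>x. norm (D x) \<partial>lborel)" for r
    using has_bochner_integral_lborel_affine[OF has_bochner_integral_integrable[OF integrable_norm[OF D_int]], of 1 "r *\<^sub>R v"]
    by (simp add: add.commute has_bochner_integral_iff)
  have int: "integrable (lborel \<Otimes>\<^sub>M lborel) (\<lambda>(r, x). indicator {0..1::real} r *\<^sub>R D (x + r *\<^sub>R v))"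
  proof (rule lborel_pair.Fubini_integrable)
    show "integrable lborel (\<lambda>r. \<integral>x. norm (case (r, x) of (r, x) \<Rightarrow> indicator {0..1::real} r *\<^sub>R D (x + r *\<^sub>R v)) \<partial>lborel)"
      by (simp add: tr_norm)
    show "AE r in lborel. integrable lborel (\<lambda>x. case (r, x) of (r, x) \<Rightarrow> indicator {0..1::real} r *\<^sub>R D (x + r *\<^sub>R v))"
      using tr[OF D_int] by (auto simp: has_bochner_integral_iff)
  qed measurable
  have ftc: "(\<integral>r. indicator {0..1::real} r *\<^sub>R D (x + r *\<^sub>R v) \<partial>lborel) = F (x + 1 *\<^sub>R v) - F (x + 0 *\<^sub>R v)" for x
  proof (rule integral_FTC_atLeastAtMost)
    fix r :: real
    have "((\<lambda>r. x + r *\<^sub>R v) has_derivative (\<lambda>r. r *\<^sub>R v)) (at r within {0..1})"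
      by (auto intro!: derivative_eq_intros)
    from has_derivative_compose[OF this F]
    have "((\<lambda>r. F (x + r *\<^sub>R v)) has_derivative (\<lambda>s. F' (x + r *\<^sub>R v) (s *\<^sub>R v))) (at r within {0..1})" .
    moreover have "F' (x + r *\<^sub>R v) (s *\<^sub>R v) = s *\<^sub>R D (x + r *\<^sub>R v)" for s
      using linear_scale[OF has_derivative_linear[OF F]] by (simp add: D)
    ultimately show "((\<lambda>r. F (x + r *\<^sub>R v)) has_vector_derivative D (x + r *\<^sub>R v)) (at r within {0..1})"
      by (simp add: has_vector_derivative_def)
  next
    show "continuous_on {0..1} (\<lambda>r. D (x + r *\<^sub>R v))"
      by (intro continuous_on_compose2[OF D_cont] continuous_intros) auto
  qed simp
  have "integral\<^sup>L lborel D = (\<integral>r. indicator {0..1::real} r *\<^sub>R integral\<^sup>L lborel D \<partial>lborel)" by simp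
  also have "\<dots> = (\<integral>r. \<integral>x. indicator {0..1::real} r *\<^sub>R D (x + r *\<^sub>R v) \<partial>lborel \<partial>lborel)"
    using tr[OF D_int] by (simp add: has_bochner_integral_iff)
  also have "\<dots> = (\<integral>x. \<integral>r. indicator {0..1::real} r *\<^sub>R D (x + r *\<^sub>R v) \<partial>lborel \<partial>lborel)"
    by (rule lborel_pair.Fubini_integral[symmetric]) (use int in simp)
  also have "\<dots> = (\<integral>x. F (x + 1 *\<^sub>R v) - F (x + 0 *\<^sub>R v) \<partial>lborel)" unfolding ftc ..
  also have "\<dots> = 0"
    using tr[OF F_int, of 1] tr[OF F_int, of 0] by (simp add: has_bochner_integral_iff)
  finally show ?thesis .
qed

lemma schwartz_bound:
  assumes f: "schwartz f"
  obtains C where "\<And>x. norm (iter_deriv vs f x) * (1 + norm x) ^ k \<le> C"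
proof -
  have "bounded (range (\<lambda>x. norm x ^ 0 *\<^sub>R iter_deriv vs f x))" "bounded (range (\<lambda>x. norm x ^ k *\<^sub>R iter_deriv vs f x))"
    using f unfolding schwartz_def by blast+
  then obtain C0 Ck where C: "\<And>x. norm (iter_deriv vs f x) \<le> C0" "\<And>x. norm x ^ k * norm (iter_deriv vs f x) \<le> Ck"
    unfolding bounded_iff by auto
  have "norm (iter_deriv vs f x) * (1 + norm x) ^ k \<le> 2 ^ k * (C0 + Ck)" for x
  proof -
    have "norm (iter_deriv vs f x) * (1 + norm x) ^ k \<le> norm (iter_deriv vs f x) * (2 ^ k * (1 + norm x ^ k))"
      by (intro mult_left_mono one_plus_power_le) auto
    also have "\<dots> = 2 ^ k * (norm (iter_deriv vs f x) + norm x ^ k * norm (iter_deriv vs f x))" by (simp add: algebra_simps)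
    also have "\<dots> \<le> 2 ^ k * (C0 + Ck)" by (intro mult_left_mono add_mono C) auto
    finally show ?thesis .
  qed
  then show thesis by (rule that)
qed

lemma schwartz_differentiable: "schwartz f \<Longrightarrow> iter_deriv vs f differentiable (at x)"
  unfolding schwartz_def by blast

lemma schwartz_continuous: "schwartz f \<Longrightarrow> continuous_on UNIV (iter_deriv vs f)"
  by (intro continuous_at_imp_continuous_on ballI differentiable_imp_continuous_within schwartz_differentiable)

lemma schwartz_integrable:
  fixes f :: "real ^ 'n \<Rightarrow> complex"
  assumes f: "schwartz f"
  shows "integrable lborel (iter_deriv vs f)"
proof -
  obtain C where "\<And>x. norm (iter_deriv vs f x) * (1 + norm x) ^ (2 * DIM(real ^ 'n)) \<le> C"
    using schwartz_bound[OF f, where k="2 * DIM(real ^ 'n)" and vs=vs] by metis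
  then show ?thesis
    by (intro integrable_decay borel_measurable_continuous_onI schwartz_continuous f)
qed

text \<open>The directional derivative of iexp (\<xi> \<bullet> x) g x has integral 0, and the
  product rule splits it into the two transforms.\<close>

lemma fourier_iter_deriv:
  fixes f :: "real ^ 'n \<Rightarrow> complex"
  assumes f: "schwartz f"
  shows "fourier (iter_deriv (v # vs) f) \<xi> = - (\<i> * complex_of_real (\<xi> \<bullet> v)) * fourier (iter_deriv vs f) \<xi>"
proof -
  let ?g = "iter_deriv vs f" and ?d = "iter_deriv (v # vs) f"
  let ?D = "\<lambda>x. iexp (\<xi> \<bullet> x) * ?d x + \<i> * complex_of_real (\<xi> \<bullet> v) * (iexp (\<xi> \<bullet> x) * ?g x)"
  have g: "(?g has_derivative frechet_derivative ?g (at x)) (at x)" for x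
    using schwartz_differentiable[OF f] frechet_derivative_works by blast
  have der: "((\<lambda>x. iexp (\<xi> \<bullet> x) * ?g x) has_derivative
     (\<lambda>w. iexp (\<xi> \<bullet> x) * frechet_derivative ?g (at x) w + (\<i> * complex_of_real (\<xi> \<bullet> w)) * iexp (\<xi> \<bullet> x) * ?g x)) (at x)" for x
  proof -
    have "((\<lambda>x. \<i> * complex_of_real (\<xi> \<bullet> x)) has_derivative (\<lambda>w. \<i> * complex_of_real (\<xi> \<bullet> w))) (at x)"
      by (intro has_derivative_mult_right has_derivative_of_real has_derivative_inner_right has_derivative_ident)
    from has_derivative_compose[OF this DERIV_exp[THEN has_field_derivative_imp_has_derivative]]
    have "((\<lambda>x. iexp (\<xi> \<bullet> x)) has_derivative (\<lambda>w. iexp (\<xi> \<bullet> x) * (\<i> * complex_of_real (\<xi> \<bullet> w)))) (at x)" .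
    from has_derivative_mult[OF this g] show ?thesis by (simp only: mult.commute)
  qed
  have mi: "integrable lborel (\<lambda>x. iexp (\<xi> \<bullet> x) * iter_deriv ws f x)" for ws
    by (rule Bochner_Integration.integrable_bound[OF schwartz_integrable[OF f, of ws]])
       (auto simp: norm_mult intro!: borel_measurable_times borel_measurable_continuous_onI[OF schwartz_continuous[OF f]])
  have "integral\<^sup>L lborel ?D = 0"
  proof (rule integral_directional_derivative[OF der, where v=v])
    show "integrable lborel ?D" by (intro Bochner_Integration.integrable_add integrable_mult_right mi)
    show "continuous_on UNIV ?D" by (intro continuous_intros schwartz_continuous f)
  qed (use mi[of vs] in \<open>auto simp: mult_ac\<close>)
  also have "integral\<^sup>L lborel ?D = fourier ?d \<xi> + \<i> * complex_of_real (\<xi> \<bullet> v) * fourier ?g \<xi>"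
    unfolding fourier_def using mi[of "v # vs"] mi[of vs] by (subst Bochner_Integration.integral_add) auto
  finally show ?thesis by (simp add: eq_neg_iff_add_eq_0)
qed

lemma fourier_norm_le: "norm (fourier f \<xi>) \<le> (\<integral>x. norm (f x) \<partial>lborel)"
proof -
  have "norm (fourier f \<xi>) \<le> (\<integral>x. norm (iexp (\<xi> \<bullet> x) * f x) \<partial>lborel)"
    unfolding fourier_def by (rule integral_norm_bound)
  then show ?thesis by (simp only: norm_mult norm_exp_i_times mult_1)
qed

lemma fourier_schwartz_decay:
  fixes f :: "real ^ 'n \<Rightarrow> complex"
  assumes f: "schwartz f"
  obtains C where "\<And>\<xi>. norm (fourier f \<xi>) * (1 + norm \<xi>) ^ k \<le> C"
proof -
  have it: "\<bar>\<xi> \<bullet> v\<bar> ^ k * norm (fourier f \<xi>) = norm (fourier (iter_deriv (replicate k v) f) \<xi>)" for \<xi> v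
  proof (induction k)
    case (Suc k)
    then show ?case
      unfolding replicate_Suc fourier_iter_deriv[OF f] norm_mult by (simp add: norm_mult)
  qed simp
  define Ck where "Ck v = (\<integral>x. norm (iter_deriv (replicate k v) f x) \<partial>lborel)" for v
  define C0 where "C0 = (\<integral>x. norm (f x) \<partial>lborel)"
  have "norm (fourier f \<xi>) * (1 + norm \<xi>) ^ k \<le> 2 ^ k * (C0 + real CARD('n) ^ k * (\<Sum>v\<in>Basis. Ck v))" for \<xi>
  proof -
    have Ck0: "Ck v \<ge> 0" for v unfolding Ck_def by (intro integral_nonneg_AE) auto
    have "norm \<xi> ^ k * norm (fourier f \<xi>) \<le> real CARD('n) ^ k * (\<Sum>v\<in>Basis. Ck v)"
    proof -
      \<comment> \<open>The direction of the largest coordinate satisfies |\<xi>| \<le> N |\<xi>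
        \<bullet> v|, so k derivatives along v control |\<xi>|^k. As v depends on \<xi>, the
        constants are summed over the basis.\<close>
      obtain v where v: "v \<in> Basis" "\<And>w. w \<in> Basis \<Longrightarrow> \<bar>\<xi> \<bullet> w\<bar> \<le> \<bar>\<xi> \<bullet> v\<bar>"
      proof -
        have "\<exists>v\<in>Basis. \<forall>w\<in>Basis. \<bar>\<xi> \<bullet> w\<bar> \<le> \<bar>\<xi> \<bullet> v\<bar>"
          using finite_Basis nonempty_Basis
            Max_in[of "(\<lambda>w. \<bar>\<xi> \<bullet> w\<bar>) ` Basis"] Max_ge[of "(\<lambda>w. \<bar>\<xi> \<bullet> w\<bar>) ` Basis"] by fastforce
        then show thesis using that by blast
      qed
      have "norm \<xi> \<le> (\<Sum>w\<in>Basis. \<bar>\<xi> \<bullet> w\<bar>)" by (rule norm_le_l1)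
      also have "\<dots> \<le> (\<Sum>w\<in>(Basis :: (real ^ 'n) set). \<bar>\<xi> \<bullet> v\<bar>)" by (intro sum_mono v(2))
      also have "\<dots> = real CARD('n) * \<bar>\<xi> \<bullet> v\<bar>" by simp
      finally have "norm \<xi> ^ k \<le> (real CARD('n) * \<bar>\<xi> \<bullet> v\<bar>) ^ k" by (intro power_mono) auto
      then have "norm \<xi> ^ k * norm (fourier f \<xi>) \<le> (real CARD('n) * \<bar>\<xi> \<bullet> v\<bar>) ^ k * norm (fourier f \<xi>)"
        by (intro mult_right_mono) auto
      also have "\<dots> = real CARD('n) ^ k * (\<bar>\<xi> \<bullet> v\<bar> ^ k * norm (fourier f \<xi>))" by (simp add: power_mult_distrib)
      also have "\<dots> \<le> real CARD('n) ^ k * Ck v" unfolding it Ck_def by (intro mult_left_mono fourier_norm_le) auto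
      also have "\<dots> \<le> real CARD('n) ^ k * (\<Sum>v\<in>Basis. Ck v)"
        using v(1) Ck0 by (intro mult_left_mono member_le_sum) auto
      finally show ?thesis .
    qed
    moreover have "norm (fourier f \<xi>) \<le> C0" unfolding C0_def by (rule fourier_norm_le)
    ultimately have "norm (fourier f \<xi>) * (1 + norm \<xi> ^ k) \<le> C0 + real CARD('n) ^ k * (\<Sum>v\<in>Basis. Ck v)"
      by (simp add: algebra_simps)
    then have "2 ^ k * (norm (fourier f \<xi>) * (1 + norm \<xi> ^ k)) \<le> 2 ^ k * (C0 + real CARD('n) ^ k * (\<Sum>v\<in>Basis. Ck v))"
      by (intro mult_left_mono) auto
    moreover have "norm (fourier f \<xi>) * (1 + norm \<xi>) ^ k \<le> norm (fourier f \<xi>) * (2 ^ k * (1 + norm \<xi> ^ k))"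
      by (intro mult_left_mono one_plus_power_le) auto
    moreover have "norm (fourier f \<xi>) * (2 ^ k * (1 + norm \<xi> ^ k)) = 2 ^ k * (norm (fourier f \<xi>) * (1 + norm \<xi> ^ k))"
      by (rule mult.left_commute)
    ultimately show ?thesis by linarith
  qed
  then show thesis by (rule that)
qed

lemma fourier_measurable [measurable]:
  fixes f :: "real ^ 'n \<Rightarrow> complex"
  assumes [measurable]: "f \<in> borel_measurable borel"
  shows "fourier f \<in> borel_measurable borel"
  unfolding fourier_def[abs_def] by measurable

text \<open>The weight 1 + |\<xi>|^2 dominates |\<xi>|^\<alpha> for all orders and, up to the mass
  of \<open>A\<close>, the symbol.\<close>

lemma integrable_fourier_schwartz:
  fixes f :: "real ^ 'n \<Rightarrow> complex"
  assumes f: "schwartz f"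
  shows "integrable lborel (\<lambda>\<xi>. complex_of_real (1 + (norm \<xi>)\<^sup>2) * fourier f \<xi>)"
proof -
  have [measurable]: "f \<in> borel_measurable borel"
    using borel_measurable_continuous_onI[OF schwartz_continuous[OF f, of "[]"]] by simp
  obtain C where C: "\<And>\<xi>. norm (fourier f \<xi>) * (1 + norm \<xi>) ^ (2 + 2 * DIM(real ^ 'n)) \<le> C"
    using fourier_schwartz_decay[OF f, where k="2 + 2 * DIM(real ^ 'n)"] by metis
  show ?thesis
  proof (rule integrable_decay)
    fix \<xi> :: "real ^ 'n"
    have n: "\<bar>1 + (norm \<xi>)\<^sup>2\<bar> \<le> (1 + norm \<xi>)\<^sup>2" by (simp add: power2_sum abs_of_nonneg add_nonneg_nonneg)
    have "norm (complex_of_real (1 + (norm \<xi>)\<^sup>2) * fourier f \<xi>) * (1 + norm \<xi>) ^ (2 * DIM(real ^ 'n))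
      = \<bar>1 + (norm \<xi>)\<^sup>2\<bar> * (norm (fourier f \<xi>) * (1 + norm \<xi>) ^ (2 * DIM(real ^ 'n)))"
      unfolding norm_mult norm_of_real by simp
    also have "\<dots> \<le> (1 + norm \<xi>)\<^sup>2 * (norm (fourier f \<xi>) * (1 + norm \<xi>) ^ (2 * DIM(real ^ 'n)))"
      by (intro mult_right_mono n) auto
    also have "\<dots> = norm (fourier f \<xi>) * (1 + norm \<xi>) ^ (2 + 2 * DIM(real ^ 'n))" by (simp add: power_add power2_eq_square)
    also have "\<dots> \<le> C" by (rule C)
    finally show "norm (complex_of_real (1 + (norm \<xi>)\<^sup>2) * fourier f \<xi>) * (1 + norm \<xi>) ^ (2 * DIM(real ^ 'n)) \<le> C" .
  qed measurable
qed

section \<open>The weak equation\<close>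

text \<open>
  Pairing with a test function turns the equation into the family of ordinary differential
  equations for \<open>exp (s * Bsym A \<xi>)\<close>.
\<close>

locale symbol_semigroup = order_weight A for A :: "real measure" +
  fixes G :: "real \<Rightarrow> real ^ 'n \<Rightarrow> real"
  assumes G_int: "\<And>s. s > 0 \<Longrightarrow> integrable lborel (G s)"
    and G_fourier: "\<And>s \<xi>. s > 0 \<Longrightarrow> fourier (\<lambda>x. complex_of_real (G s x)) \<xi> = complex_of_real (exp (- (s * symbol \<xi>)))"
begin

lemma exp_symbol_le_1: "s \<ge> 0 \<Longrightarrow> exp (- (s * symbol \<xi>)) \<le> 1"
  by (simp add: symbol_nonneg)

text \<open>Duality together with the known transform of G(s). The symbol is even, so the reflection
  in the duality formula disappears.\<close>

lemma pairing_inv_fourier: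
  assumes s: "s > 0" and c: "integrable lborel c"
  shows "(\<integral>x. G s x *\<^sub>R inv_fourier c x \<partial>lborel)
    = complex_of_real (1 / (2 * pi) ^ CARD('n)) * (\<integral>\<xi>. exp (- (s * symbol \<xi>)) *\<^sub>R c \<xi> \<partial>lborel)"
  using inv_fourier_duality[OF integrable_of_real[OF G_int[OF s]] c]
  by (simp add: scaleR_conv_of_real G_fourier[OF s] mult.commute)

context
  fixes \<phi> :: "real ^ 'n \<Rightarrow> complex"
  assumes \<phi>: "schwartz \<phi>"
begin

lemma test_function_measurable [measurable]: "\<phi> \<in> borel_measurable borel"
  using borel_measurable_continuous_onI[OF schwartz_continuous[OF \<phi>, of "[]"]] by simp

lemma weighted_fourier_integrable:
  assumes [measurable]: "k \<in> borel_measurable borel" and k: "\<And>\<xi>. \<bar>k \<xi>\<bar> \<le> K * (1 + (norm \<xi>)\<^sup>2)"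
  shows "integrable lborel (\<lambda>\<xi>. complex_of_real (k \<xi>) * fourier \<phi> \<xi>)"
proof (rule Bochner_Integration.integrable_bound)
  show "integrable lborel (\<lambda>\<xi>. K *\<^sub>R (complex_of_real (1 + (norm \<xi>)\<^sup>2) * fourier \<phi> \<xi>))"
    by (intro integrable_scaleR_right integrable_fourier_schwartz \<phi>)
  have "norm (complex_of_real (k \<xi>) * fourier \<phi> \<xi>) \<le> norm (K *\<^sub>R (complex_of_real (1 + (norm \<xi>)\<^sup>2) * fourier \<phi> \<xi>))" for \<xi>
  proof -
    have "\<bar>k \<xi>\<bar> \<le> \<bar>K * (1 + (norm \<xi>)\<^sup>2)\<bar>" using k[of \<xi>] by linarith
    then have "\<bar>k \<xi>\<bar> * norm (fourier \<phi> \<xi>) \<le> \<bar>K * (1 + (norm \<xi>)\<^sup>2)\<bar> * norm (fourier \<phi> \<xi>)"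
      by (intro mult_right_mono) auto
    then show ?thesis unfolding norm_mult norm_of_real norm_scaleR abs_mult by (simp only: mult.assoc)
  qed
  then show "AE \<xi> in lborel. norm (complex_of_real (k \<xi>) * fourier \<phi> \<xi>)
      \<le> norm (K *\<^sub>R (complex_of_real (1 + (norm \<xi>)\<^sup>2) * fourier \<phi> \<xi>))" by simp
qed measurable

lemma fourier_integrable: "integrable lborel (fourier \<phi>)"
  using weighted_fourier_integrable[of "\<lambda>_. 1" 1] by simp

lemma symbol_fourier_integrable: "integrable lborel (\<lambda>\<xi>. complex_of_real (symbol \<xi>) * fourier \<phi> \<xi>)"
  by (rule weighted_fourier_integrable[of _ "measure A (space A)"]) (auto simp: symbol_nonneg symbol_le)

lemma test_inversion: "inv_fourier (fourier \<phi>) x = \<phi> x"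
proof -
  obtain B where B: "\<And>x. norm (iter_deriv [] \<phi> x) * (1 + norm x) ^ 0 \<le> B"
    using schwartz_bound[OF \<phi>, where vs="[]" and k=0] by metis
  have "integrable lborel \<phi>" "continuous_on UNIV \<phi>"
    using schwartz_integrable[OF \<phi>, of "[]"] schwartz_continuous[OF \<phi>, of "[]"] by simp_all
  then show ?thesis
    using inv_fourier_fourier[of \<phi> B] B fourier_integrable by simp
qed

text \<open>The orders are integrated inside the inverse transform. Since |\<xi>|^\<alpha> is
  unbounded in \<xi>, the weight 1 + |\<xi>|^2 is shifted from the kernel to the transform of the
  test function: the kernel becomes bounded by 1, and the weighted transform stays integrable. The
  indicator of (0,2] makes the bound hold for every \<alpha>.\<close>

lemma distributed_D0_eq:
  "distributed_D0 A \<phi> x = inv_fourier (\<lambda>\<xi>. complex_of_real (- symbol \<xi>) * fourier \<phi> \<xi>) x"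
proof -
  let ?f = "\<lambda>\<xi>. complex_of_real (1 + (norm \<xi>)\<^sup>2) * fourier \<phi> \<xi>"
  let ?k = "\<lambda>\<alpha> \<xi>. complex_of_real (- (indicator {0<..2} \<alpha> * norm \<xi> powr \<alpha>) / (1 + (norm \<xi>)\<^sup>2)) * iexp (- (\<xi> \<bullet> x))"
  have alg: "(p * f) * (q * i) = i * (r * f)" if "p * q = r" for p q r f i :: complex
    unfolding that[symmetric] by (simp add: mult_ac)
  have pos: "1 + (norm \<xi>)\<^sup>2 > 0" for \<xi> :: "real ^ 'n" by (smt (verit) zero_le_power2)
  have kb: "norm (?k \<alpha> \<xi>) \<le> 1" for \<alpha> \<xi>
  proof -
    have "indicator {0<..2} \<alpha> * norm \<xi> powr \<alpha> \<le> 1 + (norm \<xi>)\<^sup>2"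
      using powr_le_one_plus_power2[of \<alpha> "norm \<xi>"] pos[of \<xi>] by (auto simp: indicator_def)
    then show ?thesis using pos[of \<xi>]
      unfolding norm_mult norm_exp_i_times norm_of_real by (simp add: abs_divide abs_mult)
  qed
  have "(\<integral>\<alpha>. 1 * (\<integral>\<xi>. ?f \<xi> * ?k \<alpha> \<xi> \<partial>lborel) \<partial>A) = (\<integral>\<xi>. ?f \<xi> * (\<integral>\<alpha>. 1 * ?k \<alpha> \<xi> \<partial>A) \<partial>lborel)"
  proof (rule integral_swap_bounded_kernel(1)[where K=1])
    show "(\<lambda>(\<alpha>, \<xi>). ?k \<alpha> \<xi>) \<in> borel_measurable (A \<Otimes>\<^sub>M lborel)" by measurable
  qed (use kb integrable_fourier_schwartz[OF \<phi>] in \<open>auto intro: sigma_finite_measure_axioms sigma_finite_lborel\<close>)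
  moreover have "?f \<xi> * (\<integral>\<alpha>. 1 * ?k \<alpha> \<xi> \<partial>A) = iexp (- (\<xi> \<bullet> x)) * (complex_of_real (- symbol \<xi>) * fourier \<phi> \<xi>)" for \<xi>
  proof -
    have "(\<integral>\<alpha>. indicator {0<..2} \<alpha> * norm \<xi> powr \<alpha> \<partial>A) = symbol \<xi>"
      unfolding symbol_def by (rule integral_cong_AE) (measurable, use AE_order in \<open>eventually_elim, simp\<close>)
    then have "(\<integral>\<alpha>. complex_of_real (- (indicator {0<..2} \<alpha> * norm \<xi> powr \<alpha>) / (1 + (norm \<xi>)\<^sup>2)) \<partial>A)
        = complex_of_real (- symbol \<xi> / (1 + (norm \<xi>)\<^sup>2))"
      by (simp only: integral_complex_of_real) simp
    then have "(\<integral>\<alpha>. 1 * ?k \<alpha> \<xi> \<partial>A) = complex_of_real (- symbol \<xi> / (1 + (norm \<xi>)\<^sup>2)) * iexp (- (\<xi> \<bullet> x))"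
      by (simp only: mult_1 integral_mult_left_zero)
    moreover have "complex_of_real (1 + (norm \<xi>)\<^sup>2) * complex_of_real (- symbol \<xi> / (1 + (norm \<xi>)\<^sup>2)) = complex_of_real (- symbol \<xi>)"
      using pos[of \<xi>] unfolding of_real_mult[symmetric] by simp
    ultimately show ?thesis by (simp only:) (rule alg)
  qed
  ultimately have swap: "(\<integral>\<alpha>. (\<integral>\<xi>. ?f \<xi> * ?k \<alpha> \<xi> \<partial>lborel) \<partial>A) = (\<integral>\<xi>. iexp (- (\<xi> \<bullet> x)) * (complex_of_real (- symbol \<xi>) * fourier \<phi> \<xi>) \<partial>lborel)"
    by simp
  have "D0 \<alpha> \<phi> x = complex_of_real (1 / (2 * pi) ^ CARD('n)) * (\<integral>\<xi>. ?f \<xi> * ?k \<alpha> \<xi> \<partial>lborel)" if "\<alpha> \<in> {0<..2}" for \<alpha>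
  proof -
    have "iexp (- (\<xi> \<bullet> x)) * (complex_of_real (- (norm \<xi> powr \<alpha>)) * fourier \<phi> \<xi>) = ?f \<xi> * ?k \<alpha> \<xi>" for \<xi>
    proof -
      have "complex_of_real (1 + (norm \<xi>)\<^sup>2) * complex_of_real (- (indicator {0<..2} \<alpha> * norm \<xi> powr \<alpha>) / (1 + (norm \<xi>)\<^sup>2))
         = complex_of_real (- (norm \<xi> powr \<alpha>))"
        using pos[of \<xi>] that unfolding of_real_mult[symmetric] by simp
      then show ?thesis by (rule alg[symmetric])
    qed
    then show ?thesis unfolding D0_def inv_fourier_def by simp
  qed
  moreover have "(\<lambda>\<alpha>. D0 \<alpha> \<phi> x) \<in> borel_measurable A" unfolding D0_def inv_fourier_def by measurable
  ultimately have "distributed_D0 A \<phi> x = (\<integral>\<alpha>. complex_of_real (1 / (2 * pi) ^ CARD('n)) * (\<integral>\<xi>. ?f \<xi> * ?k \<alpha> \<xi> \<partial>lborel) \<partial>A)"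
    unfolding distributed_D0_def
    by (intro integral_cong_AE) (assumption, measurable, use AE_order in \<open>eventually_elim, blast\<close>)
  also have "\<dots> = inv_fourier (\<lambda>\<xi>. complex_of_real (- symbol \<xi>) * fourier \<phi> \<xi>) x"
    unfolding inv_fourier_def swap[symmetric] by (rule integral_mult_right_zero)
  finally show ?thesis .
qed

text \<open>On the Fourier side the pairing is an integral of exp (- s \<open>symbol \<xi>\<close>),
  which is differentiated under the integral sign; the factor - \<open>symbol \<xi>\<close> that
  appears is the symbol of the distributed operator.\<close>

lemma pairing_derivative:
  assumes t: "t > 0"
  shows "((\<lambda>s. \<integral>x. G s x *\<^sub>R \<phi> x \<partial>lborel) has_vector_derivative (\<integral>x. G t x *\<^sub>R distributed_D0 A \<phi> x \<partial>lborel)) (at t)"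
proof -
  define K where "K = complex_of_real (1 / (2 * pi) ^ CARD('n))"
  let ?E = "\<lambda>s \<xi>. exp (- (s * symbol \<xi>))"
  define I where "I s = (\<integral>\<xi>. ?E s \<xi> *\<^sub>R fourier \<phi> \<xi> \<partial>lborel)" for s
  define I' where "I' = (\<integral>\<xi>. (- symbol \<xi> * ?E t \<xi>) *\<^sub>R fourier \<phi> \<xi> \<partial>lborel)"
  have P: "(\<integral>x. G s x *\<^sub>R \<phi> x \<partial>lborel) = K * I s" if "s > 0" for s
    using pairing_inv_fourier[OF that fourier_integrable] by (simp add: test_inversion I_def K_def)
  have P': "(\<integral>x. G t x *\<^sub>R distributed_D0 A \<phi> x \<partial>lborel) = K * I'"
    using pairing_inv_fourier[OF t, of "\<lambda>\<xi>. complex_of_real (- symbol \<xi>) * fourier \<phi> \<xi>"] symbol_fourier_integrable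
    by (simp add: distributed_D0_eq I'_def K_def scaleR_conv_of_real mult_ac)
  have i1: "integrable lborel (\<lambda>\<xi>. ?E s \<xi> *\<^sub>R fourier \<phi> \<xi>)" if "s > 0" for s
    unfolding scaleR_conv_of_real
  proof (rule weighted_fourier_integrable[of _ 1])
    show "\<bar>?E s \<xi>\<bar> \<le> 1 * (1 + (norm \<xi>)\<^sup>2)" for \<xi> :: "real ^ 'n"
      using exp_symbol_le_1[of s \<xi>] that zero_le_power2[of "norm \<xi>"] by (simp only: abs_exp_cancel mult_1) linarith
  qed measurable
  have i2: "integrable lborel (\<lambda>\<xi>. (- symbol \<xi> * ?E t \<xi>) *\<^sub>R fourier \<phi> \<xi>)"
    unfolding scaleR_conv_of_real
  proof (rule weighted_fourier_integrable[of _ "measure A (space A)"])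
    show "\<bar>- symbol \<xi> * ?E t \<xi>\<bar> \<le> measure A (space A) * (1 + (norm \<xi>)\<^sup>2)" for \<xi> :: "real ^ 'n"
      using symbol_nonneg[of \<xi>] symbol_le[of \<xi>] t mult_left_le[of "?E t \<xi>" "symbol \<xi>"] by (simp add: abs_mult)
  qed measurable
  \<comment> \<open>The representation holds for positive times only, so the derivative is taken
    within \<open>{0<..}\<close>, an open set containing t. Sequences are used to make dominated
    convergence available.\<close>
  have "(I has_derivative (\<lambda>d. d *\<^sub>R I')) (at t within {0<..})"
    unfolding has_derivative_within tendsto_at_iff_sequentially comp_def
  proof (intro conjI allI impI bounded_linear_scaleR_left)
    fix y assume y: "\<forall>i. y i \<in> {0<..} - {t}" "y \<longlonglongrightarrow> t"
    let ?R = "\<lambda>i \<xi>. (1 / norm (y i - t)) *\<^sub>R (?E (y i) \<xi> - (?E t \<xi> + (y i - t) * (- symbol \<xi> * ?E t \<xi>)))"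
    have "(\<lambda>i. \<integral>\<xi>. ?R i \<xi> *\<^sub>R fourier \<phi> \<xi> \<partial>lborel) \<longlonglongrightarrow> (\<integral>\<xi>. 0 *\<^sub>R fourier \<phi> \<xi> \<partial>lborel)"
    proof (rule integral_dominated_convergence[where w="\<lambda>\<xi>. 2 * norm (complex_of_real (symbol \<xi>) * fourier \<phi> \<xi>)"])
      have "(\<lambda>i. ?R i \<xi>) \<longlonglongrightarrow> 0" for \<xi>
      proof -
        have "((\<lambda>s. ?E s \<xi>) has_derivative (\<lambda>d. d * (- symbol \<xi> * ?E t \<xi>))) (at t within {0<..})"
          by (auto intro!: derivative_eq_intros)
        then show ?thesis
          unfolding has_derivative_within tendsto_at_iff_sequentially comp_def using y by blast
      qed
      then show "AE \<xi> in lborel. (\<lambda>i. ?R i \<xi> *\<^sub>R fourier \<phi> \<xi>) \<longlonglongrightarrow> 0 *\<^sub>R fourier \<phi> \<xi>"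
        by (intro AE_I2 tendsto_scaleR tendsto_const)
      \<comment> \<open>For u \<ge> 0 the function exp (- u) is 1-Lipschitz, so the difference
        quotient and the derivative contribute at most one \<open>symbol \<xi>\<close> each.\<close>
      have R_bound: "\<bar>?R i \<xi>\<bar> \<le> 2 * symbol \<xi>" for i and \<xi> :: "real ^ 'n"
      proof -
        have yi: "y i > 0" "y i \<noteq> t" using y(1) by auto
        have lip: "\<bar>exp (- u) - exp (- v)\<bar> \<le> \<bar>u - v\<bar>" if "u \<ge> 0" "v \<ge> 0" for u v :: real
        proof -
          have "exp (- u) - exp (- v) \<le> v - u" if "0 \<le> u" "u \<le> v" for u v :: real
          proof -
            have "exp (- u) - exp (- v) = exp (- u) * (1 - exp (- (v - u)))" by (simp add: right_diff_distrib flip: exp_add)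
            also have "\<dots> \<le> 1 * (v - u)"
            proof (rule mult_mono)
              show "1 - exp (- (v - u)) \<le> v - u" using exp_ge_add_one_self[of "- (v - u)"] by linarith
            qed (use that in auto)
            finally show ?thesis by simp
          qed
          from this[of u v] this[of v u] that show ?thesis by (cases "u \<le> v") auto
        qed
        have "\<bar>?E (y i) \<xi> - ?E t \<xi>\<bar> \<le> \<bar>y i * symbol \<xi> - t * symbol \<xi>\<bar>"
          using yi t symbol_nonneg[of \<xi>] by (intro lip) auto
        also have "\<dots> = \<bar>y i - t\<bar> * symbol \<xi>"
          using symbol_nonneg[of \<xi>] by (simp add: left_diff_distrib[symmetric] abs_mult)
        finally have 1: "\<bar>?E (y i) \<xi> - ?E t \<xi>\<bar> \<le> \<bar>y i - t\<bar> * symbol \<xi>" .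
        have 2: "\<bar>(y i - t) * (- symbol \<xi> * ?E t \<xi>)\<bar> \<le> \<bar>y i - t\<bar> * symbol \<xi>"
          using symbol_nonneg[of \<xi>] t by (simp add: abs_mult mult_left_le mult_left_mono)
        have "\<bar>?E (y i) \<xi> - (?E t \<xi> + (y i - t) * (- symbol \<xi> * ?E t \<xi>))\<bar> \<le> \<bar>y i - t\<bar> * (2 * symbol \<xi>)"
          using 1 2 by linarith
        then show ?thesis using yi by (simp add: abs_mult divide_le_eq mult.commute)
      qed
      show "AE \<xi> in lborel. norm (?R i \<xi> *\<^sub>R fourier \<phi> \<xi>) \<le> 2 * norm (complex_of_real (symbol \<xi>) * fourier \<phi> \<xi>)" for i
      proof (rule AE_I2)
        fix \<xi> :: "real ^ 'n"
        have "\<bar>?R i \<xi>\<bar> * norm (fourier \<phi> \<xi>) \<le> 2 * symbol \<xi> * norm (fourier \<phi> \<xi>)"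
          by (rule mult_right_mono[OF R_bound]) simp
        then show "norm (?R i \<xi> *\<^sub>R fourier \<phi> \<xi>) \<le> 2 * norm (complex_of_real (symbol \<xi>) * fourier \<phi> \<xi>)"
          by (simp only: norm_scaleR[of "?R i \<xi>"] norm_mult norm_of_real abs_of_nonneg[OF symbol_nonneg] mult.assoc)
      qed
      show "integrable lborel (\<lambda>\<xi>. 2 * norm (complex_of_real (symbol \<xi>) * fourier \<phi> \<xi>))"
        using symbol_fourier_integrable by auto
    qed measurable
    moreover have "(\<integral>\<xi>. ?R i \<xi> *\<^sub>R fourier \<phi> \<xi> \<partial>lborel) = (1 / norm (y i - t)) *\<^sub>R (I (y i) - (I t + (y i - t) *\<^sub>R I'))" for i
    proof -
      have yi: "y i > 0" using y(1) by auto
      have lin: "(r *\<^sub>R (p - (q + d * w))) *\<^sub>R f = r *\<^sub>R (p *\<^sub>R f - (q *\<^sub>R f + d *\<^sub>R (w *\<^sub>R f)))"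
        for r p q d w :: real and f :: complex
        by (simp add: scaleR_diff_left scaleR_add_left flip: scaleR_scaleR)
      have eq: "?R i \<xi> *\<^sub>R fourier \<phi> \<xi> = (1 / norm (y i - t)) *\<^sub>R (?E (y i) \<xi> *\<^sub>R fourier \<phi> \<xi>
          - (?E t \<xi> *\<^sub>R fourier \<phi> \<xi> + (y i - t) *\<^sub>R ((- symbol \<xi> * ?E t \<xi>) *\<^sub>R fourier \<phi> \<xi>)))" for \<xi>
        by (rule lin)
      show ?thesis
        unfolding eq I_def I'_def
        by (intro has_bochner_integral_integral_eq has_bochner_integral_scaleR_right has_bochner_integral_diff
            has_bochner_integral_add has_bochner_integral_integrable i1 i2 yi t)
    qed
    ultimately show "(\<lambda>i. (1 / norm (y i - t)) *\<^sub>R (I (y i) - (I t + (y i - t) *\<^sub>R I'))) \<longlonglongrightarrow> 0" by simp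
  qed
  then have "(I has_vector_derivative I') (at t)"
    unfolding has_vector_derivative_def using t by (simp add: at_within_open[of t "{0<..}"])
  then have "((\<lambda>s. K * I s) has_vector_derivative K * I') (at t)"
    by (rule has_vector_derivative_mult_right)
  then show ?thesis
    unfolding P' by (rule has_vector_derivative_transform_within_open[of _ _ _ "{0<..}"]) (use t P in auto)
qed

text \<open>As time tends to 0 the exponential tends to 1 under the integral, which leaves the
  inversion formula for the test function at the origin.\<close>

lemma pairing_initial: "((\<lambda>t. \<integral>x. G t x *\<^sub>R \<phi> x \<partial>lborel) \<longlongrightarrow> \<phi> 0) (at_right 0)"
  unfolding tendsto_at_iff_sequentially comp_def
proof (intro allI impI)
  fix y :: "nat \<Rightarrow> real" assume y: "\<forall>i. y i \<in> {0<..} - {0}" "y \<longlonglongrightarrow> 0"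
  have "(\<lambda>i. \<integral>\<xi>. exp (- (y i * symbol \<xi>)) *\<^sub>R fourier \<phi> \<xi> \<partial>lborel) \<longlonglongrightarrow> (\<integral>\<xi>. exp (- (0 * symbol \<xi>)) *\<^sub>R fourier \<phi> \<xi> \<partial>lborel)"
  proof (rule integral_dominated_convergence[where w="\<lambda>\<xi>. norm (fourier \<phi> \<xi>)"])
    show "AE \<xi> in lborel. (\<lambda>i. exp (- (y i * symbol \<xi>)) *\<^sub>R fourier \<phi> \<xi>) \<longlonglongrightarrow> exp (- (0 * symbol \<xi>)) *\<^sub>R fourier \<phi> \<xi>"
      by (intro AE_I2 tendsto_intros y)
    show "AE \<xi> in lborel. norm (exp (- (y i * symbol \<xi>)) *\<^sub>R fourier \<phi> \<xi>) \<le> norm (fourier \<phi> \<xi>)" for i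
      using y(1) by (intro AE_I2) (simp add: mult_left_le_one_le exp_symbol_le_1 less_imp_le del: exp_le_one_iff)
  qed (use fourier_integrable in auto)
  then have "(\<lambda>i. complex_of_real (1 / (2 * pi) ^ CARD('n)) * (\<integral>\<xi>. exp (- (y i * symbol \<xi>)) *\<^sub>R fourier \<phi> \<xi> \<partial>lborel))
     \<longlonglongrightarrow> complex_of_real (1 / (2 * pi) ^ CARD('n)) * (\<integral>\<xi>. fourier \<phi> \<xi> \<partial>lborel)"
    by (intro tendsto_intros) simp
  moreover have "complex_of_real (1 / (2 * pi) ^ CARD('n)) * (\<integral>\<xi>. fourier \<phi> \<xi> \<partial>lborel) = \<phi> 0"
    using test_inversion[of 0] by (simp add: inv_fourier_def)
  moreover have "(\<integral>x. G (y i) x *\<^sub>R \<phi> x \<partial>lborel) = complex_of_real (1 / (2 * pi) ^ CARD('n)) * (\<integral>\<xi>. exp (- (y i * symbol \<xi>)) *\<^sub>R fourier \<phi> \<xi> \<partial>lborel)" for i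
    using y(1) pairing_inv_fourier[OF _ fourier_integrable, of "y i"] by (simp add: test_inversion)
  ultimately show "(\<lambda>i. \<integral>x. G (y i) x *\<^sub>R \<phi> x \<partial>lborel) \<longlonglongrightarrow> \<phi> 0" by simp
qed

end

lemma fundamental_solution: "fundamental_solution A G"
  unfolding fundamental_solution_def using G_int pairing_derivative pairing_initial by blast

end

section \<open>Admissible weights and the limit of the walk\<close>

lemma admissible_weight_order: "admissible_weight A \<Longrightarrow> order_weight A"
  by (simp add: admissible_weight_def order_weight_def order_weight_axioms_def)

text \<open>In either case \<open>A\<close> has a Lebesgue density near 2 relative to (0,2], and a
  single point is a null set.\<close>

lemma admissible_weight_no_atom:
  assumes "admissible_weight A"
  shows "emeasure A {2} = 0"
proof (cases "function_weight A")
  case True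
  then obtain a where A: "A = density lborel (\<lambda>\<alpha>. ennreal (indicator {0<..2} \<alpha> * a \<alpha>))"
    and a: "set_integrable lborel {0<..2} a" unfolding function_weight_def by blast
  have [measurable]: "(\<lambda>\<alpha>. indicator {0<..2} \<alpha> * a \<alpha>) \<in> borel_measurable borel"
    using a by (auto simp: set_integrable_def)
  have "absolutely_continuous lborel A"
    unfolding A by (rule absolutely_continuousI_density) measurable
  moreover have "{2::real} \<in> null_sets lborel" by (rule finite_imp_null_set_lborel) simp
  ultimately show ?thesis unfolding absolutely_continuous_def by auto
next
  case False
  with assms have "2 \<notin> sing_supp A" by (simp add: admissible_weight_def)
  then have "2 \<notin> {0<..2::real} \<or> (\<exists>e>0. \<exists>\<rho>. smooth_at_ball \<rho> 2 e \<and>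
      (\<forall>y \<in> ball 2 e \<inter> {0<..2}. 0 \<le> \<rho> y) \<and>
      (\<forall>E \<in> sets borel. E \<subseteq> ball 2 e \<inter> {0<..2} \<longrightarrow>
         emeasure A E = (\<integral>\<^sup>+ y. ennreal (\<rho> y) * indicator E y \<partial>lborel)))"
    unfolding sing_supp_def mem_Collect_eq de_Morgan_conj not_not .
  moreover have "2 \<in> {0<..2::real}" by simp
  ultimately obtain e \<rho> where "e > 0" and \<rho>: "\<forall>E \<in> sets borel. E \<subseteq> ball 2 e \<inter> {0<..2} \<longrightarrow>
      emeasure A E = (\<integral>\<^sup>+ y. ennreal (\<rho> y) * indicator E y \<partial>lborel)"
    by blast
  then have "emeasure A {2} = (\<integral>\<^sup>+ y. ennreal (\<rho> y) * indicator {2} y \<partial>lborel)" by auto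
  also have "\<dots> = (\<integral>\<^sup>+ y. 0 \<partial>(lborel :: real measure))"
    by (rule nn_integral_cong_AE) (use AE_lborel_singleton[of "2::real"] in \<open>eventually_elim, simp\<close>)
  finally show ?thesis by simp
qed

theorem theorem3p1:
  fixes A :: "real measure" and t :: real and h :: "nat \<Rightarrow> real"
    and M :: "nat \<Rightarrow> 'w measure" and X :: "nat \<Rightarrow> nat \<Rightarrow> 'w \<Rightarrow> int ^ 'n"
  assumes "admissible_weight A"
    and "0 < t"
    and "\<And>n. 1 \<le> n \<Longrightarrow> 0 < h n"
    and "h \<longlonglongrightarrow> 0"
    and "\<And>n. 1 \<le> n \<Longrightarrow> jump_sigma TYPE('n) A (t / real n) (h n) \<le> 1"
    and "\<And>n. 1 \<le> n \<Longrightarrow> prob_space (M n)"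
    and "\<And>n. 1 \<le> n \<Longrightarrow> prob_space.indep_vars (M n) (\<lambda>_. count_space UNIV) (X n) {1..n}"
    and "\<And>n j k. 1 \<le> n \<Longrightarrow> j \<in> {1..n} \<Longrightarrow>
           measure (M n) {w \<in> space (M n). X n j w = k} = jump_prob A (t / real n) (h n) k"
  shows "\<exists>(G :: real \<Rightarrow> real ^ 'n \<Rightarrow> real) (P :: (real ^ 'n) measure) (Y :: real ^ 'n \<Rightarrow> real ^ 'n).
           fundamental_solution A G \<and>
           (\<forall>s>0. \<forall>x. complex_of_real (G s x) =
              inv_fourier (\<lambda>\<xi>. complex_of_real (exp (s * Bsym A \<xi>))) x) \<and>
           (\<forall>x. 0 \<le> G t x) \<and>
           prob_space P \<and>
           distributed P lborel Y (\<lambda>x. ennreal (G t x)) \<and>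
           converges_in_law
             (\<lambda>n. distr (M n) borel (\<lambda>w. \<Sum>j=1..n. h n *\<^sub>R lat (X n j w)))
             (distr P borel Y)"
proof -
  interpret order_weight A by (rule admissible_weight_order) fact
  have A0: "emeasure A {0<..2} \<noteq> 0" using assms(1) by (simp add: admissible_weight_def)
  define e where "e s \<xi> = complex_of_real (exp (- (s * symbol \<xi>)))" for s and \<xi> :: "real ^ 'n"
  \<comment> \<open>The walks are described for n \<ge> 1, so sequences are indexed by
    \<open>Suc n\<close> and shifted back at the end.\<close>
  define x where "x n \<xi> = enn2real (lattice_symbol A (h (Suc n)) \<xi>)" for n and \<xi> :: "real ^ 'n"
  \<comment> \<open>The law of a single step of walk \<open>Suc n\<close>, from which walks of other
    lengths are composed.\<close>
  define \<mu> where "\<mu> n = distr (M (Suc n)) borel (\<lambda>w. h (Suc n) *\<^sub>R lat (X (Suc n) 1 w))" for n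
  define S where "S n = distr (M n) borel (\<lambda>w. \<Sum>j=1..n. h n *\<^sub>R lat (X n j w))" for n
  have jump: "lattice_jump A (M (Suc n)) (X (Suc n) j) (t / real (Suc n)) (h (Suc n))" if "j \<in> {1..Suc n}" for n j
  proof -
    interpret prob_space "M (Suc n)" by (rule assms) simp
    have "X (Suc n) j \<in> M (Suc n) \<rightarrow>\<^sub>M count_space UNIV"
      using assms(7)[of "Suc n"] that by (auto simp: indep_vars_def)
    then show ?thesis
      by unfold_locales (use assms(2) assms(3,8)[of "Suc n"] that in auto)
  qed
  have cf: "(\<integral>w. iexp (\<xi> \<bullet> (h (Suc n) *\<^sub>R lat (X (Suc n) j w))) \<partial>M (Suc n)) = complex_of_real (1 - t / real (Suc n) * x n \<xi>)"
    if "j \<in> {1..Suc n}" for n j \<xi>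
    using lattice_jump.charfun_jump[OF jump[OF that]] by (simp add: x_def)
  have \<mu>: "borel_prob (\<mu> n)" and \<mu>_cf: "charfun (\<mu> n) \<xi> = complex_of_real (1 - t / real (Suc n) * x n \<xi>)" for n \<xi>
  proof -
    interpret lattice_jump A "M (Suc n)" "X (Suc n) 1" "t / real (Suc n)" "h (Suc n)" by (rule jump) simp
    show "borel_prob (\<mu> n)" unfolding \<mu>_def
      by (intro borel_prob.intro borel_prob_axioms.intro M.prob_space_distr measurable_jump) simp
    show "charfun (\<mu> n) \<xi> = complex_of_real (1 - t / real (Suc n) * x n \<xi>)"
      unfolding charfun_def \<mu>_def using cf[of 1 n \<xi>] by (subst integral_distr[OF measurable_jump]) auto
  qed
  have x_lim: "(\<lambda>n. x n \<xi>) \<longlonglongrightarrow> symbol \<xi>" for \<xi>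
  proof -
    have "(\<lambda>n. lattice_symbol A (h (Suc n)) \<xi>) \<longlonglongrightarrow> ennreal (symbol \<xi>)"
      using lattice_symbol_tendsto[of A "\<lambda>n. h (Suc n)" \<xi>] admissible_weight_no_atom[OF assms(1)] assms(3) LIMSEQ_Suc[OF assms(4)]
      by (simp add: nn_symbol lattice_symbol_def finite_measure_axioms)
    then have "(\<lambda>n. x n \<xi>) \<longlonglongrightarrow> enn2real (ennreal (symbol \<xi>))" unfolding x_def
      by (intro tendsto_enn2real) auto
    then show ?thesis by (simp add: symbol_nonneg)
  qed
  \<comment> \<open>Here m n is any number of steps whose elapsed time m n t / n tends to s. The
    case m n = n gives the theorem, the others give the density at time s.\<close>
  have power_lim: "(\<lambda>n. complex_of_real (1 - t / real (Suc n) * x n \<xi>) ^ m (Suc n)) \<longlonglongrightarrow> e s \<xi>"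
    if m: "(\<lambda>n. real (m n) * (t / real n)) \<longlonglongrightarrow> s" for m s \<xi>
  proof -
    have "\<bar>1 - t / real (Suc n) * x n \<xi>\<bar> \<le> 1" for n
      using borel_prob.norm_charfun_le[OF \<mu>[of n], of \<xi>] unfolding \<mu>_cf norm_of_real .
    then have b: "\<bar>1 - t / real n * x (n - 1) \<xi>\<bar> \<le> 1" if "n \<ge> 1" for n using that by (cases n) auto
    have "(\<lambda>n. x (n - 1) \<xi>) \<longlonglongrightarrow> symbol \<xi>" by (rule LIMSEQ_imp_Suc) (simp add: x_lim)
    then have "(\<lambda>n. (1 - t / real n * x (n - 1) \<xi>) ^ m n) \<longlonglongrightarrow> exp (- (s * symbol \<xi>))"
      by (rule power_one_minus_tendsto_exp[OF _ _ refl b assms(2) m]) (auto simp: x_def)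
    from tendsto_of_real[OF LIMSEQ_Suc[OF this], where 'a=complex] show ?thesis by (simp add: e_def)
  qed
  have e_int: "integrable lborel (e s)" if "s > 0" for s
    unfolding e_def using integrable_exp_symbol[OF A0 that] by auto
  have e_cont: "continuous_on UNIV (e s)" for s
    unfolding e_def by (intro continuous_intros continuous_symbol)
  have limit: "\<exists>\<nu>. charfun_limit (e s) \<nu>" if s: "s > 0" for s
  proof -
    \<comment> \<open>The elapsed time m n t / n then differs from s by at most one time step t /
      n.\<close>
    define m where "m n = nat \<lfloor>real n * (s / t)\<rfloor>" for n :: nat
    have m: "s - t / real n \<le> real (m n) * (t / real n)" "real (m n) * (t / real n) \<le> s" if "n > 0" for n
    proof -
      have f: "real n * (s / t) - 1 \<le> real (m n)" "real (m n) \<le> real n * (s / t)"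
        using s assms(2) by (simp_all add: m_def)
      have c: "0 \<le> t / real n" "real n * (s / t) * (t / real n) = s" using assms(2) that by auto
      show "s - t / real n \<le> real (m n) * (t / real n)"
        using mult_right_mono[OF f(1) c(1)] unfolding left_diff_distrib c(2) by simp
      show "real (m n) * (t / real n) \<le> s" using mult_right_mono[OF f(2) c(1)] unfolding c(2) .
    qed
    have "(\<lambda>n. t / real n) \<longlonglongrightarrow> 0"
      by (intro tendsto_divide_0[OF tendsto_const] filterlim_at_top_imp_at_infinity filterlim_real_sequentially)
    then have "(\<lambda>n. s - t / real n) \<longlonglongrightarrow> s - 0" by (intro tendsto_intros)
    then have "(\<lambda>n. s - t / real n) \<longlonglongrightarrow> s" by simp
    then have "(\<lambda>n. real (m n) * (t / real n)) \<longlonglongrightarrow> s"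
    proof (rule real_tendsto_sandwich[rotated 2, OF _ tendsto_const])
      show "\<forall>\<^sub>F n in sequentially. s - t / real n \<le> real (m n) * (t / real n)"
        using eventually_gt_at_top[of 0] by eventually_elim (rule m)
      show "\<forall>\<^sub>F n in sequentially. real (m n) * (t / real n) \<le> s"
        using eventually_gt_at_top[of 0] by eventually_elim (rule m)
    qed
    then have lim: "(\<lambda>n. charfun (\<mu> n) \<xi> ^ m (Suc n)) \<longlonglongrightarrow> e s \<xi>" for \<xi>
      unfolding \<mu>_cf by (rule power_lim)
    have "\<exists>\<nu>. borel_prob \<nu> \<and> (\<forall>\<xi>. charfun \<nu> \<xi> = charfun (\<mu> n) \<xi> ^ m (Suc n))" for n
      by (rule convolution_power[OF \<mu>[of n], of "m (Suc n)"]) blast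
    then have "\<forall>n. \<exists>\<nu>. borel_prob \<nu> \<and> (\<forall>\<xi>. charfun \<nu> \<xi> = charfun (\<mu> n) \<xi> ^ m (Suc n))" by blast
    from choice[OF this] obtain \<nu> where
      \<nu>: "\<And>n. borel_prob (\<nu> n)" "\<And>n \<xi>. charfun (\<nu> n) \<xi> = charfun (\<mu> n) \<xi> ^ m (Suc n)" by blast
    have "charfun_limit (e s) \<nu>"
      by (intro charfun_limit.intro \<nu>(1) e_int[OF s] e_cont) (simp only: \<nu>(2) lim)
    then show ?thesis by blast
  qed
  define G where "G s x = Re (inv_fourier (e s) x)" for s and x :: "real ^ 'n"
  have G: "complex_of_real (G s x) = inv_fourier (e s) x" "0 \<le> G s x" "integrable lborel (G s)"
    "fourier (\<lambda>x. complex_of_real (G s x)) \<xi> = e s \<xi>" if "s > 0" for s x \<xi>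
  proof -
    obtain \<nu> where "charfun_limit (e s) \<nu>" using limit[OF \<open>s > 0\<close>] by blast
    then interpret L: charfun_limit "e s" \<nu> .
    \<comment> \<open>The density depends on the limit e s alone, not on the chosen sequence of
      laws, so the choices made for different s fit into one function G.\<close>
    have eq: "L.dens = G s" by (simp add: L.dens_def G_def fun_eq_iff)
    show "complex_of_real (G s x) = inv_fourier (e s) x" "0 \<le> G s x" "integrable lborel (G s)"
      "fourier (\<lambda>x. complex_of_real (G s x)) \<xi> = e s \<xi>"
      using L.dens[of x] L.integrable_dens L.fourier_dens[of \<xi>] unfolding eq fourier_def by auto
  qed
  interpret symbol_semigroup A G
    by unfold_locales (use G in \<open>auto simp: e_def\<close>)
  have S_cf: "charfun (S (Suc n)) \<xi> = complex_of_real (1 - t / real (Suc n) * x n \<xi>) ^ Suc n" for n \<xi>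
  proof -
    interpret prob_space "M (Suc n)" by (rule assms) simp
    have "indep_vars (\<lambda>_. borel) (\<lambda>j w. h (Suc n) *\<^sub>R lat (X (Suc n) j w)) {1..Suc n}"
      by (rule indep_vars_compose2[OF assms(7)]) auto
    from charfun_sum[OF this cf] show ?thesis unfolding S_def .
  qed
  have S: "borel_prob (S (Suc n))" for n
  proof -
    interpret prob_space "M (Suc n)" by (rule assms) simp
    have "(\<lambda>w. h (Suc n) *\<^sub>R lat (X (Suc n) j w)) \<in> borel_measurable (M (Suc n))" if "j \<in> {1..Suc n}" for j
      using lattice_jump.measurable_jump[OF jump[OF that]] .
    then show ?thesis unfolding S_def
      by (intro borel_prob.intro borel_prob_axioms.intro prob_space_distr borel_measurable_sum) auto
  qed
  have "(\<lambda>n. real n * (t / real n)) \<longlonglongrightarrow> t"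
    by (rule tendsto_eventually) (use eventually_gt_at_top[of 0] in eventually_elim, simp)
  then have "(\<lambda>n. charfun (S (Suc n)) \<xi>) \<longlonglongrightarrow> e t \<xi>" for \<xi> unfolding S_cf by (rule power_lim)
  then have "charfun_limit (e t) (\<lambda>n. S (Suc n))"
    by (intro charfun_limit.intro S e_int e_cont assms(2))
  then interpret L: charfun_limit "e t" "\<lambda>n. S (Suc n)" .
  have dens: "L.dens = G t" by (simp add: L.dens_def G_def fun_eq_iff)
  \<comment> \<open>The limit vector is realised on R^N itself, under the limit law and with the
    identity map as Y.\<close>
  let ?P = "density lborel (\<lambda>x. ennreal (G t x))"
  interpret P: borel_prob ?P using L.borel_prob_dens unfolding dens .
  have P: "distr ?P borel (\<lambda>x. x) = ?P" by (rule distr_id2) simp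
  have [measurable]: "G t \<in> borel_measurable borel" using L.dens_measurable unfolding dens .
  have cl: "converges_in_law (\<lambda>n. S (Suc n)) ?P" using L.converges_in_law_dens unfolding dens .
  show ?thesis
  proof (rule exI[of _ G], rule exI[of _ ?P], rule exI[of _ "\<lambda>x. x"], intro conjI allI impI)
    show "fundamental_solution A G" by (rule fundamental_solution)
    show "complex_of_real (G s x) = inv_fourier (\<lambda>\<xi>. complex_of_real (exp (s * Bsym A \<xi>))) x" if "s > 0" for s x
      unfolding G(1)[OF that] by (simp add: e_def[abs_def] Bsym_eq)
    show "0 \<le> G t x" for x by (rule G(2)[OF assms(2)])
    show "prob_space ?P" by (rule P.prob_space_axioms)
    show "distributed ?P lborel (\<lambda>x. x) (\<lambda>x. ennreal (G t x))"
      unfolding distributed_def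
    proof (intro conjI)
      show "distr ?P lborel (\<lambda>x. x) = ?P" by (rule distr_id2) (simp only: sets_density)
      show "(\<lambda>x. ennreal (G t x)) \<in> borel_measurable lborel"
        using L.dens_measurable unfolding dens by simp
      show "(\<lambda>x. x) \<in> ?P \<rightarrow>\<^sub>M lborel"
        by (simp only: measurable_density_eq1 measurable_ident_sets[OF refl])
    qed
    have "converges_in_law S ?P"
      unfolding converges_in_law_def
    proof (intro allI impI, rule LIMSEQ_imp_Suc)
      fix f :: "real ^ 'n \<Rightarrow> real" assume "continuous_on UNIV f \<and> bounded (range f)"
      then show "(\<lambda>n. integral\<^sup>L (S (Suc n)) f) \<longlonglongrightarrow> integral\<^sup>L ?P f"
        by (rule cl[unfolded converges_in_law_def, rule_format])
    qed
    then show "converges_in_law (\<lambda>n. distr (M n) borel (\<lambda>w. \<Sum>j=1..n. h n *\<^sub>R lat (X n j w))) (distr ?P borel (\<lambda>x. x))"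
      unfolding P S_def .
  qed
qed

end
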